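(* Let $q\in(0,1)$, $\psi\in D_q$, $1\leqslant s\leqslant\infty$, $\beta\in\mathbb{R}$, $n,p\in\mathbb{N}$, $p\leqslant n$. Put $s'=\frac{s}{s-1}$ (with $s'=\infty$ for $s=1$ and $s'=1$ for $s=\infty$) and $\varepsilon_{n-p+1}=\sup_{k\geqslant n-p+1}\left|\frac{\psi(k+1)}{\psi(k)}-q\right|$. Then the following asymptotic equality holds as $n-p\to\infty$: $$\mathcal{E}(C^\psi_{\beta,s};V_{n,p})=\frac{\psi(n-p+1)}{p}\left(\frac{\|\cos t\|_{s'}}{\pi^{1+1/s'}}K_{q,p}(s')+O(1)\left(\frac{1}{(n-p+1)(1-q)^{\sigma(s',p)}}+\frac{\varepsilon_{n-p+1}}{(1-q)^2}\min\Big\{p,\frac{1}{1-q}\Big\}\right)\right),$$ where $$K_{q,p}(s')=2^{-1/s'}\left\|\frac{\sqrt{1-2q^p\cos pt+q^{2p}}}{1-2q\cos t+q^2}\right\|_{s'},$$ $$\sigma(s',p)=\begin{cases}1,& s'=1,\ p=1,\\ 2,& 1<s'\leqslant\infty,\ p=1,\\ 3,& 1\leqslant s'\leqslant\infty,\ p\in\mathbb{N}\setminus\{1\},\end{cases}$$ and $O(1)$ is a quantity uniformly bounded in $n$, $p$, $q$, $s$, $\psi$ and $\beta$.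
   Context: Spaces. $L_s$ ($1\leqslant s<\infty$) is the space of $2\pi$-periodic functions with $\|f\|_s=\left(\int_0^{2\pi}|f(t)|^s\,dt\right)^{1/s}<\infty$; $L_\infty$ is the space of essentially bounded measurable $2\pi$-periodic functions with $\|f\|_\infty=\operatorname{ess\,sup}_t|f(t)|$; $C$ is the space of continuous $2\pi$-periodic functions with $\|f\|_C=\max_t|f(t)|$. By convention $1/s'=0$ when $s'=\infty$. $(\psi,\beta)$-derivative. Let $f\in L_1$ have Fourier series $\frac{a_0(f)}{2}+\sum_{k=1}^\infty(a_k(f)\cos kx+b_k(f)\sin kx)$, let $\psi(k)$, $k\in\mathbb{N}$, be a sequence of real numbers and $\beta\in\mathbb{R}$. If there is $\varphi\in L_1$ with Fourier series $\sum_{k=1}^\infty\frac{1}{\psi(k)}\left(a_k(f)\cos(kx+\frac{\beta\pi}{2})+b_k(f)\sin(kx+\frac{\beta\pi}{2})\right)$, then $\varphi$ is called the $(\psi,\beta)$-derivative of $f$, denoted $f^\psi_\beta$. For $\mathfrak{N}\subset L_1$, $L^\psi_\beta\mathfrak{N}$ is the set of $f\in L_1$ for which $f^\psi_\beta$ exists and belongs to $\mathfrak{N}$, and $C^\psi_\beta\mathfrak{N}=C\cap L^\psi_\beta\mathfrak{N}$. The set $D_q$, $q\in(0,1)$, consists of the sequences $\psi(k)>0$, $k\in\mathbb{N}$, with $\lim_{k\to\infty}\psi(k+1)/\psi(k)=q$. Classes. $U_s^0=\{\varphi\in L_s:\|\varphi\|_s\leqslant1,\ \int_0^{2\pi}\varphi(t)\,dt=0\}$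 and $C^\psi_{\beta,s}=C^\psi_\beta U_s^0$. De la Vallée Poussin sums. $V_{n,p}(f;x)=\frac1p\sum_{k=n-p}^{n-1}S_k(f;x)$, where $S_k(f;x)$ is the $k$th partial sum (harmonics of order at most $k$) of the Fourier series of $f$. For a class $\mathfrak{M}\subset C$, $\mathcal{E}(\mathfrak{M};V_{n,p})=\sup_{f\in\mathfrak{M}}\|f(\cdot)-V_{n,p}(f;\cdot)\|_C$. Meaning of the asymptotic notation. The parameter $p=p(n)$ may vary with $n$. "As $n-p\to\infty$, with $O(1)$ uniformly bounded in the listed parameters" means: there is an absolute constant $K$ such that for each $q\in(0,1)$ and $\psi\in D_q$ there is $N=N(\psi,q)$ such that, for all $n,p$ with $p\leqslant n$ and $n-p\geqslant N$ and all values of the other parameters, the formula holds with a quantity $O(1)$ of absolute value at most $K$. *)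

theory Defs
  imports "HOL-Analysis.Analysis" "HOL-Probability.Essential_Supremum"
begin

text \<open>
  Functions on the circle are \<open>2\<pi>\<close>-periodic functions on the reals, and exponents
  range over the extended reals \<open>1 \<le> s \<le> \<infinity>\<close>.
\<close>

definition periodic_2pi :: "(real \<Rightarrow> real) \<Rightarrow> bool" where
  "periodic_2pi f \<longleftrightarrow> (\<forall>x. f (x + 2 * pi) = f x)"

abbreviation period_measure :: "real measure" where
  "period_measure \<equiv> lebesgue_on {0..2 * pi}"

definition L_space :: "ereal \<Rightarrow> (real \<Rightarrow> real) set" where
  "L_space s = {f. periodic_2pi f \<and> f \<in> borel_measurable period_measure \<and>
     (if s = \<infinity> then esssup period_measure (\<lambda>t. ereal \<bar>f t\<bar>) < \<infinity>
      else integrable period_measure (\<lambda>t. \<bar>f t\<bar> powr real_of_ereal s))}"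

text \<open>Unnormalised measure: the constant 1 has norm \<open>(2\<pi>)\<close> to the power \<open>1/s\<close>.\<close>

definition L_norm :: "ereal \<Rightarrow> (real \<Rightarrow> real) \<Rightarrow> real" where
  "L_norm s f =
     (if s = \<infinity> then real_of_ereal (esssup period_measure (\<lambda>t. ereal \<bar>f t\<bar>))
      else (\<integral>t. \<bar>f t\<bar> powr real_of_ereal s \<partial>period_measure) powr (1 / real_of_ereal s))"

definition C_space :: "(real \<Rightarrow> real) set" where
  "C_space = {f. periodic_2pi f \<and> continuous_on UNIV f}"

text \<open>For functions in \<^const>\<open>C_space\<close> the supremum is a maximum.\<close>

definition C_norm :: "(real \<Rightarrow> real) \<Rightarrow> real" where
  "C_norm f = (SUP t. \<bar>f t\<bar>)"

definition fourier_a :: "(real \<Rightarrow> real) \<Rightarrow> nat \<Rightarrow> real" where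
  "fourier_a f k = (1 / pi) * (\<integral>t. f t * cos (real k * t) \<partial>period_measure)"

definition fourier_b :: "(real \<Rightarrow> real) \<Rightarrow> nat \<Rightarrow> real" where
  "fourier_b f k = (1 / pi) * (\<integral>t. f t * sin (real k * t) \<partial>period_measure)"

text \<open>
  \<open>\<phi>\<close> is a \<open>(\<psi>,\<beta>)\<close>-derivative of \<open>f\<close>: the Fourier series of \<open>\<phi>\<close> agrees harmonic by
  harmonic, as functions of \<open>x\<close>, with the prescribed series, whose constant term is zero.
  The derivative is determined only up to null sets, hence a relation.
\<close>

definition is_psi_beta_deriv ::
    "(nat \<Rightarrow> real) \<Rightarrow> real \<Rightarrow> (real \<Rightarrow> real) \<Rightarrow> (real \<Rightarrow> real) \<Rightarrow> bool" where
  "is_psi_beta_deriv \<psi> \<beta> f \<phi> \<longleftrightarrow>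
     \<phi> \<in> L_space 1 \<and> fourier_a \<phi> 0 = 0 \<and>
     (\<forall>k\<ge>1. \<forall>x. fourier_a \<phi> k * cos (real k * x) + fourier_b \<phi> k * sin (real k * x) =
        1 / \<psi> k * (fourier_a f k * cos (real k * x + \<beta> * pi / 2) +
                   fourier_b f k * sin (real k * x + \<beta> * pi / 2)))"

definition L_class ::
    "(nat \<Rightarrow> real) \<Rightarrow> real \<Rightarrow> (real \<Rightarrow> real) set \<Rightarrow> (real \<Rightarrow> real) set" where
  "L_class \<psi> \<beta> \<NN> = {f \<in> L_space 1. \<exists>\<phi>\<in>\<NN>. is_psi_beta_deriv \<psi> \<beta> f \<phi>}"

definition C_class ::
    "(nat \<Rightarrow> real) \<Rightarrow> real \<Rightarrow> (real \<Rightarrow> real) set \<Rightarrow> (real \<Rightarrow> real) set" where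
  "C_class \<psi> \<beta> \<NN> = C_space \<inter> L_class \<psi> \<beta> \<NN>"

text \<open>Only the values \<open>\<psi> k\<close> with \<open>k \<ge> 1\<close> are relevant.\<close>

definition D_set :: "real \<Rightarrow> (nat \<Rightarrow> real) set" where
  "D_set q = {\<psi>. (\<forall>k\<ge>1. \<psi> k > 0) \<and> (\<lambda>k. \<psi> (k + 1) / \<psi> k) \<longlonglongrightarrow> q}"

definition U0 :: "ereal \<Rightarrow> (real \<Rightarrow> real) set" where
  "U0 s = {\<phi> \<in> L_space s. L_norm s \<phi> \<le> 1 \<and> (\<integral>t. \<phi> t \<partial>period_measure) = 0}"

definition C_psi_beta_s :: "(nat \<Rightarrow> real) \<Rightarrow> real \<Rightarrow> ereal \<Rightarrow> (real \<Rightarrow> real) set" where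
  "C_psi_beta_s \<psi> \<beta> s = C_class \<psi> \<beta> (U0 s)"

definition fourier_sum :: "nat \<Rightarrow> (real \<Rightarrow> real) \<Rightarrow> real \<Rightarrow> real" where
  "fourier_sum m f x = fourier_a f 0 / 2 +
     (\<Sum>k=1..m. fourier_a f k * cos (real k * x) + fourier_b f k * sin (real k * x))"

definition vallee_poussin :: "nat \<Rightarrow> nat \<Rightarrow> (real \<Rightarrow> real) \<Rightarrow> real \<Rightarrow> real" where
  "vallee_poussin n p f x = 1 / real p * (\<Sum>k=n-p..n-1. fourier_sum k f x)"

text \<open>The supremum over the class is taken in the extended reals, so that its finiteness
  is part of any equation with a real number.\<close>

definition approx_error :: "(real \<Rightarrow> real) set \<Rightarrow> nat \<Rightarrow> nat \<Rightarrow> ereal" where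
  "approx_error \<MM> n p = (SUP f\<in>\<MM>. ereal (C_norm (\<lambda>x. f x - vallee_poussin n p f x)))"

definition conj_exponent :: "ereal \<Rightarrow> ereal" where
  "conj_exponent s = (if s = 1 then \<infinity> else if s = \<infinity> then 1 else s / (s - 1))"

text \<open>In the extended reals \<open>1 / \<infinity> = 0\<close>, which is the convention for \<open>1/s'\<close>.\<close>

definition recip_exponent :: "ereal \<Rightarrow> real" where
  "recip_exponent s = real_of_ereal (1 / s)"

definition ratio_dev :: "(nat \<Rightarrow> real) \<Rightarrow> real \<Rightarrow> nat \<Rightarrow> real" where
  "ratio_dev \<psi> q m = (SUP k\<in>{m..}. \<bar>\<psi> (k + 1) / \<psi> k - q\<bar>)"

definition K_const :: "real \<Rightarrow> nat \<Rightarrow> ereal \<Rightarrow> real" where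
  "K_const q p s' = 2 powr (- recip_exponent s') *
     L_norm s' (\<lambda>t. sqrt (1 - 2 * q ^ p * cos (real p * t) + q ^ (2 * p)) /
                     (1 - 2 * q * cos t + q\<^sup>2))"

definition sigma_exp :: "ereal \<Rightarrow> nat \<Rightarrow> nat" where
  "sigma_exp s' p = (if p = 1 then (if s' = 1 then 1 else 2) else 3)"

end

theory Submission
  imports Defs
begin

text \<open>
  Put \<open>m = n - p + 1\<close> and \<open>\<gamma> = \<beta>\<pi>/2\<close>. For \<open>f\<close> in the class with derivative \<open>\<phi>\<close>,
  \<open>f(x) - V\<^sub>n\<^sub>,\<^sub>p(f;x) = \<psi>(m)/(\<pi>p) \<integral> \<phi>(t) k(t - x) dt\<close> with
  \<open>k(t) = \<Sum>\<^sub>j min(p, j+1) \<psi>(m+j)/\<psi>(m) cos((m+j)t + \<gamma>)\<close>; replacing \<open>\<psi>(m+j)/\<psi>(m)\<close> by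
  \<open>q\<^sup>j\<close> costs the term with \<open>\<epsilon>\<^sub>m\<close> and leaves \<open>h(t) = Re (e\<^sup>i\<^sup>m\<^sup>t G(t))\<close>, where
  \<open>G = e\<^sup>i\<^sup>\<gamma> (1 - z\<^sup>p)/(1 - z)\<^sup>2\<close>, \<open>z = q e\<^sup>i\<^sup>t\<close>.

  By Hoelder's inequality the supremum over \<open>\<phi>\<close> is at most the \<open>L\<^sub>s\<^sub>'\<close>-norm of \<open>h\<close>. Conversely, if
  \<open>\<phi>\<^sub>0\<close> is extremal for \<open>h\<close>, then \<open>(\<phi>\<^sub>0(t) - \<phi>\<^sub>0(t + \<pi>/m))/2\<close> has mean zero and norm at most 1,
  and it is nearly extremal because \<open>h(t - \<pi>/m)\<close> is close to \<open>-h(t)\<close>. The norm of \<open>h\<close> is found by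
  comparing \<open>h(t + u/m)\<close> with \<open>Re (e\<^sup>i\<^sup>(\<^sup>m\<^sup>t\<^sup>+\<^sup>u\<^sup>) G(t))\<close> and averaging over the phase \<open>u\<close>. All errors are
  controlled by the \<open>L\<^sub>s\<^sub>'\<close>-modulus of continuity of \<open>G\<close> at distance of order \<open>1/m\<close>, which gives the
  powers of \<open>1 - q\<close>.
\<close>

section \<open>Integration over a period\<close>

text \<open>The constant has to be uniform in \<open>q\<close> and \<open>s\<close>, so increments
  are measured in the supremum norm wherever possible; passing to any other exponent costs at most
  \<open>2 * pi\<close>. Only for \<open>p = 1\<close>, \<open>r = 1\<close> would this waste a
  power of \<open>1 - q\<close>: there the L_1 modulus of 1/(1 - z) is controlled by the integral of
  the Poisson kernel. This is where the three cases of \<open>sigma_exp\<close> come from.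

  An extremal function need not exist when \<open>s = 1\<close>, so duality is used up to an
  arbitrary \<open>e > 0\<close>, with test functions that are bounded, periodic and Borel. Such
  functions can be translated freely, and summability of \<psi> makes each one of mean zero the
  derivative of a continuous function.

  The constant \<open>12 * pi + 32\<close>: comparing the norm of the kernel with its phase average
  costs \<open>D\<close>, the passage to mean zero \<open>D / 2\<close>, where \<open>D\<close> is
  \<open>8 * pi\<^sup>2\<close> times the first error term; replacing the coefficients costs
  \<open>32 * pi\<close> times the second. The factor \<open>1 / pi\<close> of the Fourier
  coefficients divides everything at the end.\<close>

definition bounded_periodic :: "(real \<Rightarrow> real) \<Rightarrow> bool" where
  "bounded_periodic f \<longleftrightarrow> periodic_2pi f \<and> f \<in> borel_measurable borel \<and> (\<exists>B. \<forall>x. \<bar>f x\<bar> \<le> B)"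

lemma periodic_2pi_int:
  assumes "periodic_2pi f"
  shows "f (x + 2 * pi * of_int k) = f x"
proof (induction k rule: int_induct[where k=0])
  case (step1 i)
  have "f (x + 2 * pi * of_int (i + 1)) = f ((x + 2 * pi * of_int i) + 2 * pi)"
    by (simp add: algebra_simps)
  then show ?case using assms step1 by (simp add: periodic_2pi_def)
next
  case (step2 i)
  have "f (x + 2 * pi * of_int i) = f ((x + 2 * pi * of_int (i - 1)) + 2 * pi)"
    by (simp add: algebra_simps)
  then show ?case using assms step2 by (simp add: periodic_2pi_def)
qed auto

lemma period_representative:
  obtains y and k :: int where "y \<in> {0..2 * pi}" "x = y + 2 * pi * of_int k"
proof -
  define k where "k = \<lfloor>x / (2 * pi)\<rfloor>"
  have "of_int k \<le> x / (2 * pi)" "x / (2 * pi) \<le> of_int k + 1"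
    unfolding k_def by linarith+
  then have "x - 2 * pi * of_int k \<in> {0..2 * pi}"
    by (auto simp: field_simps)
  then show ?thesis using that[of "x - 2 * pi * of_int k" k] by auto
qed

lemma C_spaceD:
  assumes "f \<in> C_space"
  shows "periodic_2pi f" "continuous_on UNIV f" "continuous_on S f"
  using assms by (auto simp: C_space_def intro: continuous_on_subset)

lemma C_space_bounded:
  assumes "f \<in> C_space"
  obtains B where "\<And>x. \<bar>f x\<bar> \<le> B"
proof -
  have "compact (f ` {0..2 * pi})"
    using C_spaceD(3)[OF assms] by (intro compact_continuous_image) auto
  then have "bounded (f ` {0..2 * pi})" by (rule compact_imp_bounded)
  then obtain B where B: "\<And>y. y \<in> {0..2 * pi} \<Longrightarrow> \<bar>f y\<bar> \<le> B"
    unfolding bounded_iff real_norm_def by blast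
  have "\<bar>f x\<bar> \<le> B" for x
  proof -
    obtain y k where "y \<in> {0..2 * pi}" "x = y + 2 * pi * of_int k" by (rule period_representative)
    then show ?thesis using B periodic_2pi_int[OF C_spaceD(1)[OF assms]] by auto
  qed
  then show ?thesis using that by blast
qed

lemma C_space_bper:
  assumes "f \<in> C_space"
  shows "bounded_periodic f"
proof -
  obtain B where "\<And>x. \<bar>f x\<bar> \<le> B" using C_space_bounded[OF assms] by metis
  then show ?thesis
    unfolding bounded_periodic_def
    using C_spaceD(1)[OF assms] borel_measurable_continuous_onI[OF C_spaceD(2)[OF assms]] by blast
qed

lemma bperD:
  assumes "bounded_periodic f"
  shows "periodic_2pi f" "f \<in> borel_measurable borel"
  using assms by (auto simp: bounded_periodic_def)

lemma bper_bounded: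
  assumes "bounded_periodic f"
  obtains B where "\<And>x. \<bar>f x\<bar> \<le> B" "B > 0"
proof -
  obtain B where "\<forall>x. \<bar>f x\<bar> \<le> B" using assms by (auto simp: bounded_periodic_def)
  then have "\<bar>f x\<bar> \<le> \<bar>B\<bar> + 1" for x using le_less_trans[of "\<bar>f x\<bar>" B "\<bar>B\<bar> + 1"] by fastforce
  then show ?thesis using that[of "\<bar>B\<bar> + 1"] by fastforce
qed

lemma finite_measure_period: "finite_measure period_measure"
  by (rule finite_measure_lebesgue_on) simp

text \<open>Measurability is kept on the Borel sets of the whole line, where composition with a
  translation preserves it, and is moved to \<open>period_measure\<close> only when an integral is
  formed.\<close>

lemma borel_measurable_period:
  "f \<in> borel_measurable borel \<Longrightarrow> f \<in> borel_measurable (lebesgue_on S)"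
  by (simp add: measurable_completion measurable_restrict_space1)

lemma bounded_integrable:
  fixes f :: "real \<Rightarrow> real"
  assumes "f \<in> borel_measurable period_measure" "\<And>x. \<bar>f x\<bar> \<le> B"
  shows "integrable period_measure f"
  by (rule finite_measure.integrable_const_bound[OF finite_measure_period, of _ B])
     (use assms in auto)

lemma bper_integrable:
  assumes "bounded_periodic f"
  shows "integrable period_measure f"
proof -
  obtain B where B: "\<And>x. \<bar>f x\<bar> \<le> B" using bper_bounded[OF assms] by metis
  show ?thesis
    by (rule bounded_integrable[OF borel_measurable_period[OF bperD(2)[OF assms]] B])
qed

lemma bper_integrable_on:
  assumes "bounded_periodic f"
  shows "f integrable_on {a..b}"
proof -
  obtain B where B: "\<And>x. \<bar>f x\<bar> \<le> B" using bper_bounded[OF assms] by metis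
  have "integrable (lebesgue_on {a..b}) f"
    by (rule finite_measure.integrable_const_bound[OF finite_measure_lebesgue_on, of _ _ B])
       (simp_all add: B borel_measurable_period[OF bperD(2)[OF assms]])
  then show ?thesis by (rule integrable_on_lebesgue_on) auto
qed

lemma period_integral_eq:
  fixes f :: "real \<Rightarrow> real"
  assumes "integrable period_measure f"
  shows "integral\<^sup>L period_measure f = integral {0..2 * pi} f"
  by (rule lebesgue_integral_eq_integral[OF assms]) auto

lemma periodic_shift: "periodic_2pi f \<Longrightarrow> periodic_2pi (\<lambda>t. f (t + a))"
  unfolding periodic_2pi_def
proof (intro allI)
  fix x assume "\<forall>x. f (x + 2 * pi) = f x"
  then have "f (x + a + 2 * pi) = f (x + a)" by blast
  then show "f (x + 2 * pi + a) = f (x + a)" by (simp add: algebra_simps)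
qed

lemma bper_shift: "bounded_periodic f \<Longrightarrow> bounded_periodic (\<lambda>t. f (t + a))"
  unfolding bounded_periodic_def
proof (elim conjE exE, intro conjI exI allI)
  assume "f \<in> borel_measurable borel"
  then show "(\<lambda>t. f (t + a)) \<in> borel_measurable borel" by measurable
qed (auto intro: periodic_shift)

text \<open>Sliding a window of length \<open>2 * pi\<close> from \<open>c\<close> to
  \<open>d\<close> drops the integral over \<open>{c..d}\<close> and gains the one over
  \<open>{c + 2 * pi..d + 2 * pi}\<close>; periodicity makes the two equal.\<close>

lemma integral_shift_period:
  assumes "bounded_periodic f"
  shows "integral {0..2 * pi} (\<lambda>t. f (t + a)) = integral {0..2 * pi} f"
proof -
  note int = bper_integrable_on[OF assms]
  have per: "integral {c + 2 * pi..d + 2 * pi} f = integral {c..d} f" for c d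
  proof -
    have "integral {c..d} f = integral {c..d} (\<lambda>t. f (t + 2 * pi))"
      using bperD(1)[OF assms] by (simp add: periodic_2pi_def)
    then show ?thesis using integral_shift_Icc_real[of c d f "2 * pi"]
      by (simp add: o_def add.commute)
  qed
  have eq: "integral {c..c + 2 * pi} f = integral {d..d + 2 * pi} f" if "c \<le> d" for c d
  proof -
    have "integral {c..d} f + integral {d..d + 2 * pi} f = integral {c..d + 2 * pi} f"
      by (rule Henstock_Kurzweil_Integration.integral_combine) (use that int in auto)
    moreover have "integral {c..c + 2 * pi} f + integral {c + 2 * pi..d + 2 * pi} f = integral {c..d + 2 * pi} f"
      by (rule Henstock_Kurzweil_Integration.integral_combine) (use that int in auto)
    ultimately show ?thesis using per[of c d] by simp
  qed
  have "integral {0..2 * pi} (\<lambda>t. f (t + a)) = integral {a..a + 2 * pi} f"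
    using integral_shift_Icc_real[of 0 "2 * pi" f a] by (simp add: o_def add.commute)
  \<comment> \<open>\<open>eq\<close> presupposes ordered left endpoints, so both orders are
    supplied and the sign of \<open>a\<close> selects one.\<close>
  also have "\<dots> = integral {0..0 + 2 * pi} f"
    using eq[of a 0] eq[of 0 a] by linarith
  finally show ?thesis by simp
qed

lemma period_integral_shift:
  assumes "bounded_periodic f"
  shows "(\<integral>t. f (t + a) \<partial>period_measure) = (\<integral>t. f t \<partial>period_measure)"
  unfolding period_integral_eq[OF bper_integrable[OF assms]]
    period_integral_eq[OF bper_integrable[OF bper_shift[OF assms]]]
  by (rule integral_shift_period[OF assms])

section \<open>The norms \<open>L\<^sub>s\<close>\<close>

lemma conj_exponent_cases:
  assumes "1 \<le> s"
  obtains "s = 1" "conj_exponent s = \<infinity>"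
    | "s = \<infinity>" "conj_exponent s = 1"
    | a b where "s = ereal a" "conj_exponent s = ereal b" "a > 1" "b > 1" "1 / a + 1 / b = 1"
proof (cases s)
  case (real a)
  show ?thesis
  proof (cases "a = 1")
    case True
    then show ?thesis using that(1) real by (simp add: conj_exponent_def one_ereal_def)
  next
    case False
    with assms real have a: "a > 1" by (simp add: one_ereal_def)
    have "conj_exponent s = ereal (a / (a - 1))"
      using real a by (simp add: conj_exponent_def one_ereal_def)
    moreover have "a / (a - 1) > 1" "1 / a + 1 / (a / (a - 1)) = 1"
      using a by (auto simp: field_simps)
    ultimately show ?thesis using that(3)[of a "a / (a - 1)"] real a by blast
  qed
next
  case PInf
  then show ?thesis using that(2) by (simp add: conj_exponent_def)
next
  case MInf
  then show ?thesis using assms by simp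
qed

lemma conj_exponent_ge_1:
  assumes "1 \<le> s" shows "1 \<le> conj_exponent s"
  using assms by (rule conj_exponent_cases) (auto simp: one_ereal_def)

lemma exponent_cases:
  assumes "1 \<le> (r::ereal)"
  obtains "r = \<infinity>" | b where "r = ereal b" "1 \<le> b"
  using assms by (cases r) (auto simp: one_ereal_def)

lemma L_norm_real:
  "L_norm (ereal r) f = (\<integral>t. \<bar>f t\<bar> powr r \<partial>period_measure) powr (1 / r)"
  by (simp add: L_norm_def)

lemma L_space_real:
  "f \<in> L_space (ereal r) \<longleftrightarrow> periodic_2pi f \<and> f \<in> borel_measurable period_measure \<and>
     integrable period_measure (\<lambda>t. \<bar>f t\<bar> powr r)"
  by (simp add: L_space_def)

section \<open>Essential suprema over the period\<close>

lemma measure_period: "measure period_measure {0..2 * pi} = 2 * pi"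
  by (simp add: measure_restrict_space)

lemma emeasure_period: "emeasure period_measure {0..2 * pi} = ennreal (2 * pi)"
  by (simp add: emeasure_restrict_space)

text \<open>The period has positive measure, so its almost-everywhere filter is proper. This turns
  an absurdity that holds almost everywhere into a contradiction.\<close>

lemma period_AE_const: "(AE x in period_measure. P) \<longleftrightarrow> P"
proof (cases P)
  case False
  have "emeasure period_measure (space period_measure) \<noteq> 0"
    by (simp add: emeasure_period)
  then show ?thesis
    using False ae_filter_eq_bot_iff[of period_measure] by (simp add: trivial_limit_def)
qed simp

text \<open>Rules out the value \<open>-\<infinity>\<close>, so that \<open>real_of_ereal\<close> in
  \<open>L_norm\<close> loses nothing when the essential supremum is finite. At \<infinity> it would
  return 0, which is why membership in \<open>L_space \<infinity>\<close> accompanies the norm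
  below.\<close>

lemma esssup_abs_nonneg: "0 \<le> esssup period_measure (\<lambda>t. ereal \<bar>f t\<bar>)"
proof (rule ccontr)
  assume neg: "\<not> ?thesis"
  have "AE t in period_measure. ereal \<bar>f t\<bar> \<le> esssup period_measure (\<lambda>t. ereal \<bar>f t\<bar>)"
    by (rule esssup_AE)
  then have "AE t in period_measure. False"
  proof eventually_elim
    case (elim t)
    then have "ereal \<bar>f t\<bar> < 0" using neg by (meson le_less_trans not_le)
    then show False by simp
  qed
  then show False by (simp add: period_AE_const)
qed

lemma L_norm_nonneg: "0 \<le> L_norm r f"
  by (simp add: L_norm_def real_of_ereal_pos esssup_abs_nonneg)

lemma L_norm_inf_le:
  assumes "f \<in> borel_measurable period_measure" "AE t in period_measure. \<bar>f t\<bar> \<le> B"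
  shows "L_norm \<infinity> f \<le> B" "esssup period_measure (\<lambda>t. ereal \<bar>f t\<bar>) \<le> ereal B"
proof -
  show *: "esssup period_measure (\<lambda>t. ereal \<bar>f t\<bar>) \<le> ereal B"
    using assms by (intro esssup_I) auto
  show "L_norm \<infinity> f \<le> B"
    using * esssup_abs_nonneg[of f] unfolding L_norm_def
    by (cases "esssup period_measure (\<lambda>t. ereal \<bar>f t\<bar>)") auto
qed

lemma AE_le_L_norm_inf:
  assumes "f \<in> L_space \<infinity>"
  shows "AE t in period_measure. \<bar>f t\<bar> \<le> L_norm \<infinity> f"
proof -
  have "esssup period_measure (\<lambda>t. ereal \<bar>f t\<bar>) < \<infinity>"
    using assms by (simp add: L_space_def)
  then have "esssup period_measure (\<lambda>t. ereal \<bar>f t\<bar>) = ereal (L_norm \<infinity> f)"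
    using esssup_abs_nonneg[of f] unfolding L_norm_def
    by (cases "esssup period_measure (\<lambda>t. ereal \<bar>f t\<bar>)") auto
  then show ?thesis
    using esssup_AE[of "\<lambda>t. ereal \<bar>f t\<bar>" period_measure] by simp
qed

lemma bper_L_space_inf: "bounded_periodic f \<Longrightarrow> f \<in> L_space \<infinity>"
proof -
  assume f: "bounded_periodic f"
  obtain B where B: "\<And>x. \<bar>f x\<bar> \<le> B" using bper_bounded[OF f] by metis
  have "esssup period_measure (\<lambda>t. ereal \<bar>f t\<bar>) \<le> ereal B"
    by (rule L_norm_inf_le(2)[OF borel_measurable_period[OF bperD(2)[OF f]]]) (simp add: B)
  then have "esssup period_measure (\<lambda>t. ereal \<bar>f t\<bar>) < \<infinity>"
    by (rule le_less_trans) simp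
  then show ?thesis
    unfolding L_space_def using bperD(1)[OF f] borel_measurable_period[OF bperD(2)[OF f]] by simp
qed

text \<open>By continuity the set where \<open>\<bar>f t\<bar>\<close> stays below the norm is
  closed, and it contains almost every point of the open period. A closed set of that kind contains
  the whole interval, then its closure and, by periodicity, the line. Pointwise evaluation thus
  becomes available for exponent \<infinity>.\<close>

lemma le_L_norm_inf:
  assumes "f \<in> C_space"
  shows "\<bar>f t\<bar> \<le> L_norm \<infinity> f"
proof -
  let ?L = "L_norm \<infinity> f"
  have "AE t in period_measure. \<bar>f t\<bar> \<le> ?L"
    using assms by (intro AE_le_L_norm_inf bper_L_space_inf C_space_bper)
  then have "AE t\<in>{0..2 * pi} in lebesgue. \<bar>f t\<bar> \<le> ?L"
    by (simp add: AE_restrict_space_iff)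
  then have ae: "AE t\<in>{0<..<2 * pi} in lebesgue. t \<in> {t. \<bar>f t\<bar> \<le> ?L}"
    by eventually_elim auto
  have cl: "closed {t. \<bar>f t\<bar> \<le> ?L}"
    using C_spaceD(2)[OF assms] by (intro closed_Collect_le continuous_intros) auto
  have "\<bar>f t\<bar> \<le> ?L" if "t \<in> {0<..<2 * pi}" for t
    using mem_closed_if_AE_lebesgue_open[OF _ cl ae that] by simp
  then have "{0<..<2 * pi} \<subseteq> {t. \<bar>f t\<bar> \<le> ?L}" by blast
  then have "closure {0<..<2 * pi} \<subseteq> {t. \<bar>f t\<bar> \<le> ?L}"
    using cl by (rule closure_minimal)
  then have *: "\<bar>f t\<bar> \<le> ?L" if "t \<in> {0..2 * pi}" for t
    using that by auto
  obtain y k where "y \<in> {0..2 * pi}" "t = y + 2 * pi * of_int k" by (rule period_representative)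
  then show ?thesis using * periodic_2pi_int[OF C_spaceD(1)[OF assms]] by simp
qed

section \<open>Closure properties of bounded periodic functions\<close>

lemma bper_abs_powr:
  assumes "bounded_periodic f" "0 \<le> r"
  shows "bounded_periodic (\<lambda>t. \<bar>f t\<bar> powr r)"
proof -
  obtain B where B: "\<And>x. \<bar>f x\<bar> \<le> B" using bper_bounded[OF assms(1)] by metis
  have [measurable]: "f \<in> borel_measurable borel" by (rule bperD(2)[OF assms(1)])
  have "\<bar>\<bar>f x\<bar> powr r\<bar> \<le> B powr r" for x
    using B assms(2) by (simp add: powr_mono2)
  then show ?thesis
    using bperD(1)[OF assms(1)] by (auto simp: bounded_periodic_def periodic_2pi_def)
qed

lemma bper_add: "bounded_periodic f \<Longrightarrow> bounded_periodic g \<Longrightarrow> bounded_periodic (\<lambda>t. f t + g t)"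
proof -
  assume f: "bounded_periodic f" and g: "bounded_periodic g"
  obtain B where B: "\<And>x. \<bar>f x\<bar> \<le> B" using bper_bounded[OF f] by metis
  obtain C where C: "\<And>x. \<bar>g x\<bar> \<le> C" using bper_bounded[OF g] by metis
  have "\<bar>f x + g x\<bar> \<le> B + C" for x
    using B[of x] C[of x] by linarith
  then show ?thesis
    using bperD[OF f] bperD[OF g] by (auto simp: bounded_periodic_def periodic_2pi_def)
qed

lemma bper_mult: "bounded_periodic f \<Longrightarrow> bounded_periodic g \<Longrightarrow> bounded_periodic (\<lambda>t. f t * g t)"
proof -
  assume f: "bounded_periodic f" and g: "bounded_periodic g"
  obtain B where B: "\<And>x. \<bar>f x\<bar> \<le> B" "B > 0" using bper_bounded[OF f] by metis
  obtain C where C: "\<And>x. \<bar>g x\<bar> \<le> C" "C > 0" using bper_bounded[OF g] by metis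
  have "\<bar>f x * g x\<bar> \<le> B * C" for x
    using B(1)[of x] C(1)[of x] B(2) by (simp add: abs_mult mult_mono')
  then show ?thesis
    using bperD[OF f] bperD[OF g] by (auto simp: bounded_periodic_def periodic_2pi_def)
qed

lemma bper_const: "bounded_periodic (\<lambda>t. c)"
  by (auto simp: bounded_periodic_def periodic_2pi_def)

lemma bper_cmult: "bounded_periodic f \<Longrightarrow> bounded_periodic (\<lambda>t. c * f t)"
  by (intro bper_mult bper_const)

lemma bper_diff: "bounded_periodic f \<Longrightarrow> bounded_periodic g \<Longrightarrow> bounded_periodic (\<lambda>t. f t - g t)"
  using bper_add[of f "\<lambda>t. (-1) * g t"] bper_cmult[of g "-1"] by simp

lemma bper_abs: "bounded_periodic f \<Longrightarrow> bounded_periodic (\<lambda>t. \<bar>f t\<bar>)"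
  by (auto simp: bounded_periodic_def periodic_2pi_def)

lemma bper_L_space:
  assumes "bounded_periodic f" "1 \<le> r"
  shows "f \<in> L_space r"
  using assms(2)
proof (cases rule: exponent_cases)
  case 1
  then show ?thesis using bper_L_space_inf assms(1) by simp
next
  case (2 b)
  then show ?thesis
    using bper_integrable[OF bper_abs_powr[OF assms(1), of b]] bperD(1)[OF assms(1)]
      borel_measurable_period[OF bperD(2)[OF assms(1)]]
    by (simp add: L_space_real)
qed

section \<open>Monotonicity, homogeneity, translation invariance and Minkowski's inequality\<close>

lemma powr_root_le_iff:
  fixes I N r :: real
  assumes "0 \<le> I" "0 \<le> N" "1 \<le> r"
  shows "I powr (1 / r) \<le> N \<longleftrightarrow> I \<le> N powr r"
proof
  assume "I powr (1 / r) \<le> N"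
  then have "(I powr (1 / r)) powr r \<le> N powr r" using assms by (intro powr_mono2) auto
  then show "I \<le> N powr r" using assms by (simp add: powr_powr)
next
  assume "I \<le> N powr r"
  then have "I powr (1 / r) \<le> (N powr r) powr (1 / r)" using assms by (intro powr_mono2) auto
  then show "I powr (1 / r) \<le> N" using assms by (simp add: powr_powr)
qed

lemma L_norm_real_le_iff:
  assumes "0 \<le> N" "1 \<le> r"
  shows "L_norm (ereal r) f \<le> N \<longleftrightarrow> (\<integral>t. \<bar>f t\<bar> powr r \<partial>period_measure) \<le> N powr r"
  unfolding L_norm_real using assms by (intro powr_root_le_iff) auto

lemma L_norm_powr:
  assumes "1 \<le> r"
  shows "L_norm (ereal r) f powr r = (\<integral>t. \<bar>f t\<bar> powr r \<partial>period_measure)"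
  unfolding L_norm_real using assms by (simp add: powr_powr)

lemma L_norm_mono:
  assumes "bounded_periodic f" "bounded_periodic g" "1 \<le> r" "\<And>t. \<bar>f t\<bar> \<le> \<bar>g t\<bar>"
  shows "L_norm r f \<le> L_norm r g"
  using assms(3)
proof (cases rule: exponent_cases)
  case 1
  have "AE t in period_measure. \<bar>f t\<bar> \<le> L_norm \<infinity> g"
    using AE_le_L_norm_inf[OF bper_L_space_inf[OF assms(2)]]
    by eventually_elim (use assms(4) order_trans in blast)
  then show ?thesis
    using L_norm_inf_le(1)[OF borel_measurable_period[OF bperD(2)[OF assms(1)]]] 1 by simp
next
  case (2 b)
  have "(\<integral>t. \<bar>f t\<bar> powr b \<partial>period_measure) \<le> (\<integral>t. \<bar>g t\<bar> powr b \<partial>period_measure)"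
    using 2 assms by (intro integral_mono bper_integrable bper_abs_powr powr_mono2) auto
  then show ?thesis unfolding 2 L_norm_real using 2(2) by (intro powr_mono2) auto
qed

lemma L_norm_cmult:
  assumes "bounded_periodic f" "1 \<le> r"
  shows "L_norm r (\<lambda>t. c * f t) = \<bar>c\<bar> * L_norm r f"
  using assms(2)
proof (cases rule: exponent_cases)
  case 1
  have le: "L_norm \<infinity> (\<lambda>t. d * g t) \<le> \<bar>d\<bar> * L_norm \<infinity> g" if "bounded_periodic g" for d g
  proof (rule L_norm_inf_le(1)[OF borel_measurable_period[OF bperD(2)[OF bper_cmult[OF that]]]])
    show "AE t in period_measure. \<bar>d * g t\<bar> \<le> \<bar>d\<bar> * L_norm \<infinity> g"
      using AE_le_L_norm_inf[OF bper_L_space_inf[OF that]]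
      by eventually_elim (simp add: abs_mult mult_left_mono)
  qed
  show ?thesis
  proof (cases "c = 0")
    case True
    then show ?thesis using le[OF assms(1), of 0] L_norm_nonneg[of r "\<lambda>t. 0"] 1 by simp
  next
    case False
    have "L_norm \<infinity> f \<le> \<bar>1 / c\<bar> * L_norm \<infinity> (\<lambda>t. c * f t)"
      using le[OF bper_cmult[OF assms(1)], of "1 / c" c] False by simp
    then have "\<bar>c\<bar> * L_norm \<infinity> f \<le> L_norm \<infinity> (\<lambda>t. c * f t)"
      using False by (simp add: field_simps)
    then show ?thesis using le[OF assms(1), of c] 1 by simp
  qed
next
  case (2 b)
  then show ?thesis
    by (simp add: L_norm_real abs_mult powr_mult powr_powr)
qed

lemma L_norm_shift:
  assumes "bounded_periodic f" "1 \<le> r"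
  shows "L_norm r (\<lambda>t. f (t + a)) = L_norm r f"
  using assms(2)
proof (cases rule: exponent_cases)
  case 1
  have le: "L_norm \<infinity> (\<lambda>t. g (t + a)) \<le> L_norm \<infinity> g" if g: "bounded_periodic g" for a g
  proof -
    \<comment> \<open>\<open>P\<close> is the indicator of the exceptional set. Invariance of its
      integral shows that the translated exceptional set is null as well.\<close>
    define P where "P = (\<lambda>t. if \<bar>g t\<bar> \<le> L_norm \<infinity> g then 0 else 1 :: real)"
    have [measurable]: "g \<in> borel_measurable borel" by (rule bperD(2)[OF g])
    have P: "bounded_periodic P" using bperD[OF g]
      by (auto simp: P_def bounded_periodic_def periodic_2pi_def intro!: exI[of _ 1])
    have "(\<integral>t. P t \<partial>period_measure) = (\<integral>t. 0 \<partial>period_measure)"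
      using AE_le_L_norm_inf[OF bper_L_space_inf[OF g]]
      by (intro integral_cong_AE) (auto simp: P_def borel_measurable_period[OF bperD(2)[OF P, unfolded P_def]])
    then have "(\<integral>t. P (t + a) \<partial>period_measure) = 0"
      using period_integral_shift[OF P] by simp
    then have "AE t in period_measure. P (t + a) = 0"
      by (subst integral_nonneg_eq_0_iff_AE[symmetric])
         (use bper_integrable[OF bper_shift[OF P]] in \<open>auto simp: P_def\<close>)
    then have "AE t in period_measure. \<bar>g (t + a)\<bar> \<le> L_norm \<infinity> g"
      by eventually_elim (auto simp: P_def split: if_splits)
    then show ?thesis
      by (rule L_norm_inf_le(1)[OF borel_measurable_period[OF bperD(2)[OF bper_shift[OF g]]]])
  qed
  show ?thesis
    using le[OF assms(1), of a] le[OF bper_shift[OF assms(1), of a], of "- a"] 1 by simp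
next
  case (2 b)
  then show ?thesis
    using period_integral_shift[OF bper_abs_powr[OF assms(1)], of b a] by (simp add: L_norm_real)
qed

text \<open>The sharp factor is the power \<open>1 / r\<close> of \<open>2 * pi\<close>; since
  \<open>2 * pi \<ge> 1\<close>, the first power dominates it for every \<open>r \<ge> 1\<close>.
  The cruder factor makes all later estimates uniform in the exponent.\<close>

lemma L_norm_const_le:
  assumes "bounded_periodic f" "1 \<le> r" "\<And>t. \<bar>f t\<bar> \<le> B"
  shows "L_norm r f \<le> 2 * pi * B"
proof -
  have B: "0 \<le> B" using assms(3)[of 0] by linarith
  have pi: "2 * pi \<ge> 1" using pi_gt3 by simp
  show ?thesis
  using assms(2)
  proof (cases rule: exponent_cases)
    case 1
    have "L_norm r f \<le> B"
      using L_norm_inf_le(1)[OF borel_measurable_period[OF bperD(2)[OF assms(1)]]] assms(3) 1 by simp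
    also have "B \<le> 2 * pi * B" using B pi mult_right_mono by fastforce
    finally show ?thesis .
  next
    case (2 b)
    have "(\<integral>t. \<bar>f t\<bar> powr b \<partial>period_measure) \<le> (\<integral>t. B powr b \<partial>period_measure)"
      using 2 assms by (intro integral_mono bper_integrable bper_abs_powr powr_mono2 bper_const) auto
    also have "\<dots> = 2 * pi * B powr b" by (simp add: measure_period)
    also have "\<dots> \<le> (2 * pi) powr b * B powr b"
      using powr_mono[of 1 b "2 * pi"] 2 pi by (intro mult_right_mono) auto
    also have "\<dots> = (2 * pi * B) powr b" using B by (simp add: powr_mult)
    finally show ?thesis
      unfolding 2 using 2 B by (subst L_norm_real_le_iff) auto
  qed
qed

text \<open>On the open half-line this is convexity of the power; if one of the points is 0 it
  reduces to \<open>c powr r \<le> c\<close> for \<open>c\<close> between 0 and 1.\<close>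

lemma powr_convex_nonneg:
  fixes x y l m r :: real
  assumes "0 \<le> x" "0 \<le> y" "0 \<le> l" "0 \<le> m" "l + m = 1" "1 \<le> r"
  shows "(l * x + m * y) powr r \<le> l * x powr r + m * y powr r"
proof (cases "x = 0 \<or> y = 0")
  case True
  have *: "(c * z) powr r \<le> c * z powr r" if "0 \<le> c" "c \<le> 1" "0 \<le> z" for c z :: real
  proof -
    have "c powr r \<le> c"
      using powr_mono'[of 1 r c] that assms(6) by simp
    then show ?thesis using that by (simp add: powr_mult mult_right_mono)
  qed
  have "l \<le> 1" "m \<le> 1" using assms by auto
  then show ?thesis using True *[of l x] *[of m y] assms by auto
next
  case False
  then have "x \<in> {0<..}" "y \<in> {0<..}" using assms by auto
  moreover have l: "l = 1 - m" using assms(5) by simp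
  ultimately show ?thesis
    using convex_onD[OF powr_convex[OF assms(6)], of m x y] assms(4,3) unfolding l by simp
qed

text \<open>Minkowski's inequality from convexity:
  \<open>(\<bar>f t\<bar> + \<bar>g t\<bar>) / (F + G)\<close> is a convex combination of
  \<open>\<bar>f t\<bar> / F\<close> and \<open>\<bar>g t\<bar> / G\<close>, whose
  \<open>b\<close>-th powers have integral at most 1.\<close>

lemma L_norm_triangle:
  assumes f: "bounded_periodic f" and g: "bounded_periodic g" and r: "1 \<le> r"
  shows "L_norm r (\<lambda>t. f t + g t) \<le> L_norm r f + L_norm r g"
  using r
proof (cases rule: exponent_cases)
  case 1
  have "AE t in period_measure. \<bar>f t + g t\<bar> \<le> L_norm \<infinity> f + L_norm \<infinity> g"
    using AE_le_L_norm_inf[OF bper_L_space_inf[OF f]] AE_le_L_norm_inf[OF bper_L_space_inf[OF g]]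
    by eventually_elim linarith
  then show ?thesis unfolding 1
    by (rule L_norm_inf_le(1)[OF borel_measurable_period[OF bperD(2)[OF bper_add[OF f g]]]])
next
  case (2 b)
  show ?thesis
  proof (rule field_le_epsilon)
    fix e :: real assume e: "e > 0"
    \<comment> \<open>The slack \<open>e / 2\<close> keeps \<open>F\<close> and \<open>G\<close>
      positive even for functions of norm zero, so that one may divide by them.\<close>
    define F where "F = L_norm r f + e / 2"
    define G where "G = L_norm r g + e / 2"
    have F: "F > 0" and G: "G > 0" using e L_norm_nonneg by (auto simp: F_def G_def add_nonneg_pos)
    have iF: "(\<integral>t. \<bar>f t\<bar> powr b \<partial>period_measure) \<le> F powr b"
      using L_norm_real_le_iff[of F b f] 2 F e by (simp add: F_def)
    have iG: "(\<integral>t. \<bar>g t\<bar> powr b \<partial>period_measure) \<le> G powr b"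
      using L_norm_real_le_iff[of G b g] 2 G e by (simp add: G_def)
    define l where "l = F / (F + G)"
    define m where "m = G / (F + G)"
    have lm: "0 \<le> l" "0 \<le> m" "l + m = 1"
      using F G by (simp_all add: l_def m_def add_divide_distrib[symmetric])
    have pt: "\<bar>f t + g t\<bar> powr b \<le> (F + G) powr b *
        (l * (\<bar>f t\<bar> powr b / F powr b) + m * (\<bar>g t\<bar> powr b / G powr b))" for t
    proof -
      define x where "x = \<bar>f t\<bar> / F"
      define y where "y = \<bar>g t\<bar> / G"
      have xy: "0 \<le> x" "0 \<le> y" using F G by (simp_all add: x_def y_def)
      have "\<bar>f t + g t\<bar> \<le> F * x + G * y"
        using F G abs_triangle_ineq by (simp add: x_def y_def)
      also have "\<dots> = (F + G) * (l * x + m * y)"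
      proof -
        have "F + G \<noteq> 0" using F G by simp
        then show ?thesis by (simp add: l_def m_def distrib_left)
      qed
      finally have "\<bar>f t + g t\<bar> powr b \<le> ((F + G) * (l * x + m * y)) powr b"
        using 2 by (intro powr_mono2) simp_all
      also have "\<dots> = (F + G) powr b * (l * x + m * y) powr b"
        by (rule powr_mult)
      also have "\<dots> \<le> (F + G) powr b * (l * x powr b + m * y powr b)"
        using lm xy 2 by (intro mult_left_mono powr_convex_nonneg) simp_all
      also have "x powr b = \<bar>f t\<bar> powr b / F powr b"
        unfolding x_def by (rule powr_divide)
      also have "y powr b = \<bar>g t\<bar> powr b / G powr b"
        unfolding y_def by (rule powr_divide)
      finally show ?thesis .
    qed
    let ?u = "\<lambda>t. \<bar>f t\<bar> powr b / F powr b" and ?v = "\<lambda>t. \<bar>g t\<bar> powr b / G powr b"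
    have b0: "0 \<le> b" using 2 by simp
    have int: "integrable period_measure ?u" "integrable period_measure ?v"
      by (rule integrable_divide_zero, rule bper_integrable, rule bper_abs_powr, rule f g, rule b0)+
    have iF1: "(\<integral>t. ?u t \<partial>period_measure) \<le> 1" and iG1: "(\<integral>t. ?v t \<partial>period_measure) \<le> 1"
      using iF iG F G by simp_all
    have "(\<integral>t. \<bar>f t + g t\<bar> powr b \<partial>period_measure)
        \<le> (\<integral>t. (F + G) powr b * (l * ?u t + m * ?v t) \<partial>period_measure)"
    proof (rule integral_mono[OF _ _ pt])
      show "integrable period_measure (\<lambda>t. \<bar>f t + g t\<bar> powr b)"
        by (rule bper_integrable[OF bper_abs_powr[OF bper_add[OF f g] b0]])
      show "integrable period_measure (\<lambda>t. (F + G) powr b * (l * ?u t + m * ?v t))"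
        by (intro integrable_mult_right Bochner_Integration.integrable_add int)
    qed
    also have "\<dots> = (F + G) powr b * (l * (\<integral>t. ?u t \<partial>period_measure) + m * (\<integral>t. ?v t \<partial>period_measure))"
    proof -
      have "(\<integral>t. l * ?u t + m * ?v t \<partial>period_measure) = l * (\<integral>t. ?u t \<partial>period_measure) + m * (\<integral>t. ?v t \<partial>period_measure)"
        using Bochner_Integration.integral_add[OF integrable_mult_right[OF int(1)] integrable_mult_right[OF int(2)], of l m]
        by (simp only: integral_mult_right_zero)
      then show ?thesis by (simp only: integral_mult_right_zero)
    qed
    also have "\<dots> \<le> (F + G) powr b * (l * 1 + m * 1)"
      by (intro mult_left_mono add_mono iF1 iG1 lm) simp
    finally have "(\<integral>t. \<bar>f t + g t\<bar> powr b \<partial>period_measure) \<le> (F + G) powr b"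
      unfolding mult_1_right lm(3) .
    then have "L_norm r (\<lambda>t. f t + g t) \<le> F + G"
      using L_norm_real_le_iff[of "F + G" b] 2 F G by simp
    then show "L_norm r (\<lambda>t. f t + g t) \<le> L_norm r f + L_norm r g + e"
      unfolding F_def G_def by linarith
  qed
qed

section \<open>Duality\<close>

lemma L_space_integrable:
  assumes "1 \<le> s" "f \<in> L_space s"
  shows "integrable period_measure f"
  using assms(1)
proof (cases rule: exponent_cases)
  case 1
  have "f \<in> borel_measurable period_measure" using assms by (simp add: L_space_def)
  then show ?thesis
    using AE_le_L_norm_inf assms(2) 1
    by (intro finite_measure.integrable_const_bound[OF finite_measure_period, of _ "L_norm \<infinity> f"]) simp_all
next
  case (2 b)
  have f: "f \<in> borel_measurable period_measure" "integrable period_measure (\<lambda>t. \<bar>f t\<bar> powr b)"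
    using assms(2) unfolding 2 L_space_real by blast+
  have "\<bar>y\<bar> \<le> 1 + \<bar>y\<bar> powr b" for y :: real
  proof (cases "\<bar>y\<bar> \<le> 1")
    case True
    then show ?thesis using powr_ge_zero[of "\<bar>y\<bar>" b] by linarith
  next
    case False
    then show ?thesis using powr_mono[of 1 b "\<bar>y\<bar>"] 2 by simp
  qed
  then show ?thesis
    by (intro Bochner_Integration.integrable_bound[where f="\<lambda>t. 1 + \<bar>f t\<bar> powr b" and g=f]
        Bochner_Integration.integrable_add f bper_integrable bper_const) simp
qed

lemma integrable_mult_bper:
  assumes "integrable period_measure f" "bounded_periodic h"
  shows "integrable period_measure (\<lambda>t. f t * h t)"
proof -
  obtain B where B: "\<And>x. \<bar>h x\<bar> \<le> B" using bper_bounded[OF assms(2)] by metis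
  have [measurable]: "h \<in> borel_measurable period_measure"
    by (rule borel_measurable_period[OF bperD(2)[OF assms(2)]])
  have [measurable]: "f \<in> borel_measurable period_measure"
    using assms(1) by (rule borel_measurable_integrable)
  show ?thesis
  proof (rule Bochner_Integration.integrable_bound)
    show "integrable period_measure (\<lambda>t. B * f t)" using assms(1) by simp
    show "AE t in period_measure. norm (f t * h t) \<le> norm (B * f t)"
    proof (rule AE_I2)
      fix t
      have "\<bar>h t\<bar> \<le> \<bar>B\<bar>" using B[of t] by linarith
      then show "norm (f t * h t) \<le> norm (B * f t)"
        using mult_left_mono[of "\<bar>h t\<bar>" "\<bar>B\<bar>" "\<bar>f t\<bar>"] by (simp add: abs_mult mult.commute)
    qed
  qed measurable
qed

text \<open>\<open>f\<close> ranges over all of L_s because derivatives in the class may be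
  unbounded, whereas the kernels paired with them are bounded; the product is therefore integrable
  from the outset and only the size of its integral is in question.\<close>

lemma Holder_inequality_period:
  assumes s: "1 \<le> s" and f: "f \<in> L_space s" "L_norm s f \<le> 1" and h: "bounded_periodic h"
  shows "\<bar>\<integral>t. f t * h t \<partial>period_measure\<bar> \<le> L_norm (conj_exponent s) h"
proof -
  note intf = L_space_integrable[OF s f(1)]
  have int: "integrable period_measure (\<lambda>t. \<bar>f t\<bar> * \<bar>h t\<bar>)"
    using integrable_mult_bper[OF integrable_abs[OF intf] bper_abs[OF h]] .
  have "\<bar>\<integral>t. f t * h t \<partial>period_measure\<bar> \<le> (\<integral>t. \<bar>f t * h t\<bar> \<partial>period_measure)"
    by (rule integral_abs_bound)
  also have "\<dots> = (\<integral>t. \<bar>f t\<bar> * \<bar>h t\<bar> \<partial>period_measure)"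
    by (simp add: abs_mult)
  also have "\<dots> \<le> L_norm (conj_exponent s) h"
    using s
  proof (cases rule: conj_exponent_cases)
    case 1
    have f1: "(\<integral>t. \<bar>f t\<bar> \<partial>period_measure) \<le> 1"
      using f(2) 1(1) by (simp add: L_norm_def)
    have "(\<integral>t. \<bar>f t\<bar> * \<bar>h t\<bar> \<partial>period_measure) \<le> (\<integral>t. \<bar>f t\<bar> * L_norm \<infinity> h \<partial>period_measure)"
    proof (rule integral_mono_AE[OF int])
      show "AE t in period_measure. \<bar>f t\<bar> * \<bar>h t\<bar> \<le> \<bar>f t\<bar> * L_norm \<infinity> h"
        using AE_le_L_norm_inf[OF bper_L_space_inf[OF h]]
        by eventually_elim (simp add: mult_left_mono)
    qed (use intf in simp)
    also have "\<dots> \<le> L_norm \<infinity> h"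
      using f1 L_norm_nonneg[of \<infinity> h] by (simp add: mult_left_le_one_le)
    finally show ?thesis using 1 by simp
  next
    case 2
    have "AE t in period_measure. \<bar>f t\<bar> \<le> 1"
      using AE_le_L_norm_inf[of f] f 2 by (auto elim!: eventually_mono)
    then have "AE t in period_measure. \<bar>f t\<bar> * \<bar>h t\<bar> \<le> \<bar>h t\<bar>"
      by eventually_elim (simp add: mult_left_le_one_le)
    then have "(\<integral>t. \<bar>f t\<bar> * \<bar>h t\<bar> \<partial>period_measure) \<le> (\<integral>t. \<bar>h t\<bar> \<partial>period_measure)"
      by (rule integral_mono_AE[OF int integrable_abs[OF bper_integrable[OF h]]])
    then show ?thesis using 2 by (simp add: L_norm_def)
  next
    case (3 a b)
    show ?thesis
    proof (rule field_le_epsilon)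
      fix e :: real assume e: "e > 0"
      \<comment> \<open>Young's inequality is applied to \<open>\<bar>f t\<bar>\<close> and
        \<open>\<bar>h t\<bar> / N\<close>. Enlarging the norm by \<open>e\<close> makes
        \<open>N\<close> positive, and the weights \<open>1 / a\<close> and \<open>1 / b\<close> add
        up to 1.\<close>
      define N where "N = L_norm (conj_exponent s) h + e"
      have N: "N > 0" using e L_norm_nonneg[of "conj_exponent s" h] by (simp add: N_def)
      have ih: "(\<integral>t. \<bar>h t\<bar> powr b \<partial>period_measure) \<le> N powr b"
        using L_norm_real_le_iff[of N b h] 3 N e by (simp add: N_def)
      have if1: "(\<integral>t. \<bar>f t\<bar> powr a \<partial>period_measure) \<le> 1"
        using L_norm_real_le_iff[of 1 a f] 3 f by simp
      have intfa: "integrable period_measure (\<lambda>t. \<bar>f t\<bar> powr a)"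
        using f(1) unfolding 3 L_space_real by blast
      have inthb: "integrable period_measure (\<lambda>t. \<bar>h t\<bar> powr b)"
        using 3 by (intro bper_integrable bper_abs_powr h) simp
      have pt: "\<bar>f t\<bar> * \<bar>h t\<bar> \<le> N * ((1 / a) * \<bar>f t\<bar> powr a + (1 / (b * N powr b)) * \<bar>h t\<bar> powr b)" for t
      proof -
        have "\<bar>f t\<bar> * (\<bar>h t\<bar> / N) \<le> \<bar>f t\<bar> powr a / a + (\<bar>h t\<bar> / N) powr b / b"
          using 3 N by (intro Youngs_inequality) simp_all
        also have "\<dots> = (1 / a) * \<bar>f t\<bar> powr a + (1 / (b * N powr b)) * \<bar>h t\<bar> powr b"
          by (simp add: powr_divide mult.commute)
        finally have "N * (\<bar>f t\<bar> * (\<bar>h t\<bar> / N)) \<le> N * ((1 / a) * \<bar>f t\<bar> powr a + (1 / (b * N powr b)) * \<bar>h t\<bar> powr b)"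
          using N by (intro mult_left_mono) simp_all
        then show ?thesis using N by simp
      qed
      have i2: "integrable period_measure (\<lambda>t. (1 / a) * \<bar>f t\<bar> powr a)"
        "integrable period_measure (\<lambda>t. (1 / (b * N powr b)) * \<bar>h t\<bar> powr b)"
        by (rule integrable_mult_right[OF intfa] integrable_mult_right[OF inthb])+
      have "(\<integral>t. \<bar>f t\<bar> * \<bar>h t\<bar> \<partial>period_measure) \<le>
          (\<integral>t. N * ((1 / a) * \<bar>f t\<bar> powr a + (1 / (b * N powr b)) * \<bar>h t\<bar> powr b) \<partial>period_measure)"
        by (rule integral_mono[OF int _ pt]) (intro integrable_mult_right Bochner_Integration.integrable_add i2)
      also have "\<dots> = N * ((1 / a) * (\<integral>t. \<bar>f t\<bar> powr a \<partial>period_measure)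
          + (1 / (b * N powr b)) * (\<integral>t. \<bar>h t\<bar> powr b \<partial>period_measure))"
        unfolding integral_mult_right_zero
        unfolding Bochner_Integration.integral_add[OF i2]
        unfolding integral_mult_right_zero by (rule refl)
      also have "\<dots> \<le> N * ((1 / a) * 1 + (1 / (b * N powr b)) * N powr b)"
        using 3 N by (intro mult_left_mono add_mono if1 ih) simp_all
      also have "\<dots> = N * (1 / a + 1 / b)" using N by simp
      also have "\<dots> = N" using 3 by simp
      finally show "(\<integral>t. \<bar>f t\<bar> * \<bar>h t\<bar> \<partial>period_measure) \<le> L_norm (conj_exponent s) h + e"
        by (simp add: N_def)
    qed
  qed
  finally show ?thesis .
qed

lemma bper_sgn: "bounded_periodic f \<Longrightarrow> bounded_periodic (\<lambda>t. sgn (f t))"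
  by (auto simp: bounded_periodic_def periodic_2pi_def sgn_real_def intro!: exI[of _ 1])

lemma bper_indicator:
  assumes "bounded_periodic f"
  shows "bounded_periodic (\<lambda>t. if c < \<bar>f t\<bar> then 1 else 0)"
proof -
  have [measurable]: "f \<in> borel_measurable borel" by (rule bperD(2)[OF assms])
  show ?thesis using bperD(1)[OF assms]
    by (auto simp: bounded_periodic_def periodic_2pi_def intro!: exI[of _ 1])
qed

text \<open>For \<open>s = 1\<close> the essential supremum of \<open>h\<close> need not be attained
  on a set of positive measure, so the duality formula carries a tolerance. The functions produced
  are bounded and Borel, hence can be translated afterwards.\<close>

lemma L_norm_nearly_attained:
  assumes s: "1 \<le> s" and h: "bounded_periodic h" and e: "e > 0"
  obtains f where "bounded_periodic f" "L_norm s f \<le> 1"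
    "L_norm (conj_exponent s) h - e \<le> (\<integral>t. f t * h t \<partial>period_measure)"
  using s
proof (cases rule: conj_exponent_cases)
  case 1
  define L where "L = L_norm \<infinity> h"
  \<comment> \<open>Mass is put where \<open>\<bar>h t\<bar>\<close> exceeds \<open>L - e\<close>.
    This set has positive measure \<open>u\<close>, since otherwise \<open>L - e\<close> would be an
    essential bound; division by \<open>u\<close> gives L_1 norm at most 1.\<close>
  define S where "S = (\<lambda>t. if L - e < \<bar>h t\<bar> then 1 else 0 :: real)"
  define u where "u = (\<integral>t. S t \<partial>period_measure)"
  have S: "bounded_periodic S" unfolding S_def by (rule bper_indicator[OF h])
  have "u \<noteq> 0"
  proof
    assume "u = 0"
    then have "AE t in period_measure. S t = 0"
      unfolding u_def using bper_integrable[OF S]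
      by (subst (asm) integral_nonneg_eq_0_iff_AE) (auto simp: S_def)
    then have "AE t in period_measure. \<bar>h t\<bar> \<le> L - e"
      by eventually_elim (auto simp: S_def split: if_splits)
    from L_norm_inf_le(1)[OF borel_measurable_period[OF bperD(2)[OF h]] this] e show False
      by (simp add: L_def)
  qed
  moreover have "0 \<le> u" unfolding u_def by (rule integral_nonneg_AE) (simp add: S_def)
  ultimately have u: "u > 0" by simp
  define f where "f = (\<lambda>t. (1 / u) * (sgn (h t) * S t))"
  have f: "bounded_periodic f" unfolding f_def by (intro bper_cmult bper_mult bper_sgn h S)
  have "(\<integral>t. \<bar>f t\<bar> \<partial>period_measure) \<le> (\<integral>t. (1 / u) * S t \<partial>period_measure)"
  proof (rule integral_mono[OF integrable_abs[OF bper_integrable[OF f]] bper_integrable[OF bper_cmult[OF S]]])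
    show "\<bar>f t\<bar> \<le> (1 / u) * S t" for t
      using u by (simp add: f_def abs_mult S_def abs_sgn_eq)
  qed
  also have "\<dots> = 1" using u by (simp add: u_def)
  finally have n: "L_norm s f \<le> 1" using 1 by (simp add: L_norm_def)
  have "L - e = (\<integral>t. (1 / u) * ((L - e) * S t) \<partial>period_measure)"
    using u by (simp add: u_def)
  also have "\<dots> \<le> (\<integral>t. f t * h t \<partial>period_measure)"
  proof (rule integral_mono[OF bper_integrable bper_integrable])
    show "(1 / u) * ((L - e) * S t) \<le> f t * h t" for t
    proof -
      have "f t * h t = (1 / u) * (\<bar>h t\<bar> * S t)"
        by (simp add: f_def abs_sgn mult_ac)
      moreover have "(L - e) * S t \<le> \<bar>h t\<bar> * S t" by (simp add: S_def)
      ultimately show ?thesis using u by (simp add: divide_right_mono)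
    qed
  qed (intro bper_cmult bper_mult f h S)+
  finally show ?thesis using that[OF f n] 1 by (simp add: L_def)
next
  case 2
  have f: "bounded_periodic (\<lambda>t. sgn (h t))" by (rule bper_sgn[OF h])
  have "L_norm s (\<lambda>t. sgn (h t)) \<le> 1"
    unfolding 2(1) by (rule L_norm_inf_le(1)[OF borel_measurable_period[OF bperD(2)[OF f]]]) (simp add: abs_sgn_eq)
  moreover have "L_norm (conj_exponent s) h = (\<integral>t. sgn (h t) * h t \<partial>period_measure)"
  proof -
    have "sgn (h t) * h t = \<bar>h t\<bar>" for t by (simp add: sgn_real_def)
    moreover have "0 \<le> (\<integral>t. \<bar>h t\<bar> \<partial>period_measure)" by simp
    ultimately show ?thesis using 2 by (simp only: L_norm_def) simp
  qed
  ultimately show ?thesis using that[OF f] e by simp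
next
  case (3 a b)
  define N where "N = L_norm (conj_exponent s) h"
  have N0: "0 \<le> N" by (simp add: N_def L_norm_nonneg)
  have Nb: "N powr b = (\<integral>t. \<bar>h t\<bar> powr b \<partial>period_measure)"
    unfolding N_def 3 using L_norm_powr[of b h] 3 by simp
  show ?thesis
  proof (cases "N = 0")
    case True
    then show ?thesis
      using that[OF bper_const, of 0] e L_norm_const_le[OF bper_const s, of 0 0]
      by (simp add: N_def)
  next
    case False
    then have N: "N > 0" using N0 by simp
    \<comment> \<open>The case of equality in Hoelder's inequality:
      \<open>\<bar>f t\<bar> powr a\<close> is proportional to
      \<open>\<bar>h t\<bar> powr b\<close>, because \<open>(b - 1) * a = b\<close>.\<close>
    define f where "f = (\<lambda>t. (1 / N powr (b - 1)) * (sgn (h t) * \<bar>h t\<bar> powr (b - 1)))"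
    have f: "bounded_periodic f" unfolding f_def
      using 3 by (intro bper_cmult bper_mult bper_sgn bper_abs_powr h) simp
    have ab: "(b - 1) * a = b" using 3 by (simp add: field_simps)
    have "\<bar>f t\<bar> powr a = (1 / N powr b) * \<bar>h t\<bar> powr b" for t
    proof (cases "h t = 0")
      case True
      then show ?thesis using 3 by (simp add: f_def)
    next
      case False
      then have "\<bar>f t\<bar> = (\<bar>h t\<bar> / N) powr (b - 1)"
        using N by (simp add: f_def abs_mult abs_sgn_eq powr_divide)
      then show ?thesis by (simp add: powr_powr ab powr_divide)
    qed
    then have "(\<integral>t. \<bar>f t\<bar> powr a \<partial>period_measure) = 1"
      using N by (simp flip: Nb)
    then have n: "L_norm s f \<le> 1"
      unfolding 3 using L_norm_real_le_iff[of 1 a f] 3 by simp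
    have "f t * h t = (1 / N powr (b - 1)) * \<bar>h t\<bar> powr b" for t
    proof (cases "h t = 0")
      case False
      then have "\<bar>h t\<bar> powr b = \<bar>h t\<bar> powr (b - 1) * \<bar>h t\<bar>"
        using powr_add[of "\<bar>h t\<bar>" "b - 1" 1] by simp
      then show ?thesis by (simp add: f_def abs_sgn mult_ac)
    qed (use 3 in \<open>simp add: f_def\<close>)
    then have "(\<integral>t. f t * h t \<partial>period_measure) = (1 / N powr (b - 1)) * N powr b"
      using Nb by simp
    also have "\<dots> = N" using N powr_add[of N "b - 1" 1] by simp
    finally show ?thesis using that[OF f n] e by (simp add: N_def)
  qed
qed

text \<open>With \<open>g\<close> half the difference of \<open>f\<close> and its translate, the
  pairing of \<open>g\<close> with \<open>h\<close> equals that of \<open>f\<close> with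
  \<open>(h t - h (t - v)) / 2\<close>, that is, with \<open>h\<close> minus the mean of
  \<open>h\<close> and its translate. Hoelder bounds the loss by the norm of that mean, whatever the
  shift \<open>v\<close>.\<close>

lemma mean_zero_nearly_extremal:
  assumes s: "1 \<le> s" and h: "bounded_periodic h" and e: "e > 0"
  obtains f where "bounded_periodic f" "f \<in> U0 s"
    "L_norm (conj_exponent s) h - L_norm (conj_exponent s) (\<lambda>t. (h t + h (t - v)) / 2) - e
      \<le> (\<integral>t. f t * h t \<partial>period_measure)"
proof -
  obtain f where f: "bounded_periodic f" "L_norm s f \<le> 1"
    "L_norm (conj_exponent s) h - e \<le> (\<integral>t. f t * h t \<partial>period_measure)"
    using L_norm_nearly_attained[OF s h e] .
  define g where "g = (\<lambda>t. (1 / 2) * f t + (- 1 / 2) * f (t + v))"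
  have fv: "bounded_periodic (\<lambda>t. f (t + v))" by (rule bper_shift[OF f(1)])
  have g: "bounded_periodic g" unfolding g_def by (intro bper_add bper_cmult f fv)
  have "L_norm s g \<le> (1 / 2) * L_norm s f + (1 / 2) * L_norm s (\<lambda>t. f (t + v))"
    using L_norm_triangle[OF bper_cmult[OF f(1)] bper_cmult[OF fv] s, of "1 / 2" "- 1 / 2"]
    unfolding L_norm_cmult[OF f(1) s] L_norm_cmult[OF fv s] g_def by simp
  then have "L_norm s g \<le> 1" using f(2) by (simp add: L_norm_shift[OF f(1) s])
  moreover have "(\<integral>t. g t \<partial>period_measure) = 0"
    unfolding g_def using period_integral_shift[OF f(1), of v] bper_integrable[OF f(1)] bper_integrable[OF fv]
    by simp
  ultimately have U: "g \<in> U0 s" using bper_L_space[OF g s] by (simp add: U0_def)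
  define k where "k = (\<lambda>t. (h t + h (t - v)) / 2)"
  have hv: "bounded_periodic (\<lambda>t. h (t - v))" using bper_shift[OF h, of "- v"] by simp
  have k: "bounded_periodic k" unfolding k_def using bper_cmult[OF bper_add[OF h hv], of "1 / 2"] by simp
  have i1: "integrable period_measure (\<lambda>t. f t * h t)"
    by (rule bper_integrable[OF bper_mult[OF f(1) h]])
  have i2: "integrable period_measure (\<lambda>t. f (t + v) * h t)"
    by (rule bper_integrable[OF bper_mult[OF fv h]])
  have i3: "integrable period_measure (\<lambda>t. f t * h (t - v))"
    by (rule bper_integrable[OF bper_mult[OF f(1) hv]])
  have sh: "(\<integral>t. f (t + v) * h t \<partial>period_measure) = (\<integral>t. f t * h (t - v) \<partial>period_measure)"
    using period_integral_shift[OF bper_mult[OF f(1) hv], of v] by simp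
  have "(\<integral>t. g t * h t \<partial>period_measure)
      = (\<integral>t. (1 / 2) * (f t * h t) + (- 1 / 2) * (f (t + v) * h t) \<partial>period_measure)"
    by (simp add: g_def algebra_simps)
  also have "\<dots> = (1 / 2) * (\<integral>t. f t * h t \<partial>period_measure) - (1 / 2) * (\<integral>t. f t * h (t - v) \<partial>period_measure)"
    using i1 i2 sh by simp
  finally have G: "(\<integral>t. g t * h t \<partial>period_measure)
    = (1 / 2) * (\<integral>t. f t * h t \<partial>period_measure) - (1 / 2) * (\<integral>t. f t * h (t - v) \<partial>period_measure)" .
  have "(\<integral>t. f t * k t \<partial>period_measure)
      = (\<integral>t. (1 / 2) * (f t * h t) + (1 / 2) * (f t * h (t - v)) \<partial>period_measure)"
    by (simp add: k_def algebra_simps add_divide_distrib)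
  also have "\<dots> = (1 / 2) * (\<integral>t. f t * h t \<partial>period_measure) + (1 / 2) * (\<integral>t. f t * h (t - v) \<partial>period_measure)"
    using i1 i3 by simp
  finally have K: "(\<integral>t. f t * k t \<partial>period_measure)
    = (1 / 2) * (\<integral>t. f t * h t \<partial>period_measure) + (1 / 2) * (\<integral>t. f t * h (t - v) \<partial>period_measure)" .
  have "\<bar>\<integral>t. f t * k t \<partial>period_measure\<bar> \<le> L_norm (conj_exponent s) k"
    by (rule Holder_inequality_period[OF s bper_L_space[OF f(1) s] f(2) k])
  then have "L_norm (conj_exponent s) h - L_norm (conj_exponent s) k - e \<le> (\<integral>t. g t * h t \<partial>period_measure)"
    using G K f(3) by linarith
  then show ?thesis using that[OF g U] by (simp add: k_def)
qed

section \<open>Norms of rapidly oscillating functions\<close>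

lemma recip_exponent_simps: "recip_exponent \<infinity> = 0" "recip_exponent (ereal b) = 1 / b"
  by (auto simp: recip_exponent_def one_ereal_def)

lemma cos_C_space: "cos \<in> C_space"
  by (auto simp: C_space_def periodic_2pi_def intro: continuous_intros)

lemma L_norm_inf_cos: "L_norm \<infinity> cos = 1"
proof (rule antisym)
  show "L_norm \<infinity> cos \<le> 1"
    by (rule L_norm_inf_le(1)[OF borel_measurable_period]) simp_all
  show "1 \<le> L_norm \<infinity> cos"
    using le_L_norm_inf[OF cos_C_space, of 0] by simp
qed

text \<open>In polar form \<open>Re (cis u * w) = cmod w * cos (u + Arg w)\<close>; the argument of
  \<open>w\<close> is a mere shift of \<open>u\<close> and disappears on integration over a full
  period.\<close>

lemma integral_abs_Re_cis_powr:
  assumes "1 \<le> b"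
  shows "integral {0..2 * pi} (\<lambda>u. \<bar>Re (cis u * w)\<bar> powr b) =
    cmod w powr b * integral {0..2 * pi} (\<lambda>u. \<bar>cos u\<bar> powr b)"
proof -
  have "Re (cis u * w) = cmod w * cos (u + Arg w)" for u
  proof -
    have "w = complex_of_real (cmod w) * cis (Arg w)"
      using rcis_cmod_Arg[of w] by (simp add: rcis_def)
    then have "cis u * w = complex_of_real (cmod w) * cis (u + Arg w)"
      by (metis cis_mult mult.left_commute)
    then show ?thesis by simp
  qed
  then have "integral {0..2 * pi} (\<lambda>u. \<bar>Re (cis u * w)\<bar> powr b) =
      integral {0..2 * pi} (\<lambda>u. cmod w powr b * \<bar>cos (u + Arg w)\<bar> powr b)"
    by (simp add: abs_mult powr_mult)
  also have "\<dots> = cmod w powr b * integral {0..2 * pi} (\<lambda>u. \<bar>cos (u + Arg w)\<bar> powr b)"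
    by simp
  also have "integral {0..2 * pi} (\<lambda>u. \<bar>cos (u + Arg w)\<bar> powr b) = integral {0..2 * pi} (\<lambda>u. \<bar>cos u\<bar> powr b)"
    using assms by (intro integral_shift_period[of "\<lambda>u. \<bar>cos u\<bar> powr b"] bper_abs_powr C_space_bper cos_C_space) simp
  finally show ?thesis .
qed

lemma Re_cis_mult_C_space:
  fixes G :: "real \<Rightarrow> complex"
  assumes "continuous_on UNIV G" "\<And>t. G (t + 2 * pi) = G t"
  shows "(\<lambda>t. Re (cis (real m * t + u) * G t)) \<in> C_space"
proof -
  have "cis (real m * (t + 2 * pi) + u) = cis (real m * t + u)" for t
  proof -
    have "cis (real m * (t + 2 * pi) + u) = cis (real m * t + u) * cis (2 * pi * real m)"
      by (simp add: cis_mult algebra_simps)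
    also have "cis (2 * pi * real m) = 1"
      using cis_multiple_2pi[of "real m"] by (simp add: Ints_of_nat)
    finally show ?thesis by simp
  qed
  then show ?thesis
    unfolding C_space_def periodic_2pi_def mem_Collect_eq using assms(2)
    by (intro conjI allI continuous_intros assms(1)) (simp_all add: algebra_simps)
qed

lemma cmod_C_space:
  fixes G :: "real \<Rightarrow> complex"
  assumes "continuous_on UNIV G" "\<And>t. G (t + 2 * pi) = G t"
  shows "(\<lambda>t. cmod (G t)) \<in> C_space"
  using assms by (auto simp: C_space_def periodic_2pi_def intro!: continuous_intros)

text \<open>The translate \<open>h (t + u / m)\<close> is close to \<open>Re (cis (m t + u) * G t)\<close>, and averaging the
  latter over the phase \<open>u\<close> decouples the two factors exactly.\<close>

lemma L_norm_oscillating: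
  fixes G :: "real \<Rightarrow> complex"
  assumes r: "1 \<le> r" and G: "continuous_on UNIV G" "\<And>t. G (t + 2 * pi) = G t" and m: "m \<ge> 1"
    and D: "\<And>v. 0 \<le> v \<Longrightarrow> v \<le> 2 * pi / real m \<Longrightarrow> L_norm r (\<lambda>t. cmod (G (t + v) - G t)) \<le> D"
  shows "\<bar>L_norm r (\<lambda>t. Re (cis (real m * t) * G t))
    - L_norm r cos / (2 * pi) powr recip_exponent r * L_norm r (\<lambda>t. cmod (G t))\<bar> \<le> D"
proof -
  define h where "h = (\<lambda>u t. Re (cis (real m * t + u) * G t))"
  have hC: "h u \<in> C_space" for u
    unfolding h_def by (rule Re_cis_mult_C_space[OF G])
  note hb = C_space_bper[OF hC]
  have gb: "bounded_periodic (\<lambda>t. cmod (G t))" by (rule C_space_bper[OF cmod_C_space[OF G]])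
  \<comment> \<open>At \<open>t + u / m\<close> the oscillating factor of \<open>h 0\<close> is
    exactly that of \<open>h u\<close> at \<open>t\<close>, so the two differ only through the
    increment of \<open>G\<close>. As \<open>u\<close> covers a full turn, the increment goes up to
    \<open>2 * pi / m\<close>.\<close>
  have close: "L_norm r (h 0) \<le> L_norm r (h u) + D" "L_norm r (h u) \<le> L_norm r (h 0) + D"
    if u: "u \<in> {0..2 * pi}" for u
  proof -
    define k where "k = (\<lambda>t. h 0 (t + u / real m) - h u t)"
    have h0: "bounded_periodic (\<lambda>t. h 0 (t + u / real m))" by (rule bper_shift[OF hb])
    have k: "bounded_periodic k" unfolding k_def by (intro bper_diff h0 hb)
    have k': "bounded_periodic (\<lambda>t. - 1 * k t)" by (rule bper_cmult[OF k])
    have Gv: "continuous_on UNIV (\<lambda>t. G (t + u / real m) - G t)"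
      by (intro continuous_intros continuous_on_compose2[OF G(1)]) auto
    have "G (t + 2 * pi + u / real m) = G (t + u / real m)" for t
      using G(2)[of "t + u / real m"] by (simp add: algebra_simps)
    then have db: "bounded_periodic (\<lambda>t. cmod (G (t + u / real m) - G t))"
      by (intro C_space_bper cmod_C_space[OF Gv]) (simp add: G(2))
    have "\<bar>k t\<bar> \<le> \<bar>cmod (G (t + u / real m) - G t)\<bar>" for t
    proof -
      have "real m * (t + u / real m) = real m * t + u" using m by (simp add: field_simps)
      then have "k t = Re (cis (real m * t + u) * (G (t + u / real m) - G t))"
        by (simp add: k_def h_def algebra_simps)
      then show ?thesis
        using abs_Re_le_cmod[of "cis (real m * t + u) * (G (t + u / real m) - G t)"] by (simp add: norm_mult)
    qed
    then have "L_norm r k \<le> L_norm r (\<lambda>t. cmod (G (t + u / real m) - G t))"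
      by (intro L_norm_mono k db r)
    also have "\<dots> \<le> D" using u m by (intro D) (simp_all add: divide_right_mono)
    finally have kD: "L_norm r k \<le> D" .
    have "L_norm r (h 0) = L_norm r (\<lambda>t. h 0 (t + u / real m))" by (simp add: L_norm_shift[OF hb r])
    also have "\<dots> = L_norm r (\<lambda>t. h u t + k t)" by (simp add: k_def)
    also have "\<dots> \<le> L_norm r (h u) + L_norm r k" by (rule L_norm_triangle[OF hb k r])
    finally show "L_norm r (h 0) \<le> L_norm r (h u) + D" using kD by simp
    have "L_norm r (h u) = L_norm r (\<lambda>t. h 0 (t + u / real m) + - 1 * k t)" by (simp add: k_def)
    also have "\<dots> \<le> L_norm r (\<lambda>t. h 0 (t + u / real m)) + L_norm r (\<lambda>t. - 1 * k t)"
      by (rule L_norm_triangle[OF h0 k' r])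
    also have "\<dots> = L_norm r (h 0) + L_norm r k"
      unfolding L_norm_shift[OF hb r] L_norm_cmult[OF k r] by simp
    finally show "L_norm r (h u) \<le> L_norm r (h 0) + D" using kD by simp
  qed
  have h0: "h 0 = (\<lambda>t. Re (cis (real m * t) * G t))" by (simp add: h_def)
  have D0: "0 \<le> D" by (rule order_trans[OF L_norm_nonneg D[of 0]]) simp_all
  show ?thesis
    using r
  proof (cases rule: exponent_cases)
    case 1
    have "\<bar>h 0 t\<bar> \<le> \<bar>cmod (G t)\<bar>" for t
      using abs_Re_le_cmod[of "cis (real m * t) * G t"] by (simp add: h_def norm_mult)
    then have le: "L_norm r (h 0) \<le> L_norm r (\<lambda>t. cmod (G t))"
      by (intro L_norm_mono hb gb r)
    have "\<bar>cmod (G t)\<bar> \<le> L_norm r (h 0) + D" for t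
    proof -
      \<comment> \<open>For exponent \<infinity> averaging is replaced by a choice: with
        \<open>u\<close> equal to \<open>- Arg w\<close> modulo \<open>2 * pi\<close> the phase is
        cancelled at this one \<open>t\<close>, and \<open>h u\<close> takes the value
        \<open>cmod (G t)\<close> there.\<close>
      define w where "w = cis (real m * t) * G t"
      obtain u k where u: "u \<in> {0..2 * pi}" "- Arg w = u + 2 * pi * of_int k"
        by (rule period_representative)
      have "cis u = cis (- Arg w) * cis (2 * pi * of_int (- k))"
        using u(2) by (simp add: cis_mult)
      also have "cis (2 * pi * of_int (- k)) = 1" by (rule cis_multiple_2pi) simp
      finally have cu: "cis u = cis (- Arg w)" by simp
      have "w = complex_of_real (cmod w) * cis (Arg w)"
        using rcis_cmod_Arg[of w] by (simp only: rcis_def)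
      then have "cis u * w = cis u * (complex_of_real (cmod w) * cis (Arg w))"
        by (rule arg_cong)
      also have "\<dots> = complex_of_real (cmod w) * (cis (- Arg w) * cis (Arg w))"
        unfolding cu by (rule mult.left_commute)
      finally have "cis u * w = complex_of_real (cmod w)" by (simp add: cis_mult)
      then have "h u t = cmod (G t)"
        by (simp add: h_def w_def cis_mult[symmetric] mult_ac norm_mult del: times_complex.sel)
      then show ?thesis
        using le_L_norm_inf[OF hC, of u t] close(2)[OF u(1)] 1 by simp
    qed
    then have "L_norm r (\<lambda>t. cmod (G t)) \<le> L_norm r (h 0) + D"
      unfolding 1 by (intro L_norm_inf_le(1)[OF borel_measurable_period[OF bperD(2)[OF gb]]]) (simp add: 1)
    then show ?thesis
      using le unfolding h0 1 by (simp add: recip_exponent_simps L_norm_inf_cos)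
  next
    case (2 b)
    have b: "0 \<le> b" "0 < b" using 2 by auto
    define N where "N = L_norm r (h 0)"
    define C where "C = integral {0..2 * pi} (\<lambda>u. \<bar>cos u\<bar> powr b)"
    define A where "A = integral {0..2 * pi} (\<lambda>t. cmod (G t) powr b)"
    have Lpow: "L_norm r f powr b = integral {0..2 * pi} (\<lambda>t. \<bar>f t\<bar> powr b)" if "bounded_periodic f" for f
      unfolding 2 L_norm_powr[OF 2(2)] by (rule period_integral_eq[OF bper_integrable[OF bper_abs_powr[OF that b(1)]]])
    have LC: "L_norm r cos powr b = C"
      unfolding C_def by (rule Lpow[OF C_space_bper[OF cos_C_space]])
    have LA: "L_norm r (\<lambda>t. cmod (G t)) powr b = A"
      unfolding A_def using Lpow[OF gb] by simp
    \<comment> \<open>Joint continuity on the square justifies interchanging the integrals over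
      phase and position.\<close>
    have cont: "continuous_on (cbox (0, 0) (2 * pi, 2 * pi)) (\<lambda>(u, t). \<bar>h u t\<bar> powr b)"
      unfolding h_def split_beta
      by (intro continuous_intros continuous_on_compose2[OF G(1)] continuous_on_powr')
         (use b in auto)
    define J where "J = (\<lambda>u. integral {0..2 * pi} (\<lambda>t. \<bar>h u t\<bar> powr b))"
    have J: "J u = L_norm r (h u) powr b" for u
      unfolding J_def by (rule Lpow[OF hb, symmetric])
    have Jint: "J integrable_on {0..2 * pi}"
      using integral_integrable_2dim[OF cont] unfolding J_def by simp
    have "integral {0..2 * pi} J = integral {0..2 * pi} (\<lambda>t. integral {0..2 * pi} (\<lambda>u. \<bar>h u t\<bar> powr b))"
      using integral_swap_continuous[OF cont] unfolding J_def by simp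
    also have "\<dots> = integral {0..2 * pi} (\<lambda>t. cmod (G t) powr b * C)"
    proof (rule Henstock_Kurzweil_Integration.integral_cong)
      fix t
      have "h u t = Re (cis u * (cis (real m * t) * G t))" for u
        by (simp add: h_def cis_mult[symmetric] mult_ac del: times_complex.sel)
      then show "integral {0..2 * pi} (\<lambda>u. \<bar>h u t\<bar> powr b) = cmod (G t) powr b * C"
        unfolding C_def by (simp only: integral_abs_Re_cis_powr[OF 2(2)]) (simp add: norm_mult)
    qed
    also have "\<dots> = A * C" by (simp add: A_def)
    finally have JAC: "integral {0..2 * pi} J = A * C" .
    \<comment> \<open>\<open>N - D\<close> is truncated at 0 because powers are compared only for
      nonnegative bases.\<close>
    define a where "a = max 0 (N - D)"
    have "a powr b * (2 * pi) \<le> A * C"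
    proof -
      have "integral {0..2 * pi} (\<lambda>u. a powr b) \<le> integral {0..2 * pi} J"
      proof (rule integral_le[OF _ Jint])
        fix u assume "u \<in> {0..2 * pi}"
        then have "a \<le> L_norm r (h u)"
          using close(1)[of u] L_norm_nonneg[of r "h u"] by (simp add: a_def N_def)
        then show "a powr b \<le> J u" unfolding J by (intro powr_mono2 b) (simp_all add: a_def)
      qed auto
      then show ?thesis by (simp add: mult.commute flip: JAC)
    qed
    moreover have "A * C \<le> (N + D) powr b * (2 * pi)"
    proof -
      have "integral {0..2 * pi} J \<le> integral {0..2 * pi} (\<lambda>u. (N + D) powr b)"
      proof (rule integral_le[OF Jint])
        fix u assume "u \<in> {0..2 * pi}"
        then have "L_norm r (h u) \<le> N + D"
          using close(2)[of u] by (simp add: N_def)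
        then show "J u \<le> (N + D) powr b" unfolding J by (intro powr_mono2 b L_norm_nonneg)
      qed auto
      then show ?thesis by (simp add: mult.commute flip: JAC)
    qed
    \<comment> \<open>\<open>X\<close> is the main term of the claim; its \<open>b\<close>-th power
      is the exact average of \<open>J\<close> over the phase, which the two estimates of
      \<open>A * C\<close> enclose.\<close>
    moreover define X where "X = L_norm r cos / (2 * pi) powr (1 / b) * L_norm r (\<lambda>t. cmod (G t))"
    have X0: "0 \<le> X" by (simp add: X_def L_norm_nonneg)
    have "X powr b = A * C / (2 * pi)"
      unfolding X_def using b by (simp add: powr_mult powr_divide powr_powr LA LC)
    then have "A * C = X powr b * (2 * pi)" by (simp add: field_simps)
    ultimately have le: "a powr b \<le> X powr b" "X powr b \<le> (N + D) powr b"
      by simp_all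
    have "a \<le> X"
      using powr_less_mono2[OF b(2) X0, of a] le(1) by (meson not_le)
    moreover have "X \<le> N + D"
      using powr_less_mono2[OF b(2) _, of "N + D" X] le(2) D0 L_norm_nonneg[of r "h 0"]
      unfolding N_def by (meson add_nonneg_nonneg not_le)
    ultimately have "a \<le> X" "X \<le> N + D" .
    then show ?thesis
      unfolding X_def N_def a_def h0 2 recip_exponent_simps by (simp add: abs_le_iff)
  qed
qed

section \<open>Fourier series\<close>

inductive trig_poly :: "(real \<Rightarrow> real) \<Rightarrow> bool" where
  harmonic: "trig_poly (\<lambda>t. c * cos (real k * t + d))"
| add: "trig_poly f \<Longrightarrow> trig_poly g \<Longrightarrow> trig_poly (\<lambda>t. f t + g t)"

text \<open>Product-to-sum formula. A free phase in each harmonic covers sines (phase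
  \<open>- pi / 2\<close>) and constants (frequency 0) at once; the case split keeps the difference
  of the natural frequencies nonnegative.\<close>

lemma trig_poly_harmonic_mult:
  assumes "trig_poly f"
  shows "trig_poly (\<lambda>t. c * cos (real k * t + d) * f t)"
  using assms
proof induction
  case (harmonic c' k' d')
  show ?case
  proof (cases "k' \<le> k")
    case True
    have "c * cos (real k * t + d) * (c' * cos (real k' * t + d')) =
       (c * c' / 2) * cos (real (k + k') * t + (d + d')) + (c * c' / 2) * cos (real (k - k') * t + (d - d'))" for t
    proof -
      have "real (k + k') * t + (d + d') = (real k * t + d) + (real k' * t + d')"
        "real (k - k') * t + (d - d') = (real k * t + d) - (real k' * t + d')"
        using True by (simp_all add: of_nat_diff algebra_simps)
      then show ?thesis by (simp only: cos_add cos_diff) (simp add: algebra_simps)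
    qed
    then show ?thesis by (simp only:) (intro trig_poly.intros)
  next
    case False
    have "c * cos (real k * t + d) * (c' * cos (real k' * t + d')) =
       (c * c' / 2) * cos (real (k + k') * t + (d + d')) + (c * c' / 2) * cos (real (k' - k) * t + (d' - d))" for t
    proof -
      have "real (k + k') * t + (d + d') = (real k * t + d) + (real k' * t + d')"
        "real (k' - k) * t + (d' - d) = (real k' * t + d') - (real k * t + d)"
        using False by (simp_all add: of_nat_diff algebra_simps)
      then show ?thesis by (simp only: cos_add cos_diff) (simp add: algebra_simps)
    qed
    then show ?thesis by (simp only:) (intro trig_poly.intros)
  qed
next
  case (add f g)
  then show ?case using trig_poly.add by (simp add: distrib_left)
qed

lemma trig_poly_mult:
  assumes "trig_poly f" "trig_poly g"
  shows "trig_poly (\<lambda>t. f t * g t)"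
  using assms(1)
proof induction
  case (harmonic c k d)
  then show ?case using trig_poly_harmonic_mult[OF assms(2)] .
next
  case (add f f')
  then show ?case using trig_poly.add by (simp add: distrib_right)
qed

text \<open>A real-linear form on the complex plane, restricted to the unit circle, is a combination
  of \<open>cos t\<close> and \<open>sin t\<close>; sums and products stay inside the class.\<close>

lemma trig_poly_real_polynomial:
  fixes p :: "complex \<Rightarrow> real"
  assumes "real_polynomial_function p"
  shows "trig_poly (\<lambda>t. p (cis t))"
  using assms
proof induction
  case (linear f)
  interpret bounded_linear f by fact
  have "f (cis t) = f 1 * cos (real 1 * t + 0) + f \<i> * cos (real 1 * t + (- pi / 2))" for t
  proof -
    have "cis t = cos t *\<^sub>R 1 + sin t *\<^sub>R \<i>" by (simp add: complex_eq_iff)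
    then have "f (cis t) = cos t * f 1 + sin t * f \<i>" by (simp add: add scaleR)
    moreover have "sin t = cos (t - pi / 2)" by (simp add: cos_diff)
    ultimately show ?thesis by simp
  qed
  then show ?case by (simp only:) (intro trig_poly.intros)
next
  case (const c)
  show ?case using trig_poly.harmonic[of c 0 0] by simp
next
  case (add f g)
  then show ?case by (intro trig_poly.add)
next
  case (mult f g)
  then show ?case by (intro trig_poly_mult)
qed

lemma harmonic_C_space: "(\<lambda>t. cos (real k * t + d)) \<in> C_space"
proof -
  have "cos (real k * (t + 2 * pi) + d) = cos (real k * t + d)" for t
  proof -
    have "real k * (t + 2 * pi) + d = (real k * t + d) + 2 * pi * of_int (int k)"
      by (simp add: algebra_simps)
    then show ?thesis using sin_cos_eq_iff[of "real k * (t + 2 * pi) + d" "real k * t + d"] by metis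
  qed
  then show ?thesis
    by (auto simp: C_space_def periodic_2pi_def intro!: continuous_intros)
qed

lemma periodic_cis_cong:
  assumes "periodic_2pi f" "cis a = cis b"
  shows "f a = f b"
proof -
  have "sin a = sin b \<and> cos a = cos b" using assms(2) by (simp add: complex_eq_iff)
  then obtain k :: int where "a = b + 2 * pi * of_int k" unfolding sin_cos_eq_iff by blast
  then show ?thesis using periodic_2pi_int[OF assms(1)] by simp
qed

text \<open>\<open>Arg\<close> jumps across the negative axis and \<open>Arg2pi\<close> across the
  positive one. Periodicity of \<open>f\<close> makes the two compositions agree, and every point of
  the circle avoids one of the two cuts.\<close>

lemma continuous_on_circle_Arg:
  assumes "f \<in> C_space"
  shows "continuous_on (sphere 0 1) (\<lambda>z. f (Arg z))"
proof (intro continuous_at_imp_continuous_on ballI)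
  fix z :: complex assume z: "z \<in> sphere 0 1"
  have cf: "isCont f x" for x
    using C_spaceD(2)[OF assms] by (simp add: continuous_on_eq_continuous_at)
  have eq: "f (Arg w) = f (Arg2pi w)" for w
  proof (cases "w = 0")
    case True
    then show ?thesis using Arg2pi_eq_0[of 0] by (simp only: Arg_zero) simp
  next
    case False
    have "of_real (cmod w) * cis (Arg2pi w) = w"
      unfolding cis_conv_exp by (rule Arg2pi_eq[symmetric])
    moreover have "of_real (cmod w) * cis (Arg w) = w"
      using rcis_cmod_Arg[of w] by (simp only: rcis_def)
    ultimately have "of_real (cmod w) * cis (Arg w) = of_real (cmod w) * cis (Arg2pi w)"
      by (simp only:)
    then have "cis (Arg w) = cis (Arg2pi w)"
      using False by (simp only: mult_cancel_left of_real_eq_0_iff norm_eq_zero) blast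
    from periodic_cis_cong[OF C_spaceD(1)[OF assms] this] show ?thesis .
  qed
  show "isCont (\<lambda>z. f (Arg z)) z"
  proof (cases "z \<in> \<real>\<^sub>\<le>\<^sub>0")
    case False
    show ?thesis by (rule isCont_o2[OF continuous_at_Arg[OF False] cf])
  next
    case True
    have "z \<noteq> 0" using z by auto
    with True have nn: "z \<notin> \<real>\<^sub>\<ge>\<^sub>0"
      by (auto simp: complex_nonpos_Reals_iff complex_nonneg_Reals_iff complex_eq_iff)
    show ?thesis unfolding eq by (rule isCont_o2[OF continuous_at_Arg2pi[OF nn] cf])
  qed
qed

text \<open>Weierstrass's trigonometric theorem, from Stone-Weierstrass for real polynomials on the
  unit circle, a compact subset of the plane.\<close>

lemma trig_poly_approx:
  assumes "f \<in> C_space" "e > 0"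
  obtains p where "trig_poly p" "\<And>t. \<bar>f t - p t\<bar> < e"
proof -
  obtain g where g: "real_polynomial_function g" "\<And>z. z \<in> sphere (0::complex) 1 \<Longrightarrow> \<bar>f (Arg z) - g z\<bar> < e"
    using Stone_Weierstrass_real_polynomial_function[OF compact_sphere continuous_on_circle_Arg[OF assms(1)] assms(2)]
    by metis
  have "f (Arg (cis t)) = f t" for t
  proof -
    have "cis (Arg (cis t)) = cis t" by (simp add: cis_Arg sgn_div_norm)
    from periodic_cis_cong[OF C_spaceD(1)[OF assms(1)] this] show ?thesis .
  qed
  then have "\<bar>f t - g (cis t)\<bar> < e" for t
    using g(2)[of "cis t"] by simp
  then show ?thesis using that trig_poly_real_polynomial[OF g(1)] by blast
qed

section \<open>Fourier coefficients and uniqueness\<close>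

lemma bper_harmonic: "bounded_periodic (\<lambda>t. cos (real k * t + d))"
  by (rule C_space_bper[OF harmonic_C_space])

lemma cos_harmonic: "cos (real k * t) = cos (real k * t + 0)"
  and sin_harmonic: "sin (real k * t) = cos (real k * t + (- pi / 2))"
  by (simp_all add: cos_diff)

lemma bper_cos: "bounded_periodic (\<lambda>t. cos (real k * t))"
  unfolding cos_harmonic by (rule bper_harmonic)

lemma bper_sin: "bounded_periodic (\<lambda>t. sin (real k * t))"
  unfolding sin_harmonic by (rule bper_harmonic)

lemma integral_times_harmonic:
  assumes "integrable period_measure f"
  shows "(\<integral>t. f t * cos (real k * t + d) \<partial>period_measure) = pi * (fourier_a f k * cos d - fourier_b f k * sin d)"
proof -
  have i: "integrable period_measure (\<lambda>t. f t * cos (real k * t))"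
    "integrable period_measure (\<lambda>t. f t * sin (real k * t))"
    by (rule integrable_mult_bper[OF assms bper_cos] integrable_mult_bper[OF assms bper_sin])+
  have "(\<integral>t. f t * cos (real k * t + d) \<partial>period_measure) =
      (\<integral>t. cos d * (f t * cos (real k * t)) - sin d * (f t * sin (real k * t)) \<partial>period_measure)"
    by (simp add: cos_add algebra_simps)
  also have "\<dots> = cos d * (\<integral>t. f t * cos (real k * t) \<partial>period_measure)
      - sin d * (\<integral>t. f t * sin (real k * t) \<partial>period_measure)"
    using i by simp
  finally show ?thesis by (simp add: fourier_a_def fourier_b_def algebra_simps)
qed

text \<open>Vanishing coefficients make \<open>g\<close> orthogonal to every trigonometric
  polynomial, in particular to those uniformly close to \<open>g\<close> itself. So the integral of
  \<open>g t * g t\<close> is arbitrarily small, and continuity turns zero integral into zero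
  values.\<close>

lemma fourier_uniqueness:
  assumes g: "g \<in> C_space" and z: "\<And>k. fourier_a g k = 0" "\<And>k. fourier_b g k = 0"
  shows "g x = 0"
proof -
  note gb = C_space_bper[OF g]
  obtain B where B: "\<And>x. \<bar>g x\<bar> \<le> B" "B > 0" using bper_bounded[OF gb] by metis
  have orth: "bounded_periodic p \<and> (\<integral>t. g t * p t \<partial>period_measure) = 0" if "trig_poly p" for p
    using that
  proof induction
    case (harmonic c k d)
    have "(\<integral>t. g t * cos (real k * t + d) \<partial>period_measure) = 0"
      using integral_times_harmonic[OF bper_integrable[OF gb], of k d] by (simp add: z)
    moreover have "(\<lambda>t. g t * (c * cos (real k * t + d))) = (\<lambda>t. c * (g t * cos (real k * t + d)))"
      by (simp add: mult_ac)
    ultimately show ?case by (simp add: bper_cmult[OF bper_harmonic])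
  next
    case (add p q)
    then show ?case
      using bper_integrable[OF bper_mult[OF gb, of p]] bper_integrable[OF bper_mult[OF gb, of q]] bper_add
      by (simp add: distrib_left)
  qed
  have small: "(\<integral>t. g t * g t \<partial>period_measure) \<le> 0 + e" if e: "e > 0" for e
  proof -
    \<comment> \<open>Replacing one factor \<open>g t\<close> by \<open>p t\<close> costs at most
      \<open>2 * pi * B * d\<close>, which this choice makes equal to \<open>e\<close>.\<close>
    define d where "d = e / (2 * pi * B)"
    have d: "d > 0" using e B by (simp add: d_def)
    obtain p where p: "trig_poly p" "\<And>t. \<bar>g t - p t\<bar> < d" using trig_poly_approx[OF g d] by metis
    have pb: "bounded_periodic p" using orth[OF p(1)] by simp
    have ip: "integrable period_measure (\<lambda>t. g t * p t)" by (rule bper_integrable[OF bper_mult[OF gb pb]])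
    have "(\<integral>t. g t * g t \<partial>period_measure) \<le> (\<integral>t. g t * p t + B * d \<partial>period_measure)"
    proof (rule integral_mono[OF bper_integrable[OF bper_mult[OF gb gb]]])
      show "integrable period_measure (\<lambda>t. g t * p t + B * d)"
        by (intro Bochner_Integration.integrable_add ip bper_integrable bper_const)
      fix t
      have "g t * g t - g t * p t \<le> \<bar>g t\<bar> * \<bar>g t - p t\<bar>"
        by (metis abs_ge_self abs_mult right_diff_distrib)
      also have "\<dots> \<le> B * d" using B p(2)[of t] by (intro mult_mono) simp_all
      finally show "g t * g t \<le> g t * p t + B * d" by simp
    qed
    also have "\<dots> = (\<integral>t. g t * p t \<partial>period_measure) + 2 * pi * (B * d)"
      using Bochner_Integration.integral_add[OF ip bper_integrable[OF bper_const], of "B * d"] measure_period by simp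
    also have "\<dots> = 0 + e" using orth[OF p(1)] B by (simp add: d_def)
    finally show ?thesis .
  qed
  have "(\<integral>t. g t * g t \<partial>period_measure) \<le> 0" using small by (rule field_le_epsilon)
  moreover have "0 \<le> (\<integral>t. g t * g t \<partial>period_measure)" by simp
  ultimately have "integral {0..2 * pi} (\<lambda>t. g t * g t) = 0"
    using period_integral_eq[OF bper_integrable[OF bper_mult[OF gb gb]]] by simp
  then have "\<forall>t\<in>{0..2 * pi}. g t * g t = 0"
    by (subst (asm) integral_eq_0_iff) (auto intro!: continuous_intros C_spaceD(3)[OF g])
  moreover obtain y k where "y \<in> {0..2 * pi}" "x = y + 2 * pi * of_int k" by (rule period_representative)
  ultimately show ?thesis using periodic_2pi_int[OF C_spaceD(1)[OF g]] by simp
qed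

section \<open>Termwise integration and absolutely convergent trigonometric series\<close>

lemma sums_integral_mult:
  fixes w :: "real \<Rightarrow> real" and u :: "nat \<Rightarrow> real \<Rightarrow> real" and c :: "nat \<Rightarrow> real"
  assumes w: "integrable period_measure w" and u: "\<And>k. u k \<in> borel_measurable borel"
    and c: "\<And>k t. \<bar>u k t\<bar> \<le> c k" "summable c"
  shows "(\<lambda>k. \<integral>t. w t * u k t \<partial>period_measure) sums (\<integral>t. w t * (\<Sum>k. u k t) \<partial>period_measure)"
proof -
  have c0: "0 \<le> c k" for k using c(1)[of k 0] by linarith
  have [measurable]: "u k \<in> borel_measurable period_measure" for k
    by (rule borel_measurable_period[OF u])
  have [measurable]: "w \<in> borel_measurable period_measure" by (rule borel_measurable_integrable[OF w])
  \<comment> \<open>\<open>w\<close> may be unbounded, as the derivative \<phi> will be; the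
    dominating functions \<open>c k * \<bar>w t\<bar>\<close> are still integrable, with summable
    integrals.\<close>
  have pt: "norm (w t * u k t) \<le> c k * \<bar>w t\<bar>" for k t
    using mult_right_mono[OF c(1)[of k t], of "\<bar>w t\<bar>"] by (simp add: abs_mult mult.commute)
  have int: "integrable period_measure (\<lambda>t. w t * u k t)" for k
  proof (rule Bochner_Integration.integrable_bound)
    show "integrable period_measure (\<lambda>t. c k * w t)" using w by simp
    show "AE t in period_measure. norm (w t * u k t) \<le> norm (c k * w t)"
      using pt c0 by (intro AE_I2) (simp add: abs_mult)
  qed measurable
  have su: "summable (\<lambda>k. u k t)" for t
    by (rule summable_comparison_test'[OF c(2)]) (simp add: c(1))
  have "(\<lambda>k. \<integral>t. w t * u k t \<partial>period_measure) sums (\<integral>t. (\<Sum>k. w t * u k t) \<partial>period_measure)"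
  proof (rule sums_integral[OF int])
    show "AE t in period_measure. summable (\<lambda>k. norm (w t * u k t))"
      by (intro AE_I2 summable_comparison_test'[OF summable_mult2[OF c(2)]]) (use pt in simp)
    have "(\<integral>t. norm (w t * u k t) \<partial>period_measure) \<le> c k * (\<integral>t. \<bar>w t\<bar> \<partial>period_measure)" for k
    proof -
      have "(\<integral>t. norm (w t * u k t) \<partial>period_measure) \<le> (\<integral>t. c k * \<bar>w t\<bar> \<partial>period_measure)"
        by (rule integral_mono[OF integrable_norm[OF int] _ pt]) (use w in simp)
      then show ?thesis by simp
    qed
    then show "summable (\<lambda>k. \<integral>t. norm (w t * u k t) \<partial>period_measure)"
      by (intro summable_comparison_test'[OF summable_mult2[OF c(2)]]) simp
  qed
  moreover have "(\<Sum>k. w t * u k t) = w t * (\<Sum>k. u k t)" for t by (rule suminf_mult[OF su])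
  ultimately show ?thesis by simp
qed

lemma integral_cos_period:
  assumes "n \<ge> 1"
  shows "(\<integral>t. cos (real n * t + d) \<partial>period_measure) = 0"
proof -
  have "((\<lambda>t. cos (real n * t + d)) has_integral
      (sin (real n * (2 * pi) + d) / real n - sin (real n * 0 + d) / real n)) {0..2 * pi}"
    using assms
    by (intro fundamental_theorem_of_calculus) (auto intro!: derivative_eq_intros simp flip: has_real_derivative_iff_has_vector_derivative)
  moreover have "sin (real n * (2 * pi) + d) = sin d"
    using sin_cos_eq_iff[of "real n * (2 * pi) + d" d] by (metis add.commute mult.commute of_int_of_nat_eq)
  ultimately show ?thesis
    using period_integral_eq[OF bper_integrable[OF bper_harmonic]] by (simp add: integral_unique)
qed

text \<open>Arbitrary phases let one computation serve cosines and sines. Symmetry reduces to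
  \<open>k \<le> j\<close>, where the difference of the frequencies is a natural number; two zero
  frequencies are separate because the sum term then no longer integrates to zero.\<close>

lemma integral_harmonic_product:
  "(\<integral>t. cos (real j * t + c) * cos (real k * t + d) \<partial>period_measure) =
    (if j \<noteq> k then 0 else if k = 0 then 2 * pi * cos c * cos d else pi * cos (c - d))"
proof -
  have key: "(\<integral>t. cos (real j * t + c) * cos (real k * t + d) \<partial>period_measure) =
    (if j \<noteq> k then 0 else if k = 0 then 2 * pi * cos c * cos d else pi * cos (c - d))"
    if le: "k \<le> j" for j k c d
  proof (cases "j = 0")
    case True
    then show ?thesis using le by (simp add: measure_period)
  next
    case False
    have "cos (real j * t + c) * cos (real k * t + d) =
        (1 / 2) * cos (real (j - k) * t + (c - d)) + (1 / 2) * cos (real (j + k) * t + (c + d))" for t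
    proof -
      have "real (j + k) * t + (c + d) = (real j * t + c) + (real k * t + d)"
        "real (j - k) * t + (c - d) = (real j * t + c) - (real k * t + d)"
        using le by (simp_all add: of_nat_diff algebra_simps)
      then show ?thesis by (simp only: cos_add cos_diff) (simp add: algebra_simps)
    qed
    moreover have "integrable period_measure (\<lambda>t. (1 / 2) * cos (real i * t + e))" for i e
      using bper_integrable[OF bper_harmonic] by simp
    ultimately have "(\<integral>t. cos (real j * t + c) * cos (real k * t + d) \<partial>period_measure) =
      (1 / 2) * (\<integral>t. cos (real (j - k) * t + (c - d)) \<partial>period_measure) +
      (1 / 2) * (\<integral>t. cos (real (j + k) * t + (c + d)) \<partial>period_measure)"
      by (simp only: Bochner_Integration.integral_add integral_mult_right_zero)
    also have "(\<integral>t. cos (real (j + k) * t + (c + d)) \<partial>period_measure) = 0"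
      using False by (intro integral_cos_period) simp
    also have "(\<integral>t. cos (real (j - k) * t + (c - d)) \<partial>period_measure) = (if j \<noteq> k then 0 else 2 * pi * cos (c - d))"
      using le integral_cos_period[of "j - k" "c - d"] by (simp add: measure_period)
    finally show ?thesis using False by (cases "j = k") simp_all
  qed
  show ?thesis
  proof (cases "k \<le> j")
    case False
    then show ?thesis using key[of j k d c] by (simp add: mult.commute)
  qed (rule key)
qed

lemma C_space_suminf:
  fixes u :: "nat \<Rightarrow> real \<Rightarrow> real"
  assumes "\<And>k. u k \<in> C_space" "\<And>k t. \<bar>u k t\<bar> \<le> c k" "summable c"
  shows "(\<lambda>t. \<Sum>k. u k t) \<in> C_space"
proof -
  have "uniform_limit UNIV (\<lambda>n t. \<Sum>k<n. u k t) (\<lambda>t. \<Sum>k. u k t) sequentially"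
    by (rule Weierstrass_m_test[OF _ assms(3)]) (simp add: assms(2))
  then have "continuous_on UNIV (\<lambda>t. \<Sum>k. u k t)"
    by (rule uniform_limit_theorem[rotated])
       (auto intro!: always_eventually continuous_on_sum C_spaceD(2)[OF assms(1)])
  then show ?thesis
    using C_spaceD(1)[OF assms(1)] by (simp add: C_space_def periodic_2pi_def)
qed

lemma C_space_cmult: "f \<in> C_space \<Longrightarrow> (\<lambda>t. c * f t) \<in> C_space"
  by (auto simp: C_space_def periodic_2pi_def intro!: continuous_intros)

lemma C_space_add: "f \<in> C_space \<Longrightarrow> g \<in> C_space \<Longrightarrow> (\<lambda>t. f t + g t) \<in> C_space"
  by (auto simp: C_space_def periodic_2pi_def intro!: continuous_intros)

lemma C_space_diff: "f \<in> C_space \<Longrightarrow> g \<in> C_space \<Longrightarrow> (\<lambda>t. f t - g t) \<in> C_space"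
  by (auto simp: C_space_def periodic_2pi_def intro!: continuous_intros)

lemma trig_term_C_space: "(\<lambda>t. a * cos (real k * t) + b * sin (real k * t)) \<in> C_space"
  unfolding cos_harmonic sin_harmonic by (intro C_space_add C_space_cmult harmonic_C_space)

text \<open>Testing against a cosine of arbitrary phase isolates one harmonic, and the phases 0 and
  \<open>- pi / 2\<close> read off its two coefficients. The doubled value at 0 reflects the weight
  1/2 of the constant term in a Fourier series.\<close>

lemma fourier_of_series:
  fixes a b :: "nat \<Rightarrow> real"
  assumes s: "summable (\<lambda>k. \<bar>a k\<bar> + \<bar>b k\<bar>)"
  defines "F \<equiv> (\<lambda>t. \<Sum>k. a k * cos (real k * t) + b k * sin (real k * t))"
  shows "F \<in> C_space" "fourier_a F k = (if k = 0 then 2 * a 0 else a k)"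
    "fourier_b F k = (if k = 0 then 0 else b k)"
proof -
  have bd: "\<bar>a k * cos (real k * t) + b k * sin (real k * t)\<bar> \<le> \<bar>a k\<bar> + \<bar>b k\<bar>" for k t
  proof -
    have "\<bar>a k * cos (real k * t)\<bar> \<le> \<bar>a k\<bar>" "\<bar>b k * sin (real k * t)\<bar> \<le> \<bar>b k\<bar>"
      by (simp_all add: abs_mult mult_left_le)
    then show ?thesis by linarith
  qed
  show F: "F \<in> C_space"
    unfolding F_def by (rule C_space_suminf[OF trig_term_C_space bd s])
  have tw: "(\<integral>t. cos (real k * t + d) * (a j * cos (real j * t) + b j * sin (real j * t)) \<partial>period_measure)
     = (if j = k then (if k = 0 then 2 * pi * cos d * a k else pi * (a k * cos d - b k * sin d)) else 0)" for j d
  proof -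
    have i: "integrable period_measure (\<lambda>t. cos (real k * t + d) * cos (real j * t + e))" for e
      by (rule bper_integrable[OF bper_mult[OF bper_harmonic bper_harmonic]])
    have "cos (real k * t + d) * (a j * cos (real j * t) + b j * sin (real j * t)) =
       a j * (cos (real k * t + d) * cos (real j * t + 0)) + b j * (cos (real k * t + d) * cos (real j * t + (- pi / 2)))" for t
      by (simp add: cos_diff algebra_simps)
    then have "(\<integral>t. cos (real k * t + d) * (a j * cos (real j * t) + b j * sin (real j * t)) \<partial>period_measure) =
       a j * (\<integral>t. cos (real k * t + d) * cos (real j * t + 0) \<partial>period_measure) +
       b j * (\<integral>t. cos (real k * t + d) * cos (real j * t + (- pi / 2)) \<partial>period_measure)"
      using i by (simp only: Bochner_Integration.integral_add integral_mult_right_zero integrable_mult_right)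
    then show ?thesis unfolding integral_harmonic_product by (simp add: cos_add algebra_simps)
  qed
  have "(\<lambda>j. \<integral>t. cos (real k * t + d) * (a j * cos (real j * t) + b j * sin (real j * t)) \<partial>period_measure)
      sums (\<integral>t. cos (real k * t + d) * F t \<partial>period_measure)" for d
    unfolding F_def
    by (rule sums_integral_mult[OF bper_integrable[OF bper_harmonic] _ bd s])
       (rule bperD(2)[OF C_space_bper[OF trig_term_C_space]])
  then have "(\<lambda>j. if j = k then (if k = 0 then 2 * pi * cos d * a k else pi * (a k * cos d - b k * sin d)) else 0)
      sums (\<integral>t. cos (real k * t + d) * F t \<partial>period_measure)" for d
    unfolding tw .
  from sums_unique2[OF this sums_single]
  have I: "(\<integral>t. cos (real k * t + d) * F t \<partial>period_measure) =
      (if k = 0 then 2 * pi * cos d * a k else pi * (a k * cos d - b k * sin d))" for d .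
  show "fourier_a F k = (if k = 0 then 2 * a 0 else a k)"
    using I[of 0] by (simp add: fourier_a_def mult.commute)
  show "fourier_b F k = (if k = 0 then 0 else b k)"
    unfolding fourier_b_def sin_harmonic mult.commute[of "F _"] I by (simp add: cos_add)
qed

text \<open>The series defines a continuous function with the same coefficients, which agrees with
  \<open>f\<close> by uniqueness. Terms are indexed from \<open>Suc k\<close>, the form in which
  partial sums are subtracted later.\<close>

lemma fourier_series_sums:
  assumes f: "f \<in> C_space" and s: "summable (\<lambda>k. \<bar>fourier_a f k\<bar> + \<bar>fourier_b f k\<bar>)"
  shows "(\<lambda>k. fourier_a f (Suc k) * cos (real (Suc k) * x) + fourier_b f (Suc k) * sin (real (Suc k) * x))
    sums (f x - fourier_a f 0 / 2)"
proof -
  define a where "a = (\<lambda>k. if k = 0 then fourier_a f 0 / 2 else fourier_a f k)"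
  define b where "b = (\<lambda>k. fourier_b f k)"
  have s': "summable (\<lambda>k. \<bar>a k\<bar> + \<bar>b k\<bar>)"
    by (rule summable_comparison_test'[OF s]) (auto simp: a_def b_def)
  define F where "F = (\<lambda>t. \<Sum>k. a k * cos (real k * t) + b k * sin (real k * t))"
  note F = fourier_of_series[OF s', folded F_def]
  have b0: "fourier_b f 0 = 0" by (simp add: fourier_b_def)
  have if': "integrable period_measure (\<lambda>t. f t * cos (real k * t))" "integrable period_measure (\<lambda>t. f t * sin (real k * t))"
    and iF: "integrable period_measure (\<lambda>t. F t * cos (real k * t))" "integrable period_measure (\<lambda>t. F t * sin (real k * t))" for k
    using C_space_bper[OF f] C_space_bper[OF F(1)] by (auto intro!: bper_integrable bper_mult bper_cos bper_sin)
  have "fourier_a (\<lambda>t. f t - F t) k = fourier_a f k - fourier_a F k"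
    "fourier_b (\<lambda>t. f t - F t) k = fourier_b f k - fourier_b F k" for k
    using if'[of k] iF[of k] by (simp_all add: fourier_a_def fourier_b_def left_diff_distrib right_diff_distrib diff_divide_distrib)
  then have "f x - F x = 0"
    by (intro fourier_uniqueness[OF C_space_diff[OF f F(1)]]) (auto simp: F(2,3) a_def b_def b0)
  then have fx: "f x = F x" by simp
  have bd: "norm (a k * cos (real k * x) + b k * sin (real k * x)) \<le> \<bar>a k\<bar> + \<bar>b k\<bar>" for k
  proof -
    have "\<bar>a k * cos (real k * x)\<bar> \<le> \<bar>a k\<bar>" "\<bar>b k * sin (real k * x)\<bar> \<le> \<bar>b k\<bar>"
      by (simp_all add: abs_mult mult_left_le)
    then show ?thesis unfolding real_norm_def by linarith
  qed
  have "(\<lambda>k. a k * cos (real k * x) + b k * sin (real k * x)) sums F x"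
    unfolding F_def by (rule summable_sums[OF summable_comparison_test'[OF s' bd]])
  then have "(\<lambda>k. a (Suc k) * cos (real (Suc k) * x) + b (Suc k) * sin (real (Suc k) * x)) sums (F x - a 0)"
    by (subst sums_Suc_iff) simp
  then show ?thesis by (simp add: a_def b_def fx)
qed

text \<open>For one harmonic, equality as functions of \<open>x\<close> amounts to rotating the pair
  of coefficients by the angle \<gamma> and scaling by \<open>\<psi>k\<close>. This replaces the
  functional identity in \<open>is_psi_beta_deriv\<close> by formulas for coefficients.\<close>

lemma psi_beta_relation_iff:
  fixes \<psi>k a b a' b' \<gamma> :: real
  assumes k: "k \<ge> 1" and "\<psi>k > 0"
  shows "(\<forall>x. a' * cos (real k * x) + b' * sin (real k * x) =
      1 / \<psi>k * (a * cos (real k * x + \<gamma>) + b * sin (real k * x + \<gamma>)))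
    \<longleftrightarrow> a = \<psi>k * (a' * cos \<gamma> - b' * sin \<gamma>) \<and> b = \<psi>k * (a' * sin \<gamma> + b' * cos \<gamma>)"
proof
  assume *: "\<forall>x. a' * cos (real k * x) + b' * sin (real k * x) =
      1 / \<psi>k * (a * cos (real k * x + \<gamma>) + b * sin (real k * x + \<gamma>))"
  have x: "a * cos (y + \<gamma>) + b * sin (y + \<gamma>) = \<psi>k * (a' * cos y + b' * sin y)" for y
    using *[rule_format, of "y / real k"] assms by (simp add: field_simps)
  \<comment> \<open>At \<open>- \<gamma>\<close> and \<open>pi / 2 - \<gamma>\<close> the shifted
    harmonic reduces to \<open>a\<close> and to \<open>b\<close>.\<close>
  have "a = \<psi>k * (a' * cos (- \<gamma>) + b' * sin (- \<gamma>))" using x[of "- \<gamma>"] by simp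
  moreover have "b = \<psi>k * (a' * cos (pi / 2 - \<gamma>) + b' * sin (pi / 2 - \<gamma>))" using x[of "pi / 2 - \<gamma>"] by simp
  ultimately show "a = \<psi>k * (a' * cos \<gamma> - b' * sin \<gamma>) \<and> b = \<psi>k * (a' * sin \<gamma> + b' * cos \<gamma>)"
    by (simp add: cos_diff sin_diff)
next
  assume *: "a = \<psi>k * (a' * cos \<gamma> - b' * sin \<gamma>) \<and> b = \<psi>k * (a' * sin \<gamma> + b' * cos \<gamma>)"
  show "\<forall>x. a' * cos (real k * x) + b' * sin (real k * x) =
      1 / \<psi>k * (a * cos (real k * x + \<gamma>) + b * sin (real k * x + \<gamma>))"
  proof
    fix x
    define y where "y = real k * x"
    have "a * cos (y + \<gamma>) + b * sin (y + \<gamma>) = \<psi>k * ((a' * cos y + b' * sin y) * ((sin \<gamma>)\<^sup>2 + (cos \<gamma>)\<^sup>2))"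
      by (simp only: * cos_add sin_add power2_eq_square) (simp only: algebra_simps)
    then have "a * cos (y + \<gamma>) + b * sin (y + \<gamma>) = \<psi>k * (a' * cos y + b' * sin y)" by simp
    then show "a' * cos (real k * x) + b' * sin (real k * x) =
      1 / \<psi>k * (a * cos (real k * x + \<gamma>) + b * sin (real k * x + \<gamma>))"
      using assms(2) unfolding y_def[symmetric] by simp
  qed
qed

section \<open>Remainders of de la Vallee Poussin sums\<close>

text \<open>In use, \<open>m\<close> is the lowest harmonic that some partial sum in the mean omits,
  and \<open>c j\<close> is the weight of harmonic \<open>m + j\<close>.\<close>

definition phase_kernel :: "(nat \<Rightarrow> real) \<Rightarrow> nat \<Rightarrow> real \<Rightarrow> real \<Rightarrow> real" where
  "phase_kernel c m \<gamma> t = (\<Sum>j. c j * cos (real (m + j) * t + \<gamma>))"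

lemma phase_kernel_C_space:
  assumes "summable (\<lambda>j. \<bar>c j\<bar>)"
  shows "phase_kernel c m \<gamma> \<in> C_space"
  unfolding phase_kernel_def
  by (rule C_space_suminf[OF C_space_cmult[OF harmonic_C_space] _ assms]) (simp add: abs_mult mult_left_le)

lemma fourier_bound:
  assumes "integrable period_measure f"
  shows "\<bar>fourier_a f k\<bar> \<le> (\<integral>t. \<bar>f t\<bar> \<partial>period_measure) / pi"
    "\<bar>fourier_b f k\<bar> \<le> (\<integral>t. \<bar>f t\<bar> \<partial>period_measure) / pi"
proof -
  have *: "\<bar>\<integral>t. f t * u t \<partial>period_measure\<bar> \<le> (\<integral>t. \<bar>f t\<bar> \<partial>period_measure)"
    if u: "bounded_periodic u" "\<And>t. \<bar>u t\<bar> \<le> 1" for u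
  proof -
    have "\<bar>\<integral>t. f t * u t \<partial>period_measure\<bar> \<le> (\<integral>t. \<bar>f t * u t\<bar> \<partial>period_measure)"
      by (rule integral_abs_bound)
    also have "\<dots> \<le> (\<integral>t. \<bar>f t\<bar> \<partial>period_measure)"
      by (rule integral_mono[OF integrable_abs[OF integrable_mult_bper[OF assms u(1)]] integrable_abs[OF assms]])
         (simp add: abs_mult mult_left_le u(2))
    finally show ?thesis .
  qed
  show "\<bar>fourier_a f k\<bar> \<le> (\<integral>t. \<bar>f t\<bar> \<partial>period_measure) / pi"
    using *[OF bper_cos[of k]] by (simp add: fourier_a_def abs_mult divide_right_mono)
  show "\<bar>fourier_b f k\<bar> \<le> (\<integral>t. \<bar>f t\<bar> \<partial>period_measure) / pi"
    using *[OF bper_sin[of k]] by (simp add: fourier_b_def abs_mult divide_right_mono)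
qed

text \<open>Fourier coefficients of an integrable function are bounded, so the decay of \<psi> alone
  gives absolute summability. It serves both an \<open>f\<close> given in the class and an
  \<open>f\<close> built from a prescribed derivative.\<close>

lemma psi_coefficients_summable:
  assumes "summable \<psi>" "\<And>k. k \<ge> 1 \<Longrightarrow> \<psi> k > 0" and f: "integrable period_measure f"
    and a: "\<And>k. k \<ge> 1 \<Longrightarrow> a k = \<psi> k * (fourier_a f k * cos \<gamma> - fourier_b f k * sin \<gamma>)"
    and b: "\<And>k. k \<ge> 1 \<Longrightarrow> b k = \<psi> k * (fourier_a f k * sin \<gamma> + fourier_b f k * cos \<gamma>)"
  shows "summable (\<lambda>k. \<bar>a k\<bar> + \<bar>b k\<bar> :: real)"
proof (rule summable_comparison_test')
  define M where "M = (\<integral>t. \<bar>f t\<bar> \<partial>period_measure) / pi"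
  show "summable (\<lambda>k. \<psi> k * (4 * M))" using assms(1) by (rule summable_mult2)
  fix k :: nat assume k: "1 \<le> k"
  have *: "\<bar>u * x\<bar> \<le> M" if "\<bar>u\<bar> \<le> M" "\<bar>x\<bar> \<le> 1" for u x :: real
  proof -
    have "\<bar>u * x\<bar> \<le> \<bar>u\<bar>" using that(2) by (simp add: abs_mult mult_left_le)
    then show ?thesis using that(1) by linarith
  qed
  note fb = fourier_bound[OF f, of k, folded M_def]
  have "\<bar>fourier_a f k * cos \<gamma> - fourier_b f k * sin \<gamma>\<bar> \<le> 2 * M"
    using *[OF fb(1), of "cos \<gamma>"] *[OF fb(2), of "sin \<gamma>"] by simp
  moreover have "\<bar>fourier_a f k * sin \<gamma> + fourier_b f k * cos \<gamma>\<bar> \<le> 2 * M"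
    using *[OF fb(1), of "sin \<gamma>"] *[OF fb(2), of "cos \<gamma>"] by simp
  ultimately have "\<bar>a k\<bar> \<le> \<psi> k * (2 * M)" "\<bar>b k\<bar> \<le> \<psi> k * (2 * M)"
    using assms(2)[OF k] by (simp_all add: a[OF k] b[OF k] abs_mult)
  then show "norm (\<bar>a k\<bar> + \<bar>b k\<bar>) \<le> \<psi> k * (4 * M)" by simp
qed

text \<open>Origin of the weight \<open>min p (j + 1)\<close>: among the \<open>p\<close> partial
  sums in the mean, these are the ones that omit the harmonic \<open>n - p + 1 + j\<close>.\<close>

lemma card_window: "card {i \<in> {n - p..n - 1}. i \<le> n - p + j} = min p (j + 1)"
  if "1 \<le> p" "p \<le> n" for n p j :: nat
proof -
  have "{i \<in> {n - p..n - 1}. i \<le> n - p + j} = {n - p..<n - p + min p (j + 1)}"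
    using that by auto
  then show ?thesis by simp
qed

lemma vallee_poussin_remainder:
  assumes psi: "summable \<psi>" "\<And>k. k \<ge> 1 \<Longrightarrow> \<psi> k > 0" and np: "1 \<le> p" "p \<le> n"
    and f: "f \<in> C_space" and d: "is_psi_beta_deriv \<psi> \<beta> f \<phi>"
  defines "m \<equiv> n - p + 1"
  shows "f x - vallee_poussin n p f x = \<psi> m / (pi * real p) *
    (\<integral>t. \<phi> t * phase_kernel (\<lambda>j. real (min p (j + 1)) * (\<psi> (m + j) / \<psi> m)) m (\<beta> * pi / 2) (t - x) \<partial>period_measure)"
proof -
  define \<gamma> where "\<gamma> = \<beta> * pi / 2"
  have int: "integrable period_measure \<phi>"
    using d L_space_integrable[of 1 \<phi>] by (simp add: is_psi_beta_deriv_def)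
  have rel: "fourier_a f k = \<psi> k * (fourier_a \<phi> k * cos \<gamma> - fourier_b \<phi> k * sin \<gamma>)"
    "fourier_b f k = \<psi> k * (fourier_a \<phi> k * sin \<gamma> + fourier_b \<phi> k * cos \<gamma>)" if "k \<ge> 1" for k
    using d psi_beta_relation_iff[OF that psi(2)[OF that], of "fourier_a \<phi> k" "fourier_b \<phi> k" "fourier_a f k" \<gamma> "fourier_b f k"]
      that unfolding is_psi_beta_deriv_def \<gamma>_def by blast+
  define H where "H = (\<lambda>k. fourier_a f k * cos (real k * x) + fourier_b f k * sin (real k * x))"
  have H: "H k = \<psi> k / pi * (\<integral>t. \<phi> t * cos (real k * (t - x) + \<gamma>) \<partial>period_measure)" if "k \<ge> 1" for k
  proof -
    have "(\<integral>t. \<phi> t * cos (real k * (t - x) + \<gamma>) \<partial>period_measure)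
        = (\<integral>t. \<phi> t * cos (real k * t + (\<gamma> - real k * x)) \<partial>period_measure)"
      by (simp add: algebra_simps)
    also have "\<dots> = pi * (fourier_a \<phi> k * cos (\<gamma> - real k * x) - fourier_b \<phi> k * sin (\<gamma> - real k * x))"
      by (rule integral_times_harmonic[OF int])
    finally have "\<psi> k / pi * (\<integral>t. \<phi> t * cos (real k * (t - x) + \<gamma>) \<partial>period_measure)
        = \<psi> k * (fourier_a \<phi> k * cos (\<gamma> - real k * x) - fourier_b \<phi> k * sin (\<gamma> - real k * x))"
      by simp
    then show ?thesis
      by (simp only: H_def rel[OF that] cos_diff sin_diff) (simp only: algebra_simps)
  qed
  have sH: "(\<lambda>k. H (Suc k)) sums (f x - fourier_a f 0 / 2)"
    unfolding H_def using psi_coefficients_summable[OF psi int rel]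
    by (intro fourier_series_sums[OF f])
  \<comment> \<open>\<open>m + j\<close> is one more than \<open>n - p + j\<close>, so the condition
    \<open>i \<le> n - p + j\<close> says that harmonic \<open>m + j\<close> lies beyond the partial
    sum of order \<open>i\<close>.\<close>
  have tail: "(\<lambda>j. if i \<le> n - p + j then H (m + j) else 0) sums (f x - fourier_sum i f x)"
    if i: "n - p \<le> i" for i
  proof -
    have "(\<lambda>k. if k < i then H (Suc k) else 0) sums (\<Sum>k<i. H (Suc k))"
      by (rule sums_If_finite_set[of "{..<i}" "\<lambda>k. H (Suc k)", simplified])
    then have "(\<lambda>k. H (Suc k) - (if k < i then H (Suc k) else 0)) sums (f x - fourier_a f 0 / 2 - (\<Sum>k<i. H (Suc k)))"
      by (rule sums_diff[OF sH])
    moreover have "fourier_sum i f x = fourier_a f 0 / 2 + (\<Sum>k<i. H (Suc k))"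
      unfolding fourier_sum_def H_def by (simp add: sum.atLeast1_atMost_eq)
    moreover have "H (Suc k) - (if k < i then H (Suc k) else 0) = (if i \<le> k then H (Suc k) else 0)" for k
      by simp
    ultimately have "(\<lambda>k. if i \<le> k then H (Suc k) else 0) sums (f x - fourier_sum i f x)"
      by (simp only: diff_diff_eq)
    \<comment> \<open>Since \<open>i \<ge> n - p\<close>, the terms with \<open>k < n - p\<close>
      vanish, and all remainders can be indexed from the common starting harmonic
      \<open>m\<close>.\<close>
    moreover have "(\<Sum>k<n - p. if i \<le> k then H (Suc k) else 0) = 0"
      using i by (intro sum.neutral) auto
    ultimately have "(\<lambda>j. if i \<le> j + (n - p) then H (Suc (j + (n - p))) else 0) sums (f x - fourier_sum i f x)"
      using sums_iff_shift[of "\<lambda>k. if i \<le> k then H (Suc k) else 0" "n - p" "f x - fourier_sum i f x"] by simp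
    moreover have "Suc (j + (n - p)) = m + j" "j + (n - p) = n - p + j" for j by (simp_all add: m_def)
    ultimately show ?thesis by (simp only:)
  qed
  have "(\<lambda>j. \<Sum>i=n-p..n-1. if i \<le> n - p + j then H (m + j) else 0) sums (\<Sum>i=n-p..n-1. f x - fourier_sum i f x)"
    by (intro sums_sum tail) simp
  moreover have "(\<Sum>i=n-p..n-1. if i \<le> n - p + j then H (m + j) else 0) = real (min p (j + 1)) * H (m + j)" for j
    using card_window[OF np, of j] by (simp add: sum.If_cases Int_def)
  moreover have "(\<Sum>i=n-p..n-1. f x - fourier_sum i f x) = real p * (f x - vallee_poussin n p f x)"
  proof -
    have "card {n-p..n-1} = p" using np by simp
    then show ?thesis using np by (simp add: vallee_poussin_def sum_subtractf right_diff_distrib)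
  qed
  ultimately have S1: "(\<lambda>j. real (min p (j + 1)) * H (m + j)) sums (real p * (f x - vallee_poussin n p f x))"
    by simp
  define c where "c = (\<lambda>j. real (min p (j + 1)) * (\<psi> (m + j) / \<psi> m))"
  have pm: "\<psi> m > 0" using psi(2) by (simp add: m_def)
  have cb: "\<bar>c j * cos y\<bar> \<le> real p * (\<psi> (m + j) / \<psi> m)" for j y
  proof -
    have pos: "\<psi> (m + j) > 0" using psi(2) by (simp add: m_def)
    have "\<bar>c j * cos y\<bar> \<le> \<bar>c j\<bar>" by (simp add: abs_mult mult_left_le)
    also have "\<dots> = c j" using pos pm by (simp add: c_def)
    also have "\<dots> \<le> real p * (\<psi> (m + j) / \<psi> m)" unfolding c_def using pos pm by (intro mult_right_mono) simp_all
    finally show ?thesis .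
  qed
  have cs: "summable (\<lambda>j. real p * (\<psi> (m + j) / \<psi> m))"
    using psi(1) summable_iff_shift[of \<psi> m] by (intro summable_mult summable_divide) (simp add: add.commute)
  have "(\<lambda>j. \<integral>t. \<phi> t * (c j * cos (real (m + j) * (t - x) + \<gamma>)) \<partial>period_measure) sums
      (\<integral>t. \<phi> t * (\<Sum>j. c j * cos (real (m + j) * (t - x) + \<gamma>)) \<partial>period_measure)"
    by (rule sums_integral_mult[OF int _ cb cs]) simp
  moreover have "(\<integral>t. \<phi> t * (c j * cos (real (m + j) * (t - x) + \<gamma>)) \<partial>period_measure)
      = real (min p (j + 1)) * H (m + j) * (pi / \<psi> m)" for j
  proof -
    have "(\<integral>t. \<phi> t * (c j * cos (real (m + j) * (t - x) + \<gamma>)) \<partial>period_measure)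
      = c j * (\<integral>t. \<phi> t * cos (real (m + j) * (t - x) + \<gamma>) \<partial>period_measure)"
      by (simp add: mult.left_commute flip: integral_mult_right_zero)
    then show ?thesis using pm by (subst H) (simp_all add: m_def c_def)
  qed
  ultimately have "(\<lambda>j. real (min p (j + 1)) * H (m + j) * (pi / \<psi> m)) sums (\<integral>t. \<phi> t * phase_kernel c m \<gamma> (t - x) \<partial>period_measure)"
    by (simp add: phase_kernel_def)
  from sums_unique2[OF this sums_mult2[OF S1]]
  have "(\<integral>t. \<phi> t * phase_kernel c m \<gamma> (t - x) \<partial>period_measure) = real p * (f x - vallee_poussin n p f x) * (pi / \<psi> m)" .
  then show ?thesis
    unfolding c_def[symmetric] \<gamma>_def[symmetric] using np pm by simp
qed

text \<open>Prescribing the coefficients and summing the absolutely convergent series yields a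
  continuous \<open>f\<close>. Every bounded \<phi> in \<open>U0 s\<close> is thus realised within
  the class, as the lower bound demands.\<close>

lemma exists_psi_beta_integral:
  assumes psi: "summable \<psi>" "\<And>k. k \<ge> 1 \<Longrightarrow> \<psi> k > 0" and s: "1 \<le> s"
    and \<phi>: "\<phi> \<in> U0 s" "bounded_periodic \<phi>"
  obtains f where "f \<in> C_psi_beta_s \<psi> \<beta> s" "f \<in> C_space" "is_psi_beta_deriv \<psi> \<beta> f \<phi>"
proof -
  define \<gamma> where "\<gamma> = \<beta> * pi / 2"
  define a where "a = (\<lambda>k. if k = 0 then 0 else \<psi> k * (fourier_a \<phi> k * cos \<gamma> - fourier_b \<phi> k * sin \<gamma>))"
  define b where "b = (\<lambda>k. if k = 0 then 0 else \<psi> k * (fourier_a \<phi> k * sin \<gamma> + fourier_b \<phi> k * cos \<gamma>))"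
  have sm: "summable (\<lambda>k. \<bar>a k\<bar> + \<bar>b k\<bar>)"
    by (rule psi_coefficients_summable[OF psi bper_integrable[OF \<phi>(2)], of _ \<gamma>]) (simp_all add: a_def b_def)
  define F where "F = (\<lambda>t. \<Sum>k. a k * cos (real k * t) + b k * sin (real k * t))"
  note F = fourier_of_series[OF sm, folded F_def]
  have "fourier_a \<phi> 0 = 0" using \<phi>(1) by (simp add: U0_def fourier_a_def)
  moreover have "\<forall>x. fourier_a \<phi> k * cos (real k * x) + fourier_b \<phi> k * sin (real k * x) =
        1 / \<psi> k * (fourier_a F k * cos (real k * x + \<gamma>) + fourier_b F k * sin (real k * x + \<gamma>))" if "k \<ge> 1" for k
    by (subst psi_beta_relation_iff[OF that psi(2)[OF that]]) (use that in \<open>simp add: F(2,3) a_def b_def\<close>)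
  ultimately have d: "is_psi_beta_deriv \<psi> \<beta> F \<phi>"
    unfolding is_psi_beta_deriv_def \<gamma>_def[symmetric] using bper_L_space[OF \<phi>(2)] by simp
  moreover have "F \<in> C_psi_beta_s \<psi> \<beta> s"
    unfolding C_psi_beta_s_def C_class_def L_class_def
    using F(1) bper_L_space[OF C_space_bper[OF F(1)]] d \<phi>(1) by auto
  ultimately show ?thesis using that F(1) by blast
qed

section \<open>The kernel of a geometric sequence\<close>

lemma cmod_cis_diff_le: "cmod (cis x - cis y) \<le> \<bar>x - y\<bar>"
proof -
  have "cmod (cis x - cis y) = cmod (cis y * (cis (x - y) - 1))"
    by (simp add: right_diff_distrib cis_mult)
  also have "\<dots> = 2 * \<bar>sin ((x - y) / 2)\<bar>"
    using dist_exp_i_1[of "x - y"] by (simp add: norm_mult cis_conv_exp)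
  also have "\<dots> \<le> \<bar>x - y\<bar>" using abs_sin_x_le_abs_x[of "(x - y) / 2"] by simp
  finally show ?thesis .
qed

text \<open>With \<open>z = q e\<^sup>i\<^sup>t\<close> this is \<open>(1 - z\<^sup>p) / (1 - z)\<^sup>2\<close>.\<close>

definition vp_amplitude :: "real \<Rightarrow> nat \<Rightarrow> real \<Rightarrow> complex" where
  "vp_amplitude q p t = (\<Sum>i<p. (of_real q * cis t) ^ i) * (1 / (1 - of_real q * cis t))"

context
  fixes q :: real
  assumes q: "0 < q" "q < 1"
begin

lemma cmod_q_cis: "cmod (of_real q * cis t) = q"
  using q by (simp add: norm_mult)

lemma one_minus_q_cis: "1 - q \<le> cmod (1 - of_real q * cis t)" "1 - of_real q * cis t \<noteq> 0"
  "of_real q * cis t \<noteq> 1"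
proof -
  show "1 - q \<le> cmod (1 - of_real q * cis t)"
    using norm_triangle_ineq2[of 1 "of_real q * cis t"] unfolding cmod_q_cis by simp
  then show "1 - of_real q * cis t \<noteq> 0" using q by auto
  then show "of_real q * cis t \<noteq> 1" by auto
qed

text \<open>Cauchy product of 1 + z + ... + z^(p-1) with the geometric series: \<open>z ^ j\<close>
  arises once for each \<open>i < p\<close> with \<open>i \<le> j\<close>, that is,
  \<open>min p (j + 1)\<close> times.\<close>

lemma vp_amplitude_sums:
  "(\<lambda>j. of_real (real (min p (j + 1)) * q ^ j) * cis (real j * t)) sums vp_amplitude q p t"
proof -
  define z where "z = of_real q * cis t"
  have z1: "cmod z < 1" unfolding z_def cmod_q_cis by (rule q(2))
  have "(\<lambda>j. if i \<le> j then z ^ j else 0) sums (z ^ i * (1 / (1 - z)))" for i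
  proof -
    have "(\<lambda>j. z ^ i * z ^ j) sums (z ^ i * (1 / (1 - z)))"
      by (rule sums_mult[OF geometric_sums[OF z1]])
    then have "(\<lambda>j. if i \<le> j + i then z ^ (j + i) else 0) sums (z ^ i * (1 / (1 - z)))"
      by (simp add: power_add mult.commute)
    moreover have "(\<Sum>j<i. if i \<le> j then z ^ j else 0) = 0" by (intro sum.neutral) auto
    ultimately show ?thesis
      using sums_iff_shift[of "\<lambda>j. if i \<le> j then z ^ j else 0" i "z ^ i * (1 / (1 - z))"] by simp
  qed
  then have "(\<lambda>j. \<Sum>i<p. if i \<le> j then z ^ j else 0) sums (\<Sum>i<p. z ^ i * (1 / (1 - z)))"
    by (intro sums_sum)
  moreover have "(\<Sum>i<p. if i \<le> j then z ^ j else 0) = of_real (real (min p (j + 1)) * q ^ j) * cis (real j * t)" for j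
  proof -
    have "{i. i < p \<and> i \<le> j} = {..<min p (j + 1)}" by auto
    then have "(\<Sum>i<p. if i \<le> j then z ^ j else 0) = of_nat (min p (j + 1)) * z ^ j"
      by (simp add: sum.If_cases Int_def)
    moreover have "z ^ j = of_real (q ^ j) * cis (real j * t)"
      by (simp add: z_def power_mult_distrib Complex.DeMoivre)
    ultimately show ?thesis by (simp only: of_real_mult of_real_of_nat_eq mult.assoc)
  qed
  ultimately show ?thesis
    unfolding vp_amplitude_def z_def[symmetric] sum_distrib_right by simp
qed

lemma cmod_one_minus_q_cis: "(cmod (1 - of_real (q ^ k) * cis (real k * t)))\<^sup>2 = 1 - 2 * q ^ k * cos (real k * t) + q ^ (2 * k)"
proof -
  have *: "(1 - a * c)\<^sup>2 + (a * s)\<^sup>2 = 1 - 2 * a * c + a\<^sup>2 * (s\<^sup>2 + c\<^sup>2)" for a c s :: real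
    by (simp add: power2_eq_square algebra_simps)
  have "(cmod (1 - of_real (q ^ k) * cis (real k * t)))\<^sup>2
      = (1 - q ^ k * cos (real k * t))\<^sup>2 + (q ^ k * sin (real k * t))\<^sup>2"
    unfolding cmod_power2 by simp
  also have "\<dots> = 1 - 2 * q ^ k * cos (real k * t) + (q ^ k)\<^sup>2 * ((sin (real k * t))\<^sup>2 + (cos (real k * t))\<^sup>2)"
    by (rule *)
  finally show ?thesis by (simp add: power_mult mult.commute[of 2])
qed

text \<open>The squared moduli of \<open>1 - z ^ p\<close> and \<open>1 - z\<close> are the
  preceding formula for \<open>k = p\<close> and \<open>k = 1\<close>; the quotient is exactly the
  function whose norm \<open>K_const\<close> takes.\<close>

lemma cmod_vp_amplitude:
  "cmod (vp_amplitude q p t) = sqrt (1 - 2 * q ^ p * cos (real p * t) + q ^ (2 * p)) / (1 - 2 * q * cos t + q\<^sup>2)"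
proof -
  define z where "z = of_real q * cis t"
  have z: "1 - z \<noteq> 0" unfolding z_def by (rule one_minus_q_cis)
  have "(\<Sum>i<p. z ^ i) = (1 - z ^ p) / (1 - z)" using z sum_gp_strict[of z p] by auto
  then have "vp_amplitude q p t = (1 - z ^ p) / (1 - z)\<^sup>2"
    by (simp add: vp_amplitude_def z_def[symmetric] power2_eq_square)
  then have "cmod (vp_amplitude q p t) = cmod (1 - z ^ p) / (cmod (1 - z))\<^sup>2"
    by (simp add: norm_divide norm_power)
  also have "cmod (1 - z ^ p) = sqrt ((cmod (1 - of_real (q ^ p) * cis (real p * t)))\<^sup>2)"
    by (simp add: z_def power_mult_distrib Complex.DeMoivre)
  also have "(cmod (1 - z))\<^sup>2 = 1 - 2 * q * cos t + q\<^sup>2"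
    using cmod_one_minus_q_cis[of 1 t] by (simp add: z_def)
  finally show ?thesis unfolding cmod_one_minus_q_cis .
qed

section \<open>Modulus of continuity of the amplitude\<close>

lemma vp_amplitude_continuous: "continuous_on UNIV (vp_amplitude q p)"
  unfolding vp_amplitude_def by (intro continuous_intros) (simp add: one_minus_q_cis)

lemma vp_amplitude_periodic: "vp_amplitude q p (t + 2 * pi) = vp_amplitude q p t"
proof -
  have "cis (t + 2 * pi) = cis t" by (simp add: complex_eq_iff)
  then show ?thesis by (simp add: vp_amplitude_def)
qed

text \<open>Both denominators are kept: for the supremum norm each is replaced by
  \<open>1 - q\<close>, but in L_1 their product costs only a single power of
  \<open>1 - q\<close>.\<close>

lemma cauchy_factor_diff:
  "cmod (1 / (1 - of_real q * cis (t + v)) - 1 / (1 - of_real q * cis t))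
    \<le> \<bar>v\<bar> / (cmod (1 - of_real q * cis (t + v)) * cmod (1 - of_real q * cis t))"
proof -
  let ?a = "1 - complex_of_real q * cis (t + v)" and ?b = "1 - complex_of_real q * cis t"
  have nz: "?a \<noteq> 0" "?b \<noteq> 0" by (rule one_minus_q_cis)+
  have "1 / ?a - 1 / ?b = (?b - ?a) / (?a * ?b)"
    using nz by (simp add: diff_frac_eq)
  also have "?b - ?a = of_real q * (cis (t + v) - cis t)" by (simp add: right_diff_distrib)
  finally have "cmod (1 / ?a - 1 / ?b) = q * cmod (cis (t + v) - cis t) / (cmod ?a * cmod ?b)"
    using q by (simp add: norm_divide norm_mult)
  also have "\<dots> \<le> 1 * \<bar>v\<bar> / (cmod ?a * cmod ?b)"
    using q cmod_cis_diff_le[of "t + v" t] by (intro divide_right_mono mult_mono) simp_all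
  finally show ?thesis by simp
qed

lemma cauchy_factor_lipschitz:
  "cmod (1 / (1 - of_real q * cis (t + v)) - 1 / (1 - of_real q * cis t)) \<le> \<bar>v\<bar> / (1 - q)\<^sup>2"
proof -
  have "\<bar>v\<bar> / (cmod (1 - of_real q * cis (t + v)) * cmod (1 - of_real q * cis t)) \<le> \<bar>v\<bar> / ((1 - q) * (1 - q))"
    using q by (intro divide_left_mono mult_mono one_minus_q_cis mult_pos_pos) (simp_all add: one_minus_q_cis)
  then show ?thesis using cauchy_factor_diff[of t v] by (simp add: power2_eq_square)
qed

text \<open>Product rule: each of the two factors is at most \<open>1 / (1 - q)\<close> and has
  Lipschitz constant \<open>1 / (1 - q)\<^sup>2\<close>. Estimating the finite geometric sum by the
  full series removes \<open>p\<close> from the bound.\<close>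

lemma vp_amplitude_lipschitz:
  "cmod (vp_amplitude q p (t + v) - vp_amplitude q p t) \<le> 2 * \<bar>v\<bar> / (1 - q) ^ 3"
proof -
  define a where "a = (\<lambda>t. \<Sum>i<p. (complex_of_real q * cis t) ^ i)"
  define b where "b = (\<lambda>t. 1 / (1 - complex_of_real q * cis t))"
  have az: "cmod (a t) \<le> 1 / (1 - q)" for t
  proof -
    have "cmod (a t) \<le> (\<Sum>i<p. cmod ((complex_of_real q * cis t) ^ i))"
      unfolding a_def by (rule norm_sum)
    also have "\<dots> = (\<Sum>i<p. q ^ i)" by (simp only: norm_power cmod_q_cis)
    also have "\<dots> \<le> (\<Sum>i. q ^ i)" using q by (intro sum_le_suminf summable_geometric) simp_all
    also have "\<dots> = 1 / (1 - q)" using q by (intro suminf_geometric) simp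
    finally show ?thesis .
  qed
  have ad: "cmod (a (t + v) - a t) \<le> \<bar>v\<bar> / (1 - q)\<^sup>2"
  proof -
    \<comment> \<open>The Lipschitz constant \<open>i\<close> of the \<open>i\<close>-th harmonic is
      raised to \<open>Suc i\<close>, to match this series for
      \<open>1 / (1 - q)\<^sup>2\<close>.\<close>
    have d: "(\<lambda>n. of_nat (Suc n) * q ^ n) sums (1 / (1 - q)\<^sup>2)"
      using q by (intro geometric_deriv_sums) simp
    have "a (t + v) - a t = (\<Sum>i<p. of_real (q ^ i) * (cis (real i * (t + v)) - cis (real i * t)))"
      by (simp add: a_def sum_subtractf[symmetric] power_mult_distrib Complex.DeMoivre right_diff_distrib)
    then have "cmod (a (t + v) - a t) \<le> (\<Sum>i<p. cmod (of_real (q ^ i) * (cis (real i * (t + v)) - cis (real i * t))))"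
      using norm_sum by metis
    also have "\<dots> \<le> (\<Sum>i<p. \<bar>v\<bar> * (of_nat (Suc i) * q ^ i))"
    proof (rule sum_mono)
      fix i
      have "cmod (cis (real i * (t + v)) - cis (real i * t)) \<le> real i * \<bar>v\<bar>"
        using cmod_cis_diff_le[of "real i * (t + v)" "real i * t"] by (simp add: algebra_simps abs_mult)
      also have "\<dots> \<le> real (Suc i) * \<bar>v\<bar>" by (intro mult_right_mono) simp_all
      finally have "q ^ i * cmod (cis (real i * (t + v)) - cis (real i * t)) \<le> q ^ i * (real (Suc i) * \<bar>v\<bar>)"
        using q by (intro mult_left_mono) simp_all
      then show "cmod (of_real (q ^ i) * (cis (real i * (t + v)) - cis (real i * t))) \<le> \<bar>v\<bar> * (of_nat (Suc i) * q ^ i)"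
        using q by (simp add: norm_mult norm_power mult_ac)
    qed
    also have "\<dots> = \<bar>v\<bar> * (\<Sum>i<p. of_nat (Suc i) * q ^ i)" by (simp only: sum_distrib_left)
    also have "\<dots> \<le> \<bar>v\<bar> * (1 / (1 - q)\<^sup>2)"
      using q sum_le_suminf[OF sums_summable[OF d], of "{..<p}"] sums_unique[OF d]
      by (intro mult_left_mono) simp_all
    finally show ?thesis by simp
  qed
  have bz: "cmod (b t) \<le> 1 / (1 - q)" for t
    unfolding b_def norm_divide using q one_minus_q_cis(1)[of t] by (simp add: frac_le)
  have bd: "cmod (b (t + v) - b t) \<le> \<bar>v\<bar> / (1 - q)\<^sup>2"
    unfolding b_def by (rule cauchy_factor_lipschitz)
  have "vp_amplitude q p (t + v) - vp_amplitude q p t = a (t + v) * (b (t + v) - b t) + (a (t + v) - a t) * b t"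
    by (simp add: vp_amplitude_def a_def b_def algebra_simps)
  then have "cmod (vp_amplitude q p (t + v) - vp_amplitude q p t)
      \<le> cmod (a (t + v)) * cmod (b (t + v) - b t) + cmod (a (t + v) - a t) * cmod (b t)"
    by (metis norm_mult norm_triangle_ineq)
  also have "\<dots> \<le> 1 / (1 - q) * (\<bar>v\<bar> / (1 - q)\<^sup>2) + \<bar>v\<bar> / (1 - q)\<^sup>2 * (1 / (1 - q))"
    using q by (intro add_mono mult_mono az ad bz bd) simp_all
  also have "\<dots> = 2 * \<bar>v\<bar> / (1 - q) ^ 3" by (simp add: power2_eq_square power3_eq_cube)
  finally show ?thesis .
qed

text \<open>The Poisson kernel satisfies \<open>(1 - q\<^sup>2) * P t = 2 * F t - 1\<close> with
  \<open>F\<close> the real part of 1/(1 - z), and the integral of \<open>F\<close> is read off its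
  zeroth coefficient. The exact value \<open>2 * pi / (1 - q\<^sup>2)\<close> is then weakened to a
  power of \<open>1 - q\<close>.\<close>

lemma poisson_integral:
  "(\<integral>t. 1 / (cmod (1 - of_real q * cis t))\<^sup>2 \<partial>period_measure) \<le> 2 * pi / (1 - q)"
  "bounded_periodic (\<lambda>t. 1 / (cmod (1 - of_real q * cis t))\<^sup>2)"
proof -
  define P where "P = (\<lambda>t. 1 / (cmod (1 - of_real q * cis t))\<^sup>2)"
  have D: "(cmod (1 - of_real q * cis t))\<^sup>2 = 1 - 2 * q * cos t + q\<^sup>2" for t
    using cmod_one_minus_q_cis[of 1 t] by simp
  have "cis (t + 2 * pi) = cis t" for t by (simp add: complex_eq_iff)
  then have "P \<in> C_space"
    unfolding P_def C_space_def periodic_2pi_def by (auto intro!: continuous_intros simp: one_minus_q_cis)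
  then have P: "bounded_periodic P" by (rule C_space_bper)
  then show "bounded_periodic (\<lambda>t. 1 / (cmod (1 - of_real q * cis t))\<^sup>2)" by (simp add: P_def)
  define F where "F = (\<lambda>t. \<Sum>k. q ^ k * cos (real k * t) + 0 * sin (real k * t))"
  have s: "summable (\<lambda>k. \<bar>q ^ k\<bar> + \<bar>0\<bar>)" using q by (simp add: summable_geometric)
  note F = fourier_of_series[OF s, folded F_def]
  have IF: "(\<integral>t. F t \<partial>period_measure) = 2 * pi"
    using F(2)[of 0] by (simp add: fourier_a_def divide_eq_eq)
  have Ft: "F t = (1 - q * cos t) * P t" for t
  proof -
    have "(\<lambda>j. Re ((of_real q * cis t) ^ j)) sums Re (1 / (1 - of_real q * cis t))"
      using q by (intro sums_Re geometric_sums) (simp add: norm_mult)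
    moreover have "Re ((of_real q * cis t) ^ j) = q ^ j * cos (real j * t)" for j
      by (simp add: power_mult_distrib Complex.DeMoivre flip: of_real_power)
    moreover have "Re (1 / (1 - of_real q * cis t)) = (1 - q * cos t) * P t"
      by (simp add: P_def Re_divide cmod_power2)
    ultimately show ?thesis unfolding F_def using sums_unique by fastforce
  qed
  have "(1 - q\<^sup>2) * P t = 2 * F t + - 1" for t
  proof -
    have "(1 - 2 * q * cos t + q\<^sup>2) * P t = 1"
      using one_minus_q_cis(2)[of t] unfolding D[symmetric] P_def by simp
    then show ?thesis unfolding Ft by (simp add: algebra_simps)
  qed
  then have "(\<integral>t. (1 - q\<^sup>2) * P t \<partial>period_measure) = (\<integral>t. 2 * F t + - 1 \<partial>period_measure)" by simp
  also have "\<dots> = 2 * (2 * pi) + (\<integral>t. - 1 \<partial>period_measure)"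
    using bper_integrable[OF C_space_bper[OF F(1)]] bper_integrable[OF bper_const[of "- 1"]]
    by (simp only: Bochner_Integration.integral_add integrable_mult_right integral_mult_right_zero IF)
  also have "\<dots> = 2 * pi" using measure_period by simp
  finally have "(1 - q\<^sup>2) * (\<integral>t. P t \<partial>period_measure) = 2 * pi" by simp
  moreover have "(1 - q) * (\<integral>t. P t \<partial>period_measure) \<le> (1 - q\<^sup>2) * (\<integral>t. P t \<partial>period_measure)"
  proof (rule mult_right_mono)
    show "1 - q \<le> 1 - q\<^sup>2" using q by (simp add: power2_eq_square mult_left_le)
    show "0 \<le> (\<integral>t. P t \<partial>period_measure)" by (simp add: P_def)
  qed
  ultimately show "(\<integral>t. 1 / (cmod (1 - of_real q * cis t))\<^sup>2 \<partial>period_measure) \<le> 2 * pi / (1 - q)"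
    using q by (simp add: P_def field_simps)
qed

lemma vp_amplitude_diff_C_space:
  "(\<lambda>t. cmod (vp_amplitude q p (t + v) - vp_amplitude q p t)) \<in> C_space"
proof (rule cmod_C_space)
  show "continuous_on UNIV (\<lambda>t. vp_amplitude q p (t + v) - vp_amplitude q p t)"
    by (intro continuous_intros continuous_on_compose2[OF vp_amplitude_continuous]) simp_all
  show "vp_amplitude q p (t + 2 * pi + v) - vp_amplitude q p (t + 2 * pi) = vp_amplitude q p (t + v) - vp_amplitude q p t" for t
    using vp_amplitude_periodic[of p "t + v"] vp_amplitude_periodic[of p t] by (simp add: add_ac)
qed

text \<open>Two cases are Lipschitz bounds times \<open>2 * pi\<close>; the third is a genuine L_1
  estimate. The factor \<open>4 * pi\<close> is dictated by \<open>p \<noteq> 1\<close>, and the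
  other cases are doubled to fit it.\<close>

lemma vp_amplitude_modulus:
  assumes r: "1 \<le> r" and v: "0 \<le> v"
  shows "L_norm r (\<lambda>t. cmod (vp_amplitude q p (t + v) - vp_amplitude q p t))
    \<le> 4 * pi * v / (1 - q) ^ sigma_exp r p"
proof -
  note bp = C_space_bper[OF vp_amplitude_diff_C_space[of p v]]
  have amp1: "vp_amplitude q 1 t = 1 / (1 - of_real q * cis t)" for t by (simp add: vp_amplitude_def)
  consider (general) "p \<noteq> 1" | (one) "p = 1" "r \<noteq> 1" | (L1) "p = 1" "r = 1" by blast
  then show ?thesis
  proof cases
    case general
    have "L_norm r (\<lambda>t. cmod (vp_amplitude q p (t + v) - vp_amplitude q p t)) \<le> 2 * pi * (2 * v / (1 - q) ^ 3)"
      using vp_amplitude_lipschitz[of p _ v] v by (intro L_norm_const_le bp r) simp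
    then show ?thesis using general by (simp add: sigma_exp_def)
  next
    case one
    have "L_norm r (\<lambda>t. cmod (vp_amplitude q p (t + v) - vp_amplitude q p t)) \<le> 2 * pi * (v / (1 - q)\<^sup>2)"
      using cauchy_factor_lipschitz[of _ v] v one by (intro L_norm_const_le bp r) (simp add: amp1[simplified])
    also have "\<dots> \<le> 2 * (2 * pi * (v / (1 - q)\<^sup>2))"
    proof -
      have "0 \<le> 2 * pi * (v / (1 - q)\<^sup>2)" using v by simp
      then show ?thesis by linarith
    qed
    finally show ?thesis using one by (simp add: sigma_exp_def)
  next
    case L1
    define P where "P = (\<lambda>t. 1 / (cmod (1 - of_real q * cis t))\<^sup>2)"
    note P = poisson_integral[folded P_def]
    \<comment> \<open>The inequality \<open>x * y \<le> (x\<^sup>2 + y\<^sup>2) / 2\<close> replaces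
      the mixed product of denominators by two translates of \<open>P\<close>, which have the same
      integral.\<close>
    have le: "cmod (vp_amplitude q p (t + v) - vp_amplitude q p t) \<le> (v / 2) * P (t + v) + (v / 2) * P t" for t
    proof -
      define x where "x = 1 / cmod (1 - of_real q * cis (t + v))"
      define y where "y = 1 / cmod (1 - of_real q * cis t)"
      have "cmod (vp_amplitude q p (t + v) - vp_amplitude q p t) \<le> v * (x * y)"
        using cauchy_factor_diff[of t v] v L1(1) by (simp add: amp1[simplified] x_def y_def)
      also have "\<dots> \<le> v * ((x\<^sup>2 + y\<^sup>2) / 2)"
        using v sum_squares_bound[of x y] by (intro mult_left_mono) (simp_all add: mult.assoc)
      also have "\<dots> = (v / 2) * P (t + v) + (v / 2) * P t"
        by (simp add: P_def x_def y_def power_divide algebra_simps add_divide_distrib)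
      finally show ?thesis .
    qed
    have i: "integrable period_measure (\<lambda>t. (v / 2) * P (t + v))" "integrable period_measure (\<lambda>t. (v / 2) * P t)"
      using bper_integrable[OF bper_shift[OF P(2), of v]] bper_integrable[OF P(2)] by simp_all
    have "L_norm r (\<lambda>t. cmod (vp_amplitude q p (t + v) - vp_amplitude q p t))
        = (\<integral>t. cmod (vp_amplitude q p (t + v) - vp_amplitude q p t) \<partial>period_measure)"
      using L1(2) by (simp add: L_norm_def)
    also have "\<dots> \<le> (\<integral>t. (v / 2) * P (t + v) + (v / 2) * P t \<partial>period_measure)"
      by (rule integral_mono[OF bper_integrable[OF bp] Bochner_Integration.integrable_add[OF i] le])
    also have "\<dots> = (v / 2) * (\<integral>t. P t \<partial>period_measure) + (v / 2) * (\<integral>t. P t \<partial>period_measure)"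
      by (simp only: Bochner_Integration.integral_add[OF i] integral_mult_right_zero period_integral_shift[OF P(2)])
    also have "\<dots> = v * (\<integral>t. P t \<partial>period_measure)" by simp
    also have "\<dots> \<le> v * (2 * pi / (1 - q))" using v P(1) by (intro mult_left_mono)
    also have "\<dots> \<le> 2 * (v * (2 * pi / (1 - q)))"
    proof -
      have "x \<le> 2 * x" if "0 \<le> x" for x :: real using that by simp
      moreover have "0 \<le> v * (2 * pi / (1 - q))" using v q by simp
      ultimately show ?thesis by blast
    qed
    finally show ?thesis using L1 by (simp add: sigma_exp_def mult_ac)
  qed
qed

end

section \<open>Sequences with asymptotically constant ratio\<close>

text \<open>Split \<open>x (Suc j) - q ^ Suc j\<close> into the one-step error
  \<open>x (Suc j) - q * x j\<close> and \<open>q\<close> times the previous deviation. The one-step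
  error is at most \<open>e\<close> times \<open>x j\<close>, itself bounded by
  \<open>(q + e) ^ j\<close>; after \<open>Suc j\<close> steps that many errors have
  accumulated.\<close>

lemma geometric_deviation:
  fixes x :: "nat \<Rightarrow> real"
  assumes "x 0 = 1" "\<And>j. x j > 0" "\<And>j. \<bar>x (Suc j) / x j - q\<bar> \<le> e" "0 < q" "0 \<le> e"
  shows "\<bar>x (Suc j) - q ^ Suc j\<bar> \<le> real (Suc j) * e * (q + e) ^ j"
proof -
  have step: "\<bar>x (Suc j) - q * x j\<bar> \<le> e * x j" for j
  proof -
    have "x (Suc j) - q * x j = (x (Suc j) / x j - q) * x j"
      using assms(2)[of j] by (simp add: field_simps)
    then show ?thesis using assms(2)[of j] assms(3)[of j] by (simp add: abs_mult)
  qed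
  have xle: "x j \<le> (q + e) ^ j" for j
  proof (induction j)
    case (Suc j)
    have "x (Suc j) \<le> (q + e) * x j" using step[of j] by (simp add: algebra_simps abs_le_iff)
    also have "\<dots> \<le> (q + e) * (q + e) ^ j" using Suc assms by (intro mult_left_mono) simp_all
    finally show ?case by simp
  qed (simp add: assms(1))
  show ?thesis
  proof (induction j)
    case 0
    then show ?case using step[of 0] assms(1) by simp
  next
    case (Suc j)
    have "\<bar>x (Suc (Suc j)) - q ^ Suc (Suc j)\<bar> \<le> \<bar>x (Suc (Suc j)) - q * x (Suc j)\<bar> + \<bar>q * (x (Suc j) - q ^ Suc j)\<bar>"
      by (simp add: algebra_simps)
    also have "\<dots> \<le> e * (q + e) ^ Suc j + (q + e) * (real (Suc j) * e * (q + e) ^ j)"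
    proof (rule add_mono)
      show "\<bar>x (Suc (Suc j)) - q * x (Suc j)\<bar> \<le> e * (q + e) ^ Suc j"
        using step[of "Suc j"] mult_left_mono[OF xle[of "Suc j"] assms(5)] by linarith
      show "\<bar>q * (x (Suc j) - q ^ Suc j)\<bar> \<le> (q + e) * (real (Suc j) * e * (q + e) ^ j)"
        unfolding abs_mult using Suc assms by (intro mult_mono) simp_all
    qed
    also have "\<dots> = real (Suc (Suc j)) * e * (q + e) ^ Suc j" by (simp add: algebra_simps)
    finally show ?case .
  qed
qed

lemma sum_Suc_power_le:
  fixes x :: real
  assumes "0 \<le> x" "x < 1"
  shows "(\<Sum>j<N. real (Suc j) * x ^ j) \<le> 1 / (1 - x)\<^sup>2"
proof -
  have s: "(\<lambda>j. real (Suc j) * x ^ j) sums (1 / (1 - x)\<^sup>2)"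
    using geometric_deriv_sums[of x] assms by simp
  show ?thesis
    using sum_le_suminf[OF sums_summable[OF s], of "{..<N}"] sums_unique[OF s] assms by simp
qed

text \<open>Multiplication by \<open>1 - x\<close> lowers the degree of the polynomial weights by
  one, up to a nonpositive boundary term, and so reduces the bound to the preceding sum.\<close>

lemma sum_Suc_Suc_power_le:
  fixes x :: real
  assumes "0 \<le> x" "x < 1"
  shows "(\<Sum>j<N. real (j + 2) * real (Suc j) * x ^ j) \<le> 2 / (1 - x) ^ 3"
proof -
  have "(1 - x) * (\<Sum>j<N. real (j + 2) * real (Suc j) * x ^ j) =
      2 * (\<Sum>j<N. real (Suc j) * x ^ j) - real N * real (Suc N) * x ^ N"
    by (induction N) (simp_all add: algebra_simps)
  also have "\<dots> \<le> 2 * (\<Sum>j<N. real (Suc j) * x ^ j)" using assms by simp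
  also have "\<dots> \<le> 2 * (1 / (1 - x)\<^sup>2)" using mult_left_mono[OF sum_Suc_power_le[OF assms], of 2] by simp
  finally have "(\<Sum>j<N. real (j + 2) * real (Suc j) * x ^ j) \<le> 2 * (1 / (1 - x)\<^sup>2) / (1 - x)"
    using assms by (subst pos_le_divide_eq) (simp_all only: mult.commute diff_gt_0_iff_gt)
  then show ?thesis by (simp add: power2_eq_square power3_eq_cube mult.assoc)
qed

text \<open>The weight \<open>min p (j + 2)\<close> is bounded once by \<open>p\<close> and once by
  \<open>j + 2\<close>; the two sums give the two arguments of the minimum. As
  \<open>e \<le> (1 - q) / 2\<close>, replacing \<open>1 - (q + e)\<close> by \<open>1 - q\<close>
  costs 2^2 in the first sum and 2^3 in the second, and 16 = 2 * 2^3 covers both.\<close>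

lemma vp_coefficients_close:
  fixes x :: "nat \<Rightarrow> real" and p :: nat
  assumes x: "x 0 = 1" "\<And>j. x j > 0" "\<And>j. \<bar>x (Suc j) / x j - q\<bar> \<le> e"
    and q: "0 < q" "q < 1" and e: "0 \<le> e" "e \<le> (1 - q) / 2"
  defines "D \<equiv> (\<lambda>j. \<bar>real (min p (j + 1)) * x j - real (min p (j + 1)) * q ^ j\<bar>)"
  shows "summable D" "(\<Sum>j. D j) \<le> 16 * (e / (1 - q)\<^sup>2 * min (real p) (1 / (1 - q)))"
proof -
  define r where "r = q + e"
  have r: "0 \<le> r" "r < 1" "(1 - q) / 2 \<le> 1 - r" using q e by (auto simp: r_def field_simps)
  define B where "B = 16 * (e / (1 - q)\<^sup>2 * min (real p) (1 / (1 - q)))"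
  \<comment> \<open>The leading coefficients agree exactly, so summation starts at
    \<open>Suc j\<close>, where a factor \<open>e\<close> is available.\<close>
  have D0: "D 0 = 0" by (simp add: D_def x(1))
  have DS: "D (Suc j) \<le> real (min p (j + 2)) * (real (Suc j) * e * r ^ j)" for j
  proof -
    have "D (Suc j) = real (min p (j + 2)) * \<bar>x (Suc j) - q ^ Suc j\<bar>"
      unfolding D_def right_diff_distrib[symmetric] abs_mult by simp
    also have "\<dots> \<le> real (min p (j + 2)) * (real (Suc j) * e * r ^ j)"
      using geometric_deviation[OF x q(1) e(1)] by (intro mult_left_mono) (simp_all add: r_def)
    finally show ?thesis .
  qed
  have le1: "D (Suc j) \<le> real p * e * (real (Suc j) * r ^ j)" for j
  proof -
    have "real (min p (j + 2)) * (real (Suc j) * e * r ^ j) \<le> real p * (real (Suc j) * e * r ^ j)"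
      using r e by (intro mult_right_mono) simp_all
    then show ?thesis using DS[of j] by (simp add: mult_ac)
  qed
  have le2: "D (Suc j) \<le> e * (real (j + 2) * real (Suc j) * r ^ j)" for j
  proof -
    have "real (min p (j + 2)) * (real (Suc j) * e * r ^ j) \<le> real (j + 2) * (real (Suc j) * e * r ^ j)"
      using r e by (intro mult_right_mono) simp_all
    then show ?thesis using DS[of j] by (simp add: mult_ac)
  qed
  have inv: "1 / (1 - r) ^ k \<le> 2 ^ k / (1 - q) ^ k" for k
  proof -
    have "1 / (1 - r) ^ k \<le> 1 / ((1 - q) / 2) ^ k"
      using r q by (intro divide_left_mono power_mono mult_pos_pos zero_less_power) simp_all
    then show ?thesis by (simp add: power_divide)
  qed
  have part: "(\<Sum>j<N. D j) \<le> B" for N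
  proof (cases N)
    case 0
    then show ?thesis using e q by (simp add: B_def)
  next
    case (Suc N')
    have eq: "(\<Sum>j<N. D j) = (\<Sum>j<N'. D (Suc j))"
      unfolding Suc sum.lessThan_Suc_shift D0 by simp
    have "(\<Sum>j<N'. D (Suc j)) \<le> (\<Sum>j<N'. real p * e * (real (Suc j) * r ^ j))"
      by (rule sum_mono[OF le1])
    also have "\<dots> = real p * e * (\<Sum>j<N'. real (Suc j) * r ^ j)" by (simp only: sum_distrib_left)
    also have "\<dots> \<le> real p * e * (1 / (1 - r) ^ 2)"
      using e sum_Suc_power_le[OF r(1,2)] by (intro mult_left_mono) simp_all
    also have "\<dots> \<le> real p * e * (2 ^ 2 / (1 - q) ^ 2)"
      using e by (intro mult_left_mono inv) simp_all
    also have "\<dots> \<le> 16 * (e / (1 - q)\<^sup>2 * real p)"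
      using e by (simp add: mult_ac divide_right_mono)
    finally have b1: "(\<Sum>j<N. D j) \<le> 16 * (e / (1 - q)\<^sup>2 * real p)" using eq by simp
    have "(\<Sum>j<N'. D (Suc j)) \<le> (\<Sum>j<N'. e * (real (j + 2) * real (Suc j) * r ^ j))"
      by (rule sum_mono[OF le2])
    also have "\<dots> = e * (\<Sum>j<N'. real (j + 2) * real (Suc j) * r ^ j)" by (simp only: sum_distrib_left)
    also have "\<dots> \<le> e * (2 / (1 - r) ^ 3)"
      using e sum_Suc_Suc_power_le[OF r(1,2)] by (intro mult_left_mono) simp_all
    also have "\<dots> = 2 * e * (1 / (1 - r) ^ 3)" by simp
    also have "\<dots> \<le> 2 * e * (2 ^ 3 / (1 - q) ^ 3)"
      using e by (intro mult_left_mono inv) simp_all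
    also have "\<dots> = 16 * (e / (1 - q)\<^sup>2 * (1 / (1 - q)))"
      by (simp add: power2_eq_square power3_eq_cube)
    finally have b2: "(\<Sum>j<N. D j) \<le> 16 * (e / (1 - q)\<^sup>2 * (1 / (1 - q)))" using eq by simp
    show ?thesis
      using b1 b2 unfolding B_def by (cases "real p \<le> 1 / (1 - q)") (simp_all only: min_def if_True if_False)
  qed
  have "D j \<ge> 0" for j by (simp add: D_def)
  then show "summable D" by (rule summableI_nonneg_bounded[OF _ part])
  then show "(\<Sum>j. D j) \<le> 16 * (e / (1 - q)\<^sup>2 * min (real p) (1 / (1 - q)))"
    using part unfolding B_def by (rule suminf_le_const)
qed

section \<open>Two-sided bounds for the supremum over the class\<close>

lemma approx_error_estimate:
  assumes q: "0 < q" "q < 1" and psi: "summable \<psi>" "\<And>k. k \<ge> 1 \<Longrightarrow> \<psi> k > 0"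
    and np: "1 \<le> p" "p \<le> n" and s: "1 \<le> s"
  defines "m \<equiv> n - p + 1"
  assumes e: "0 \<le> e" "e \<le> (1 - q) / 2" and dev: "\<And>k. k \<ge> m \<Longrightarrow> \<bar>\<psi> (k + 1) / \<psi> k - q\<bar> \<le> e"
  defines "r \<equiv> conj_exponent s"
  shows "\<exists>E. approx_error (C_psi_beta_s \<psi> \<beta> s) n p = ereal (\<psi> m / real p * E) \<and>
    \<bar>E - L_norm r cos / pi powr (1 + recip_exponent r) * K_const q p r\<bar>
      \<le> (12 * pi + 32) * (1 / (real m * (1 - q) ^ sigma_exp r p) + e / (1 - q)\<^sup>2 * min (real p) (1 / (1 - q)))"
proof -
  define \<gamma> where "\<gamma> = \<beta> * pi / 2"
  have r: "1 \<le> r" unfolding r_def by (rule conj_exponent_ge_1[OF s])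
  have m: "m \<ge> 1" by (simp add: m_def)
  have pm: "\<psi> m > 0" by (rule psi(2)[OF m])
  define R1 where "R1 = 1 / (real m * (1 - q) ^ sigma_exp r p)"
  define R2 where "R2 = e / (1 - q)\<^sup>2 * min (real p) (1 / (1 - q))"
  define c where "c = (\<lambda>j. real (min p (j + 1)) * q ^ j)"
  define d where "d = (\<lambda>j. real (min p (j + 1)) * (\<psi> (m + j) / \<psi> m))"
  have cd: "summable (\<lambda>j. \<bar>d j - c j\<bar>)" "(\<Sum>j. \<bar>d j - c j\<bar>) \<le> 16 * R2"
  proof -
    have d1: "\<bar>\<psi> (m + Suc j) / \<psi> m / (\<psi> (m + j) / \<psi> m) - q\<bar> \<le> e" for j
      using dev[of "m + j"] pm by simp
    have d2: "0 < \<psi> (m + j) / \<psi> m" for j using psi(2)[of "m + j"] pm m by simp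
    have d3: "\<psi> (m + 0) / \<psi> m = 1" using pm by simp
    note close = vp_coefficients_close[of "\<lambda>j. \<psi> (m + j) / \<psi> m" q e p, OF d3 d2 d1 q e]
    show "summable (\<lambda>j. \<bar>d j - c j\<bar>)" "(\<Sum>j. \<bar>d j - c j\<bar>) \<le> 16 * R2"
      unfolding d_def c_def R2_def by (rule close)+
  qed
  have sc: "summable (\<lambda>j. \<bar>c j\<bar>)"
  proof (rule summable_comparison_test')
    show "summable (\<lambda>j. real p * q ^ j)" using q by (intro summable_mult summable_geometric) simp
    show "norm \<bar>c j\<bar> \<le> real p * q ^ j" for j
      using q by (simp add: c_def abs_mult mult_right_mono)
  qed
  have sd: "summable (\<lambda>j. \<bar>d j\<bar>)"
    by (rule summable_comparison_test'[OF summable_add[OF cd(1) sc]]) simp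
  define h where "h = phase_kernel c m \<gamma>"
  define k where "k = phase_kernel d m \<gamma>"
  note hC = phase_kernel_C_space[OF sc, of m \<gamma>, folded h_def]
  note kC = phase_kernel_C_space[OF sd, of m \<gamma>, folded k_def]
  have kh: "\<bar>k t - h t\<bar> \<le> 16 * R2" for t
  proof -
    have sum: "summable (\<lambda>j. a j * cos (real (m + j) * t + \<gamma>))" if "summable (\<lambda>j. \<bar>a j\<bar>)" for a :: "nat \<Rightarrow> real"
      by (rule summable_comparison_test'[OF that]) (simp add: abs_mult mult_left_le)
    have "k t - h t = (\<Sum>j. (d j - c j) * cos (real (m + j) * t + \<gamma>))"
      unfolding k_def h_def phase_kernel_def suminf_diff[OF sum[OF sd] sum[OF sc]] by (simp only: left_diff_distrib)
    also have "\<bar>\<dots>\<bar> \<le> (\<Sum>j. \<bar>d j - c j\<bar>)"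
    proof -
      have sn: "summable (\<lambda>j. \<bar>(d j - c j) * cos (real (m + j) * t + \<gamma>)\<bar>)"
        by (rule summable_comparison_test'[OF cd(1)]) (simp add: abs_mult mult_left_le)
      have "\<bar>\<Sum>j. (d j - c j) * cos (real (m + j) * t + \<gamma>)\<bar> \<le> (\<Sum>j. \<bar>(d j - c j) * cos (real (m + j) * t + \<gamma>)\<bar>)"
        by (rule summable_rabs[OF sn])
      also have "\<dots> \<le> (\<Sum>j. \<bar>d j - c j\<bar>)"
        by (rule suminf_le[OF _ sn cd(1)]) (simp add: abs_mult mult_left_le)
      finally show ?thesis .
    qed
    finally show ?thesis using cd(2) by simp
  qed
  define G where "G = (\<lambda>t. cis \<gamma> * vp_amplitude q p t)"
  have Gc: "continuous_on UNIV G" unfolding G_def by (intro continuous_intros vp_amplitude_continuous[OF q])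
  have Gp: "G (t + 2 * pi) = G t" for t by (simp add: G_def vp_amplitude_periodic[OF q])
  have hG: "h t = Re (cis (real m * t) * G t)" for t
  proof -
    have "(\<lambda>j. Re (cis (real m * t + \<gamma>) * (of_real (c j) * cis (real j * t)))) sums Re (cis (real m * t + \<gamma>) * vp_amplitude q p t)"
      unfolding c_def by (intro sums_Re sums_mult vp_amplitude_sums[OF q])
    moreover have "Re (cis (real m * t + \<gamma>) * (of_real (c j) * cis (real j * t))) = c j * cos (real (m + j) * t + \<gamma>)" for j
    proof -
      have "cis (real m * t + \<gamma>) * (of_real (c j) * cis (real j * t)) = of_real (c j) * cis (real (m + j) * t + \<gamma>)"
      proof -
        have "real m * t + \<gamma> + real j * t = real (m + j) * t + \<gamma>" by (simp add: algebra_simps)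
        then show ?thesis by (simp only: mult.left_commute cis_mult)
      qed
      then show ?thesis by (simp only:) simp
    qed
    moreover have "cis (real m * t + \<gamma>) * vp_amplitude q p t = cis (real m * t) * G t"
      by (simp add: G_def cis_mult flip: mult.assoc)
    ultimately show ?thesis
      unfolding h_def phase_kernel_def by (simp only:) (rule sums_unique[symmetric])
  qed
  \<comment> \<open>The modulus bound \<open>4 * pi * v / (1 - q) ^ sigma_exp r p\<close> at the
    largest distance \<open>v = 2 * pi / m\<close>.\<close>
  define D where "D = 8 * pi\<^sup>2 * R1"
  have mod: "L_norm r (\<lambda>t. cmod (G (t + v) - G t)) \<le> D" if v: "0 \<le> v" "v \<le> 2 * pi / real m" for v
  proof -
    have "cmod (G (t + v) - G t) = cmod (vp_amplitude q p (t + v) - vp_amplitude q p t)" for t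
      by (simp add: G_def norm_mult flip: right_diff_distrib)
    then have "L_norm r (\<lambda>t. cmod (G (t + v) - G t)) \<le> 4 * pi * v / (1 - q) ^ sigma_exp r p"
      using vp_amplitude_modulus[OF q r v(1), of p] by simp
    also have "\<dots> \<le> 4 * pi * (2 * pi / real m) / (1 - q) ^ sigma_exp r p"
      using v q by (intro divide_right_mono mult_left_mono) simp_all
    also have "\<dots> = D" by (simp add: D_def R1_def power2_eq_square)
    finally show ?thesis .
  qed
  define M where "M = L_norm r cos / (2 * pi) powr recip_exponent r * L_norm r (\<lambda>t. cmod (G t))"
  have hM: "\<bar>L_norm r h - M\<bar> \<le> D"
    using L_norm_oscillating[OF r Gc Gp m mod] unfolding M_def hG[abs_def] by simp
  \<comment> \<open>The constants match because \<open>pi\<close> times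
    \<open>(2 * pi) powr recip_exponent r\<close> splits into
    \<open>pi powr (1 + recip_exponent r)\<close> and the power of 2 contained in
    \<open>K_const\<close>.\<close>
  have Mmain: "M / pi = L_norm r cos / pi powr (1 + recip_exponent r) * K_const q p r"
  proof -
    have "cmod (G t) = sqrt (1 - 2 * q ^ p * cos (real p * t) + q ^ (2 * p)) / (1 - 2 * q * cos t + q\<^sup>2)" for t
      by (simp add: G_def norm_mult cmod_vp_amplitude[OF q])
    moreover have "pi powr (1 + recip_exponent r) = pi * pi powr recip_exponent r"
      by (simp add: powr_add)
    ultimately show ?thesis
      by (simp add: M_def K_const_def powr_mult powr_minus field_simps)
  qed
  \<comment> \<open>Half a period of the leading oscillation:
    \<open>cis (real m * (t - v)) = - cis (real m * t)\<close>, so \<open>h t + h (t - v)\<close>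
    retains only an increment of \<open>G\<close>.\<close>
  define v where "v = pi / real m"
  have v: "0 \<le> v" "v \<le> 2 * pi / real m" by (simp_all add: v_def divide_right_mono)
  have half: "L_norm r (\<lambda>t. (h t + h (t - v)) / 2) \<le> D / 2"
  proof -
    define g where "g = (\<lambda>t. cmod (G (t + v) - G t))"
    have gC: "g \<in> C_space"
    proof -
      have "g = (\<lambda>t. cmod (vp_amplitude q p (t + v) - vp_amplitude q p t))"
        unfolding g_def G_def by (simp add: norm_mult flip: right_diff_distrib)
      then show ?thesis using vp_amplitude_diff_C_space[OF q, of p v] by simp
    qed
    have g: "bounded_periodic (\<lambda>t. g (t - v))" using bper_shift[OF C_space_bper[OF gC], of "- v"] by simp
    have hv: "bounded_periodic (\<lambda>t. h (t - v))" using bper_shift[OF C_space_bper[OF hC], of "- v"] by simp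
    have hb: "bounded_periodic (\<lambda>t. (1 / 2) * (h t + h (t - v)))"
      by (intro bper_cmult bper_add hv C_space_bper hC)
    have "\<bar>(1 / 2) * (h t + h (t - v))\<bar> \<le> \<bar>(1 / 2) * g (t - v)\<bar>" for t
    proof -
      have "cis (real m * (t - v)) = - cis (real m * t)"
      proof -
        have "real m * (t - v) = real m * t - pi" using m by (simp add: v_def field_simps)
        then show ?thesis by (simp add: complex_eq_iff cos_diff sin_diff)
      qed
      then have "h t + h (t - v) = Re (cis (real m * t) * (G (t - v + v) - G (t - v)))"
        unfolding hG by (simp add: algebra_simps)
      then have "\<bar>h t + h (t - v)\<bar> \<le> g (t - v)"
        using abs_Re_le_cmod[of "cis (real m * t) * (G (t - v + v) - G (t - v))"] unfolding g_def norm_mult by simp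
      then show ?thesis by simp
    qed
    then have "L_norm r (\<lambda>t. (1 / 2) * (h t + h (t - v))) \<le> L_norm r (\<lambda>t. (1 / 2) * g (t - v))"
      by (intro L_norm_mono hb bper_cmult g r)
    also have "\<dots> = (1 / 2) * L_norm r g"
      using L_norm_cmult[OF g r, of "1 / 2"] L_norm_shift[OF C_space_bper[OF gC] r, of "- v"] by simp
    also have "\<dots> \<le> D / 2" using mod[OF v] by (simp add: g_def)
    finally show ?thesis by simp
  qed
  define a where "a = \<psi> m / (pi * real p)"
  have a: "a > 0" using pm np by (simp add: a_def)
  \<comment> \<open>\<open>32 * pi\<close> is the pointwise error \<open>16 * R2\<close> of the
    kernel times the factor \<open>2 * pi\<close> for passing from the supremum to the norm with
    exponent \<open>r\<close>.\<close>
  define U where "U = L_norm r h + 32 * pi * R2"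
  have diff: "\<bar>(\<integral>t. \<phi> t * k (t - x) \<partial>period_measure) - (\<integral>t. \<phi> t * h (t - x) \<partial>period_measure)\<bar> \<le> 32 * pi * R2"
    if "\<phi> \<in> U0 s" for \<phi> x
  proof -
    have \<phi>: "\<phi> \<in> L_space s" "L_norm s \<phi> \<le> 1" using that by (auto simp: U0_def)
    have b: "bounded_periodic (\<lambda>t. k (t - x))" "bounded_periodic (\<lambda>t. h (t - x))"
      using bper_shift[OF C_space_bper[OF kC], of "- x"] bper_shift[OF C_space_bper[OF hC], of "- x"] by simp_all
    note i = integrable_mult_bper[OF L_space_integrable[OF s \<phi>(1)] b(1)]
      integrable_mult_bper[OF L_space_integrable[OF s \<phi>(1)] b(2)]
    have "(\<integral>t. \<phi> t * k (t - x) \<partial>period_measure) - (\<integral>t. \<phi> t * h (t - x) \<partial>period_measure)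
        = (\<integral>t. \<phi> t * (k (t - x) - h (t - x)) \<partial>period_measure)"
      using i by (simp add: right_diff_distrib)
    also have "\<bar>\<dots>\<bar> \<le> L_norm r (\<lambda>t. k (t - x) - h (t - x))"
      unfolding r_def by (rule Holder_inequality_period[OF s \<phi> bper_diff[OF b]])
    also have "\<dots> \<le> 2 * pi * (16 * R2)" by (rule L_norm_const_le[OF bper_diff[OF b] r kh])
    finally show ?thesis by simp
  qed
  \<comment> \<open>Translating the kernel by \<open>x\<close> does not change its norm, so the
    bound is uniform in \<open>x\<close>.\<close>
  have upper: "\<bar>f x - vallee_poussin n p f x\<bar> \<le> a * U" if f: "f \<in> C_psi_beta_s \<psi> \<beta> s" for f x
  proof -
    obtain \<phi> where f': "f \<in> C_space" and \<phi>: "\<phi> \<in> U0 s" "is_psi_beta_deriv \<psi> \<beta> f \<phi>"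
      using f by (auto simp: C_psi_beta_s_def C_class_def L_class_def)
    have b: "bounded_periodic (\<lambda>t. h (t - x))" using bper_shift[OF C_space_bper[OF hC], of "- x"] by simp
    have "f x - vallee_poussin n p f x = a * (\<integral>t. \<phi> t * k (t - x) \<partial>period_measure)"
      using vallee_poussin_remainder[OF psi np f' \<phi>(2)]
      unfolding a_def k_def d_def m_def[symmetric] \<gamma>_def[symmetric] by simp
    moreover have "\<bar>\<integral>t. \<phi> t * h (t - x) \<partial>period_measure\<bar> \<le> L_norm r (\<lambda>t. h (t - x))"
      unfolding r_def using \<phi>(1) by (intro Holder_inequality_period[OF s _ _ b]) (auto simp: U0_def)
    moreover have "L_norm r (\<lambda>t. h (t - x)) = L_norm r h"
      using L_norm_shift[OF C_space_bper[OF hC] r, of "- x"] by simp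
    ultimately have "\<bar>\<integral>t. \<phi> t * k (t - x) \<partial>period_measure\<bar> \<le> U"
      using diff[OF \<phi>(1), of x] unfolding U_def by linarith
    then show ?thesis
      using a \<open>f x - vallee_poussin n p f x = _\<close> by (simp add: abs_mult)
  qed
  define L where "L = L_norm r h - D / 2 - 32 * pi * R2"
  have lower: "\<exists>f\<in>C_psi_beta_s \<psi> \<beta> s. a * (L - \<delta>) \<le> C_norm (\<lambda>x. f x - vallee_poussin n p f x)"
    if \<delta>: "\<delta> > 0" for \<delta>
  proof -
    obtain \<phi> where \<phi>: "bounded_periodic \<phi>" "\<phi> \<in> U0 s"
      "L_norm r h - L_norm r (\<lambda>t. (h t + h (t - v)) / 2) - \<delta> \<le> (\<integral>t. \<phi> t * h t \<partial>period_measure)"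
      using mean_zero_nearly_extremal[OF s C_space_bper[OF hC] \<delta>, of v] unfolding r_def by metis
    obtain f where f: "f \<in> C_psi_beta_s \<psi> \<beta> s" "f \<in> C_space" "is_psi_beta_deriv \<psi> \<beta> f \<phi>"
      using exists_psi_beta_integral[OF psi s \<phi>(2,1)] by metis
    \<comment> \<open>One point suffices for a lower bound on the supremum norm; at
      \<open>x = 0\<close> the kernel appears untranslated.\<close>
    have "L - \<delta> \<le> (\<integral>t. \<phi> t * k (t - 0) \<partial>period_measure)"
      using \<phi>(3) half diff[OF \<phi>(2), of 0] unfolding L_def by simp
    then have "a * (L - \<delta>) \<le> a * (\<integral>t. \<phi> t * k (t - 0) \<partial>period_measure)"
      using a by (intro mult_left_mono) simp_all
    also have "\<dots> = f 0 - vallee_poussin n p f 0"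
      using vallee_poussin_remainder[OF psi np f(2,3), of 0]
      unfolding a_def k_def d_def m_def[symmetric] \<gamma>_def[symmetric] by simp
    also have "\<dots> \<le> \<bar>f 0 - vallee_poussin n p f 0\<bar>" by simp
    \<comment> \<open>\<open>C_norm\<close> is a supremum in the reals, so the remainder has to be
      bounded; \<open>upper\<close> supplies this.\<close>
    also have "\<dots> \<le> C_norm (\<lambda>x. f x - vallee_poussin n p f x)"
      unfolding C_norm_def using upper[OF f(1)] by (intro cSUP_upper bdd_aboveI2) auto
    finally show ?thesis using f(1) by blast
  qed
  have up: "approx_error (C_psi_beta_s \<psi> \<beta> s) n p \<le> ereal (a * U)"
    unfolding approx_error_def C_norm_def using upper by (intro SUP_least) (simp add: cSUP_least)
  have lo: "ereal (a * (L - \<delta>)) \<le> approx_error (C_psi_beta_s \<psi> \<beta> s) n p" if "\<delta> > 0" for \<delta>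
    using lower[OF that] unfolding approx_error_def by (meson SUP_upper2 ereal_less_eq(3))
  \<comment> \<open>\<open>up\<close> excludes \<infinity> and \<open>lo\<close> at 1 excludes
    \<open>-\<infinity>\<close>, so the extended supremum is a real number.\<close>
  obtain E where E: "approx_error (C_psi_beta_s \<psi> \<beta> s) n p = ereal E"
    using up lo[of 1] by (cases "approx_error (C_psi_beta_s \<psi> \<beta> s) n p") auto
  have EU: "E / a \<le> U" using up a unfolding E by (simp add: field_simps)
  have EL: "L \<le> E / a"
  proof (rule field_le_epsilon)
    fix \<delta> :: real assume "\<delta> > 0"
    then have "a * (L - \<delta>) \<le> E" using lo[of \<delta>] unfolding E by simp
    then show "L \<le> E / a + \<delta>" using a by (simp add: field_simps)
  qed
  have R: "0 \<le> R1" "0 \<le> R2" using q e by (simp_all add: R1_def R2_def)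
  have "0 \<le> D" using R by (simp add: D_def)
  \<comment> \<open>\<open>E / a\<close> lies between \<open>L\<close> and \<open>U\<close>. The
    distance of the norm of \<open>h\<close> from \<open>M\<close> contributes \<open>D\<close>, and
    the mean-zero correction in \<open>L\<close> a further \<open>D / 2\<close>.\<close>
  then have "\<bar>E / a - M\<bar> \<le> (3 / 2) * D + 32 * pi * R2"
    using EU EL hM mult_nonneg_nonneg[OF pi_ge_zero R(2)] unfolding U_def L_def abs_le_iff by linarith
  then have "\<bar>E / a - M\<bar> / pi \<le> ((3 / 2) * D + 32 * pi * R2) / pi"
    by (intro divide_right_mono) simp_all
  also have "\<dots> = 12 * pi * R1 + 32 * R2"
    by (simp add: D_def power2_eq_square add_divide_distrib)
  also have "\<dots> \<le> (12 * pi + 32) * (R1 + R2)"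
    using R by (simp add: algebra_simps)
  finally have "\<bar>E / a / pi - M / pi\<bar> \<le> (12 * pi + 32) * (R1 + R2)"
    unfolding diff_divide_distrib[symmetric] abs_divide by simp
  moreover have "\<psi> m / real p * (E / a / pi) = E" using pm np by (simp add: a_def)
  ultimately show ?thesis
    unfolding E Mmain R1_def R2_def by (intro exI[of _ "E / a / pi"]) simp
qed

section \<open>Reduction of the asymptotics to the estimate for fixed \<open>n\<close> and
  \<open>p\<close>\<close>

theorem theorem2:
  "\<exists>K::real. \<forall>(q::real) (\<psi>::nat \<Rightarrow> real).
     0 < q \<longrightarrow> q < 1 \<longrightarrow> \<psi> \<in> D_set q \<longrightarrow>
     (\<exists>N::nat. \<forall>(n::nat) (p::nat) (s::ereal) (\<beta>::real).
        1 \<le> p \<longrightarrow> p \<le> n \<longrightarrow> N \<le> n - p \<longrightarrow> 1 \<le> s \<longrightarrow>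
        (\<exists>\<theta>::real. \<bar>\<theta>\<bar> \<le> K \<and>
           approx_error (C_psi_beta_s \<psi> \<beta> s) n p =
           ereal (\<psi> (n - p + 1) / real p *
             (L_norm (conj_exponent s) cos / pi powr (1 + recip_exponent (conj_exponent s)) *
                K_const q p (conj_exponent s) +
              \<theta> * (1 / (real (n - p + 1) * (1 - q) ^ sigma_exp (conj_exponent s) p) +
                   ratio_dev \<psi> q (n - p + 1) / (1 - q)\<^sup>2 * min (real p) (1 / (1 - q)))))))"
proof (rule exI[of _ "12 * pi + 32"], intro allI impI)
  fix q :: real and \<psi> :: "nat \<Rightarrow> real"
  assume q: "0 < q" "q < 1" and \<psi>: "\<psi> \<in> D_set q"
  have pos: "\<psi> k > 0" if "k \<ge> 1" for k using \<psi> that by (simp add: D_set_def)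
  have lim: "(\<lambda>k. \<psi> (k + 1) / \<psi> k) \<longlonglongrightarrow> q" using \<psi> by (simp add: D_set_def)
  \<comment> \<open>This \<open>N\<close> depends on \<psi> and \<open>q\<close> alone. Half of the
    gap \<open>1 - q\<close> serves two ends: it meets the smallness condition on
    \<open>ratio_dev\<close>, and it keeps the ratios below \<open>(1 + q) / 2\<close>, which makes
    \<psi> summable.\<close>
  obtain N where N: "\<And>k. k \<ge> N \<Longrightarrow> \<bar>\<psi> (k + 1) / \<psi> k - q\<bar> < (1 - q) / 2"
    using LIMSEQ_D[OF lim, of "(1 - q) / 2"] q by auto
  have summ: "summable \<psi>"
  proof (rule summable_ratio_test)
    show "(1 + q) / 2 < 1" using q by simp
    fix k assume k: "max N 1 \<le> k"
    then have p: "\<psi> k > 0" "\<psi> (Suc k) > 0" using pos by auto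
    have "N \<le> k" using k by simp
    moreover have "x \<le> (1 + q) / 2" if "\<bar>x - q\<bar> < (1 - q) / 2" for x
      using that by argo
    ultimately have "\<psi> (Suc k) / \<psi> k \<le> (1 + q) / 2"
      using N[of k] unfolding Suc_eq_plus1 by blast
    then show "norm (\<psi> (Suc k)) \<le> (1 + q) / 2 * norm (\<psi> k)" using p by (simp add: pos_divide_le_eq)
  qed
  show "\<exists>N::nat. \<forall>(n::nat) (p::nat) (s::ereal) (\<beta>::real).
        1 \<le> p \<longrightarrow> p \<le> n \<longrightarrow> N \<le> n - p \<longrightarrow> 1 \<le> s \<longrightarrow>
        (\<exists>\<theta>::real. \<bar>\<theta>\<bar> \<le> 12 * pi + 32 \<and>
           approx_error (C_psi_beta_s \<psi> \<beta> s) n p =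
           ereal (\<psi> (n - p + 1) / real p *
             (L_norm (conj_exponent s) cos / pi powr (1 + recip_exponent (conj_exponent s)) *
                K_const q p (conj_exponent s) +
              \<theta> * (1 / (real (n - p + 1) * (1 - q) ^ sigma_exp (conj_exponent s) p) +
                   ratio_dev \<psi> q (n - p + 1) / (1 - q)\<^sup>2 * min (real p) (1 / (1 - q))))))"
  proof (rule exI[of _ N], intro allI impI)
    fix n p :: nat and s :: ereal and \<beta> :: real
    assume np: "1 \<le> p" "p \<le> n" and Nn: "N \<le> n - p" and s: "1 \<le> s"
    define m where "m = n - p + 1"
    define e where "e = ratio_dev \<psi> q m"
    have small: "\<bar>\<psi> (k + 1) / \<psi> k - q\<bar> \<le> (1 - q) / 2" if "k \<ge> m" for k
      using N[of k] that Nn by (simp add: m_def)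
    \<comment> \<open>The supremum in \<open>ratio_dev\<close> is taken in the reals;
      \<open>small\<close> guarantees that it is over a bounded set.\<close>
    have dev: "\<bar>\<psi> (k + 1) / \<psi> k - q\<bar> \<le> e" if "k \<ge> m" for k
      unfolding e_def ratio_dev_def
      by (rule cSUP_upper[OF _ bdd_aboveI2[of _ _ "(1 - q) / 2"]]) (use that small in simp_all)
    have e: "0 \<le> e" "e \<le> (1 - q) / 2"
    proof -
      show "0 \<le> e" using dev[of m] by linarith
      show "e \<le> (1 - q) / 2"
        unfolding e_def ratio_dev_def by (rule cSUP_least) (use small in simp_all)
    qed
    define r where "r = conj_exponent s"
    define R where "R = 1 / (real m * (1 - q) ^ sigma_exp r p) + e / (1 - q)\<^sup>2 * min (real p) (1 / (1 - q))"
    define A where "A = L_norm r cos / pi powr (1 + recip_exponent r) * K_const q p r"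
    obtain E where E: "approx_error (C_psi_beta_s \<psi> \<beta> s) n p = ereal (\<psi> m / real p * E)"
      "\<bar>E - A\<bar> \<le> (12 * pi + 32) * R"
      using approx_error_estimate[OF q summ pos np s e dev[unfolded m_def]]
      unfolding m_def[symmetric] r_def[symmetric] A_def[symmetric] R_def[symmetric] by blast
    \<comment> \<open>The first error term is strictly positive, so one may divide by
      \<open>R\<close> even when \<open>e\<close> vanishes, and \<theta> can be taken as
      \<open>(E - A) / R\<close>.\<close>
    have "0 < 1 / (real m * (1 - q) ^ sigma_exp r p)" using q by (simp add: m_def)
    moreover have "0 \<le> e / (1 - q)\<^sup>2 * min (real p) (1 / (1 - q))" using q e by simp
    ultimately have R: "R > 0" unfolding R_def by linarith
    have "\<bar>(E - A) / R\<bar> \<le> 12 * pi + 32"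
      using E(2) R by (simp add: abs_divide pos_divide_le_eq)
    moreover have "E = A + (E - A) / R * R" using R by simp
    ultimately show "\<exists>\<theta>::real. \<bar>\<theta>\<bar> \<le> 12 * pi + 32 \<and>
           approx_error (C_psi_beta_s \<psi> \<beta> s) n p =
           ereal (\<psi> (n - p + 1) / real p *
             (L_norm (conj_exponent s) cos / pi powr (1 + recip_exponent (conj_exponent s)) *
                K_const q p (conj_exponent s) +
              \<theta> * (1 / (real (n - p + 1) * (1 - q) ^ sigma_exp (conj_exponent s) p) +
                   ratio_dev \<psi> q (n - p + 1) / (1 - q)\<^sup>2 * min (real p) (1 / (1 - q)))))"
      unfolding m_def[symmetric] r_def[symmetric] e_def[symmetric] A_def[symmetric] R_def[symmetric] E(1)
      by (intro exI[of _ "(E - A) / R"]) simp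
  qed
qed

end
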